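(* For positive functions $\alpha_n$ ($n\in\mathbb N$) and $\alpha$ on $\mathbb R^d$, let $(\mathcal E^n,\mathcal F^n)$ and $(\mathcal E,\mathcal F)$ be the regular symmetric Dirichlet forms on $L^2(\mathbb R^d)$ obtained as the smallest closed extensions of $$\mathcal E^n(u,v)=\int_{\mathbb R^d}\alpha_n(x)\langle\nabla u(x),\nabla v(x)\rangle\,dx,\qquad \mathcal E(u,v)=\int_{\mathbb R^d}\alpha(x)\langle\nabla u(x),\nabla v(x)\rangle\,dx,\qquad u,v\in C_0^\infty(\mathbb R^d).$$ (i) (explosive ones to conservative one) If $\alpha_n(x)=(2+|x|)^2\bigl(\log(2+|x|)\bigr)^{1+1/n}$ and $\alpha(x)=(2+|x|)^2\log(2+|x|)$ for $n\in\mathbb N$, then $(\mathcal E^n,\mathcal F^n)$ is explosive for any $n$ and converges in the sense of Mosco to $(\mathcal E,\mathcal F)$, which is conservative. (ii) (conservative ones to explosive one) If $\alpha_n(x)=(2+|x|)^{2-1/n}\bigl(\log(2+|x|)\bigr)^2$ and $\alpha(x)=(2+|x|)^2\bigl(\log(2+|x|)\bigr)^2$ for $n\in\mathbb N$, then $(\mathcal E^n,\mathcal F^n)$ is conservative for any $n$ and converges in the sense of Mosco to $(\mathcal E,\mathcal F)$, which is explosive.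
   Context: $L^2(\mathbb R^d)=L^2(\mathbb R^d;dx)$, $dx$ Lebesgue measure; $C_0^\infty(\mathbb R^d)$ is the set of infinitely differentiable functions with compact support. A Dirichlet form with associated Markovian semigroup $\{T_t\}_{t>0}$ is conservative if $T_t1=1$ a.e. for all $t>0$, and explosive if it is not conservative. Mosco convergence: a closed form means a nonnegative definite symmetric closed form on a Hilbert space $\mathcal H$ (not necessarily densely defined), and it is extended by setting $\mathcal E(u,u)=\infty$ for $u\in\mathcal H\setminus\mathcal F$. A sequence of closed forms $\mathcal E^n$ on $\mathcal H$ converges to $\mathcal E$ in the sense of Mosco if (M1) for every $u\in\mathcal H$ and every sequence $\{u_n\}$ converging to $u$ weakly in $\mathcal H$, $\liminf_{n\to\infty}\mathcal E^n(u_n,u_n)\ge\mathcal E(u,u)$; and (M2) for every $u\in\mathcal H$ there exists a sequence $\{u_n\}$ converging to $u$ (strongly) in $\mathcal H$ such that $\limsup_{n\to\infty}\mathcal E^n(u_n,u_n)\le\mathcal E(u,u)$. Here $\mathcal H=L^2(\mathbb R^d)$. *)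

theory Defs
  imports "HOL-Analysis.Analysis"
begin

section \<open>The Hilbert space of square integrable functions\<close>

definition L2_fun :: "('a::euclidean_space \<Rightarrow> real) set" where
  "L2_fun = {f \<in> borel_measurable lborel. integrable lborel (\<lambda>x. (f x)\<^sup>2)}"

definition L2_eq :: "('a::euclidean_space \<Rightarrow> real) \<Rightarrow> ('a \<Rightarrow> real) \<Rightarrow> bool" where
  "L2_eq f g \<longleftrightarrow> f \<in> L2_fun \<and> g \<in> L2_fun \<and> (AE x in lborel. f x = g x)"

lemma L2_fun_zero: "(\<lambda>x. 0) \<in> L2_fun"
  by (simp add: L2_fun_def)

lemma L2_fun_mult_integrable:
  assumes "f \<in> L2_fun" "g \<in> L2_fun"
  shows "integrable lborel (\<lambda>x. f x * g x)"
proof (rule Bochner_Integration.integrable_bound)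
  show "integrable lborel (\<lambda>x. (f x)\<^sup>2 + (g x)\<^sup>2)"
    using assms by (simp add: L2_fun_def)
  show "(\<lambda>x. f x * g x) \<in> borel_measurable lborel"
    using assms by (auto simp: L2_fun_def)
  have "\<bar>a * b\<bar> \<le> a\<^sup>2 + b\<^sup>2" for a b :: real
  proof -
    have "0 \<le> (\<bar>a\<bar> - \<bar>b\<bar>)\<^sup>2" by simp
    then have "2 * (\<bar>a\<bar> * \<bar>b\<bar>) \<le> a\<^sup>2 + b\<^sup>2" by (simp add: power2_diff)
    moreover have "0 \<le> \<bar>a\<bar> * \<bar>b\<bar>" by simp
    ultimately show ?thesis unfolding abs_mult by linarith
  qed
  then show "AE x in lborel. norm (f x * g x) \<le> norm ((f x)\<^sup>2 + (g x)\<^sup>2)"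
    by (simp add: order_trans[OF _ abs_ge_self])
qed

lemma L2_fun_add:
  assumes "f \<in> L2_fun" "g \<in> L2_fun"
  shows "(\<lambda>x. f x + g x) \<in> L2_fun"
proof -
  have "integrable lborel (\<lambda>x. (f x)\<^sup>2 + (g x)\<^sup>2 + 2 * (f x * g x))"
    using assms L2_fun_mult_integrable[OF assms] by (simp add: L2_fun_def)
  then show ?thesis
    using assms by (auto simp: L2_fun_def power2_sum mult.assoc)
qed

lemma L2_fun_scale: "f \<in> L2_fun \<Longrightarrow> (\<lambda>x. c * f x) \<in> L2_fun"
  by (auto simp: L2_fun_def power_mult_distrib)

lemma L2_fun_diff:
  assumes "f \<in> L2_fun" "g \<in> L2_fun"
  shows "(\<lambda>x. f x - g x) \<in> L2_fun"
  using L2_fun_add[OF assms(1) L2_fun_scale[OF assms(2), of "-1"]] by simp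

quotient_type (overloaded) 'a L2 = "'a::euclidean_space \<Rightarrow> real" / partial: L2_eq
proof (rule part_equivpI)
  show "\<exists>f. L2_eq f f"
    by (rule exI[of _ "\<lambda>x. 0"]) (simp add: L2_eq_def L2_fun_zero)
  show "symp L2_eq"
    by (auto simp: symp_def L2_eq_def)
  show "transp L2_eq"
    by (auto simp: transp_def L2_eq_def elim: AE_mp)
qed

instantiation L2 :: (euclidean_space) real_inner
begin

lift_definition zero_L2 :: "'a L2" is "\<lambda>x. 0"
  by (simp add: L2_eq_def L2_fun_zero)

lift_definition plus_L2 :: "'a L2 \<Rightarrow> 'a L2 \<Rightarrow> 'a L2" is "\<lambda>f g x. f x + g x"
  by (auto simp: L2_eq_def intro: L2_fun_add)

lift_definition minus_L2 :: "'a L2 \<Rightarrow> 'a L2 \<Rightarrow> 'a L2" is "\<lambda>f g x. f x - g x"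
  by (auto simp: L2_eq_def intro: L2_fun_diff)

lift_definition uminus_L2 :: "'a L2 \<Rightarrow> 'a L2" is "\<lambda>f x. - f x"
  using L2_fun_scale[where c = "-1"] by (auto simp: L2_eq_def)

lift_definition scaleR_L2 :: "real \<Rightarrow> 'a L2 \<Rightarrow> 'a L2" is "\<lambda>c f x. c * f x"
  by (auto simp: L2_eq_def intro: L2_fun_scale)

lift_definition inner_L2 :: "'a L2 \<Rightarrow> 'a L2 \<Rightarrow> real"
  is "\<lambda>f g. \<integral>x. f x * g x \<partial>lborel"
  by (rule integral_cong_AE) (auto simp: L2_eq_def L2_fun_def)

definition norm_L2 :: "'a L2 \<Rightarrow> real" where
  "norm_L2 u = sqrt (inner u u)"

definition dist_L2 :: "'a L2 \<Rightarrow> 'a L2 \<Rightarrow> real" where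
  "dist_L2 u v = norm (u - v)"

definition sgn_L2 :: "'a L2 \<Rightarrow> 'a L2" where
  "sgn_L2 u = inverse (norm u) *\<^sub>R u"

definition uniformity_L2 :: "('a L2 \<times> 'a L2) filter" where
  "uniformity_L2 = (INF e\<in>{0<..}. principal {(u, v). dist u v < e})"

definition open_L2 :: "'a L2 set \<Rightarrow> bool" where
  "open_L2 U \<longleftrightarrow> (\<forall>u\<in>U. \<forall>\<^sub>F (u', v) in uniformity. u' = u \<longrightarrow> v \<in> U)"

instance
proof
  fix u v w :: "'a L2" and r s :: real
  show "u + v + w = u + (v + w)"
    by transfer (auto simp: L2_eq_def add.assoc intro: L2_fun_add)
  show "u + v = v + u"
    by transfer (auto simp: L2_eq_def add.commute intro: L2_fun_add)
  show "0 + u = u"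
    by transfer (auto simp: L2_eq_def)
  show "- u + u = 0"
    by transfer (auto simp: L2_eq_def L2_fun_zero)
  show "u - v = u + - v"
    by transfer (auto simp: L2_eq_def intro: L2_fun_diff)
  show "r *\<^sub>R (u + v) = r *\<^sub>R u + r *\<^sub>R v"
    by transfer (auto simp: L2_eq_def distrib_left intro: L2_fun_scale L2_fun_add)
  show "(r + s) *\<^sub>R u = r *\<^sub>R u + s *\<^sub>R u"
    by transfer (auto simp: L2_eq_def distrib_right intro: L2_fun_scale L2_fun_add)
  show "r *\<^sub>R s *\<^sub>R u = (r * s) *\<^sub>R u"
    by transfer (auto simp: L2_eq_def mult.assoc intro: L2_fun_scale)
  show "1 *\<^sub>R u = u"
    by transfer (auto simp: L2_eq_def)
  show "dist u v = norm (u - v)" by (rule dist_L2_def)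
  show "sgn u = inverse (norm u) *\<^sub>R u" by (rule sgn_L2_def)
  show "uniformity = (INF e\<in>{0<..}. principal {(u, v :: 'a L2). dist u v < e})"
    by (rule uniformity_L2_def)
  show "open U \<longleftrightarrow> (\<forall>u\<in>U. \<forall>\<^sub>F (u', v) in uniformity. u' = u \<longrightarrow> v \<in> U)" for U :: "'a L2 set"
    by (rule open_L2_def)
  show "inner u v = inner v u"
    by transfer (simp add: mult.commute)
  show "inner (u + v) w = inner u w + inner v w"
    by transfer (auto simp: L2_eq_def distrib_right L2_fun_mult_integrable)
  show "inner (r *\<^sub>R u) v = r * inner u v"
    by transfer (auto simp: mult.assoc)
  show "0 \<le> inner u u"
    by transfer simp
  show "inner u u = 0 \<longleftrightarrow> u = 0"
  proof transfer
    fix f :: "'a \<Rightarrow> real"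
    assume "L2_eq f f"
    then have f: "f \<in> L2_fun" by (simp add: L2_eq_def)
    have "(\<integral>x. f x * f x \<partial>lborel) = 0 \<longleftrightarrow> (AE x in lborel. f x * f x = 0)"
      by (rule integral_nonneg_eq_0_iff_AE) (use f in \<open>auto intro: L2_fun_mult_integrable\<close>)
    then show "(\<integral>x. f x * f x \<partial>lborel) = 0 \<longleftrightarrow> L2_eq f (\<lambda>x. 0)"
      using f by (simp add: L2_eq_def L2_fun_zero)
  qed
  show "norm u = sqrt (inner u u)" by (rule norm_L2_def)
qed

end

text \<open>The class of a function; functions that are not square integrable are sent to \<open>0\<close>.\<close>

lift_definition to_L2 :: "('a::euclidean_space \<Rightarrow> real) \<Rightarrow> 'a L2"
  is "\<lambda>f. if f \<in> L2_fun then f else (\<lambda>x. 0)"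
  by (simp add: L2_eq_def L2_fun_zero)

lemma rep_L2: "rep_L2 u \<in> L2_fun"
  using Quotient3_rep_reflp[OF Quotient3_L2, of u] by (simp add: L2_eq_def)

lemma to_L2_rep: "to_L2 (rep_L2 u) = u"
  by (simp add: to_L2_def rep_L2 Quotient3_abs_rep[OF Quotient3_L2])

lemma rep_to_L2:
  assumes "f \<in> L2_fun"
  shows "AE x in lborel. rep_L2 (to_L2 f) x = f x"
  using Quotient3_rep_abs[OF Quotient3_L2, of f] assms by (simp add: L2_eq_def to_L2_def)

lemma to_L2_diff:
  assumes "f \<in> L2_fun" "g \<in> L2_fun"
  shows "to_L2 f - to_L2 g = to_L2 (\<lambda>x. f x - g x)"
  using assms by transfer (auto simp: L2_eq_def intro: L2_fun_diff)

lemma norm_to_L2: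
  assumes "f \<in> L2_fun"
  shows "(norm (to_L2 f))\<^sup>2 = (\<integral>x. (f x)\<^sup>2 \<partial>lborel)"
  unfolding power2_norm_eq_inner using assms by transfer (simp add: power2_eq_square)

instance L2 :: (euclidean_space) complete_space
proof
  fix X :: "nat \<Rightarrow> 'a L2"
  assume X: "Cauchy X"
  have "\<forall>k. \<exists>N. \<forall>m\<ge>N. \<forall>n\<ge>N. norm (X m - X n) < (1/4) ^ k"
    using X by (simp add: Cauchy_def dist_norm)
  then obtain N where N: "\<And>k m n. m \<ge> N k \<Longrightarrow> n \<ge> N k \<Longrightarrow> norm (X m - X n) < (1/4) ^ k"
    by metis
  define r where "r k = (\<Sum>i\<le>k. N i) + k" for k
  have r: "strict_mono r"
    by (rule strict_mono_Suc_iff[THEN iffD2]) (simp add: r_def)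
  have r_ge: "N k \<le> r j" if "k \<le> j" for k j
    using member_le_sum[of k "{..j}" N] that by (simp add: r_def)
  define f where "f k = rep_L2 (X (r k))" for k
  have f: "f k \<in> L2_fun" for k
    by (simp add: f_def rep_L2)
  have [measurable]: "f k \<in> borel_measurable borel" for k
    using f[of k] by (simp add: L2_fun_def)
  have to_L2_f: "to_L2 (f k) = X (r k)" for k
    by (simp add: f_def to_L2_rep)
  have nn: "(\<integral>\<^sup>+x. ennreal ((f j x - f k x)\<^sup>2) \<partial>lborel) = ennreal ((norm (X (r j) - X (r k)))\<^sup>2)" for j k
  proof -
    have d: "(\<lambda>x. f j x - f k x) \<in> L2_fun"
      by (intro L2_fun_diff f)
    then have "(\<integral>\<^sup>+x. ennreal ((f j x - f k x)\<^sup>2) \<partial>lborel) = ennreal (\<integral>x. (f j x - f k x)\<^sup>2 \<partial>lborel)"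
      by (intro nn_integral_eq_integral) (auto simp: L2_fun_def)
    then show ?thesis
      using norm_to_L2[OF d] by (simp add: to_L2_diff[symmetric] f to_L2_f)
  qed
  have "(\<integral>\<^sup>+x. (\<Sum>k. ennreal (4 ^ k * (f (Suc k) x - f k x)\<^sup>2)) \<partial>lborel)
      = (\<Sum>k. \<integral>\<^sup>+x. ennreal (4 ^ k * (f (Suc k) x - f k x)\<^sup>2) \<partial>lborel)"
    by (rule nn_integral_suminf) simp
  also have "\<dots> \<le> (\<Sum>k. ennreal ((1/4) ^ k))"
  proof (intro suminf_le summableI)
    fix k
    have "(norm (X (r (Suc k)) - X (r k)))\<^sup>2 \<le> ((1/4) ^ k)\<^sup>2"
      by (rule power_mono[OF less_imp_le[OF N[OF r_ge r_ge]]]) simp_all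
    also have "\<dots> = (1/16) ^ k"
      by (simp add: power2_eq_square power_mult_distrib[symmetric])
    finally have "4 ^ k * (norm (X (r (Suc k)) - X (r k)))\<^sup>2 \<le> 4 ^ k * (1/16) ^ k"
      by simp
    also have "\<dots> = (1/4) ^ k"
      by (simp add: power_mult_distrib[symmetric])
    finally have "ennreal (4 ^ k * (norm (X (r (Suc k)) - X (r k)))\<^sup>2) \<le> ennreal ((1/4) ^ k)"
      by (rule ennreal_leI)
    then show "(\<integral>\<^sup>+x. ennreal (4 ^ k * (f (Suc k) x - f k x)\<^sup>2) \<partial>lborel) \<le> ennreal ((1/4) ^ k)"
      by (simp add: ennreal_mult nn_integral_cmult nn)
  qed
  also have "\<dots> < \<infinity>"
    using summable_geometric[of "1/4 :: real"]
    by (simp add: suminf_ennreal2 ennreal_less_top)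
  finally have "(\<integral>\<^sup>+x. (\<Sum>k. ennreal (4 ^ k * (f (Suc k) x - f k x)\<^sup>2)) \<partial>lborel) \<noteq> \<infinity>"
    by simp
  then have "AE x in lborel. (\<Sum>k. ennreal (4 ^ k * (f (Suc k) x - f k x)\<^sup>2)) \<noteq> \<infinity>"
    by (intro nn_integral_PInf_AE) simp_all
  then have conv: "AE x in lborel. (\<lambda>k. f k x) \<longlonglongrightarrow> lim (\<lambda>k. f k x)"
  proof eventually_elim
    case (elim x)
    then have "summable (\<lambda>k. 4 ^ k * (f (Suc k) x - f k x)\<^sup>2)"
      by (intro summable_suminf_not_top) auto
    then have "Bseq (\<lambda>k. 4 ^ k * (f (Suc k) x - f k x)\<^sup>2)"
      using summable_LIMSEQ_zero convergentI convergent_imp_Bseq by blast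
    then obtain C where C: "C > 0" "\<And>k. norm (4 ^ k * (f (Suc k) x - f k x)\<^sup>2) \<le> C"
      by (auto simp: Bseq_def)
    have "summable (\<lambda>k. f (Suc k) x - f k x)"
    proof (rule summable_comparison_test'[of "\<lambda>k. sqrt C * (1/2) ^ k" 0])
      show "summable (\<lambda>k. sqrt C * (1/2) ^ k)"
        by (intro summable_mult summable_geometric) simp
      fix k
      have "(4 :: real) ^ k = (2 ^ k)\<^sup>2"
        by (simp add: power2_eq_square power_mult_distrib[symmetric])
      then have "(2 ^ k * \<bar>f (Suc k) x - f k x\<bar>)\<^sup>2 \<le> C"
        using C(2)[of k] by (simp add: power_mult_distrib)
      then have "2 ^ k * \<bar>f (Suc k) x - f k x\<bar> \<le> sqrt C"
        by (rule real_le_rsqrt)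
      then show "norm (f (Suc k) x - f k x) \<le> sqrt C * (1/2) ^ k"
        by (simp add: power_one_over field_simps)
    qed
    then have "convergent (\<lambda>n. f n x - f 0 x)"
      by (simp add: summable_iff_convergent sum_lessThan_telescope[of "\<lambda>n. f n x"])
    then have "convergent (\<lambda>n. f n x)"
      using convergent_diff_const_right_iff[of "\<lambda>n. f n x" "f 0 x"] by simp
    then show ?case
      by (simp add: convergent_LIMSEQ_iff)
  qed
  define F where "F x = lim (\<lambda>k. f k x)" for x
  have [measurable]: "F \<in> borel_measurable borel"
    unfolding F_def by measurable
  have le: "(\<integral>\<^sup>+x. ennreal ((F x - f n x)\<^sup>2) \<partial>lborel) \<le> ennreal (e\<^sup>2)"
    if "\<And>k. k \<ge> n \<Longrightarrow> norm (X (r k) - X (r n)) \<le> e" for n e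
  proof -
    have "(\<integral>\<^sup>+x. ennreal ((F x - f n x)\<^sup>2) \<partial>lborel)
        = (\<integral>\<^sup>+x. liminf (\<lambda>k. ennreal ((f k x - f n x)\<^sup>2)) \<partial>lborel)"
    proof (rule nn_integral_cong_AE, use conv in eventually_elim)
      case (elim x)
      have "(\<lambda>k. ennreal ((f k x - f n x)\<^sup>2)) \<longlonglongrightarrow> ennreal ((F x - f n x)\<^sup>2)"
        using elim unfolding F_def by (intro tendsto_ennrealI tendsto_intros)
      then show ?case
        by (rule lim_imp_Liminf[OF trivial_limit_sequentially, symmetric])
    qed
    also have "\<dots> \<le> liminf (\<lambda>k. \<integral>\<^sup>+x. ennreal ((f k x - f n x)\<^sup>2) \<partial>lborel)"
      by (rule nn_integral_liminf) simp
    also have "\<dots> \<le> liminf (\<lambda>k. ennreal (e\<^sup>2))"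
      by (intro Liminf_mono eventually_sequentiallyI[of n])
        (auto simp: nn intro!: ennreal_leI power_mono that)
    finally show ?thesis
      by (simp add: Liminf_const)
  qed
  have L2_le: "(\<lambda>x. F x - f n x) \<in> L2_fun \<and> norm (to_L2 (\<lambda>x. F x - f n x)) \<le> e"
    if "\<And>k. k \<ge> n \<Longrightarrow> norm (X (r k) - X (r n)) \<le> e" "0 \<le> e" for n e
  proof
    have fin: "(\<integral>\<^sup>+x. ennreal ((F x - f n x)\<^sup>2) \<partial>lborel) < \<infinity>"
      using le[OF that(1)] by (rule le_less_trans) (simp_all add: ennreal_less_top)
    then have int: "integrable lborel (\<lambda>x. (F x - f n x)\<^sup>2)"
      by (intro integrableI_nonneg) auto
    then show mem: "(\<lambda>x. F x - f n x) \<in> L2_fun"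
      by (simp add: L2_fun_def)
    have "ennreal (\<integral>x. (F x - f n x)\<^sup>2 \<partial>lborel) \<le> ennreal (e\<^sup>2)"
      using le[OF that(1)] nn_integral_eq_integral[OF int] by simp
    then have "(norm (to_L2 (\<lambda>x. F x - f n x)))\<^sup>2 \<le> e\<^sup>2"
      by (simp add: norm_to_L2[OF mem])
    then show "norm (to_L2 (\<lambda>x. F x - f n x)) \<le> e"
      using that(2) by (rule power2_le_imp_le)
  qed
  have "(\<lambda>x. F x - f 0 x) \<in> L2_fun"
  proof -
    obtain M where "\<And>k. k \<ge> M \<Longrightarrow> norm (X (r k) - X (r M)) \<le> 1"
      using N[of 0] r_ge[of 0] by (metis le0 less_imp_le power_0)
    then have "(\<lambda>x. F x - f M x) \<in> L2_fun"
      using L2_le[of M 1] by simp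
    from L2_fun_add[OF this L2_fun_diff[OF f[of M] f[of 0]]] show ?thesis
      by simp
  qed
  from L2_fun_add[OF this f[of 0]] have F: "F \<in> L2_fun"
    by simp
  have "(X \<circ> r) \<longlonglongrightarrow> to_L2 F"
  proof (rule LIMSEQ_I)
    fix e :: real
    assume "0 < e"
    with X obtain M where M: "\<And>m n. m \<ge> M \<Longrightarrow> n \<ge> M \<Longrightarrow> norm (X m - X n) < e / 2"
      unfolding Cauchy_def dist_norm by (meson half_gt_zero)
    have "norm ((X \<circ> r) n - to_L2 F) < e" if "n \<ge> M" for n
    proof -
      have "norm (X (r k) - X (r n)) \<le> e / 2" if "k \<ge> n" for k
        using that \<open>n \<ge> M\<close> seq_suble[OF r] by (meson M less_imp_le order_trans)
      then have "norm (to_L2 F - to_L2 (f n)) \<le> e / 2"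
        using L2_le[of n "e / 2"] \<open>0 < e\<close> by (simp add: to_L2_diff F f)
      then show ?thesis
        using \<open>0 < e\<close> by (simp add: to_L2_f norm_minus_commute)
    qed
    then show "\<exists>n0. \<forall>n\<ge>n0. norm ((X \<circ> r) n - to_L2 F) < e"
      by blast
  qed
  with X r show "convergent X"
    by (meson Cauchy_converges_subseq convergentI)
qed


section \<open>Closed forms on a Hilbert space\<close>

definition symmetric_form ::
  "('h::{real_inner,complete_space} \<Rightarrow> 'h \<Rightarrow> real) \<Rightarrow> 'h set \<Rightarrow> bool" where
  "symmetric_form E F \<longleftrightarrow>
     subspace F \<and>
     (\<forall>u\<in>F. \<forall>v\<in>F. E u v = E v u) \<and>
     (\<forall>u\<in>F. \<forall>v\<in>F. \<forall>w\<in>F. E (u + v) w = E u w + E v w) \<and>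
     (\<forall>c. \<forall>u\<in>F. \<forall>v\<in>F. E (c *\<^sub>R u) v = c * E u v) \<and>
     (\<forall>u\<in>F. 0 \<le> E u u)"

definition form1 ::
  "('h::{real_inner,complete_space} \<Rightarrow> 'h \<Rightarrow> real) \<Rightarrow> 'h \<Rightarrow> 'h \<Rightarrow> real" where
  "form1 E u v = E u v + inner u v"

definition closed_form ::
  "('h::{real_inner,complete_space} \<Rightarrow> 'h \<Rightarrow> real) \<Rightarrow> 'h set \<Rightarrow> bool" where
  "closed_form E F \<longleftrightarrow>
     symmetric_form E F \<and>
     (\<forall>u. (\<forall>n::nat. u n \<in> F) \<longrightarrow>
        (\<forall>e>0. \<exists>N. \<forall>m\<ge>N. \<forall>n\<ge>N. form1 E (u m - u n) (u m - u n) < e) \<longrightarrow>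
        (\<exists>v\<in>F. (\<lambda>n. form1 E (u n - v) (u n - v)) \<longlonglongrightarrow> 0))"

definition extended_form ::
  "('h::{real_inner,complete_space} \<Rightarrow> 'h \<Rightarrow> real) \<Rightarrow> 'h set \<Rightarrow> 'h \<Rightarrow> ereal" where
  "extended_form E F u = (if u \<in> F then ereal (E u u) else \<infinity>)"

definition weakly_converges :: "(nat \<Rightarrow> 'h::{real_inner,complete_space}) \<Rightarrow> 'h \<Rightarrow> bool" where
  "weakly_converges u v \<longleftrightarrow> (\<forall>w. (\<lambda>n. inner (u n) w) \<longlonglongrightarrow> inner v w)"

definition mosco_converges ::
  "(nat \<Rightarrow> 'h::{real_inner,complete_space} \<Rightarrow> 'h \<Rightarrow> real) \<Rightarrow> (nat \<Rightarrow> 'h set) \<Rightarrow>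
   ('h \<Rightarrow> 'h \<Rightarrow> real) \<Rightarrow> 'h set \<Rightarrow> bool" where
  "mosco_converges En Fn E F \<longleftrightarrow>
     (\<forall>u un. weakly_converges un u \<longrightarrow>
        liminf (\<lambda>n. extended_form (En n) (Fn n) (un n)) \<ge> extended_form E F u) \<and>
     (\<forall>u. \<exists>un. un \<longlonglongrightarrow> u \<and>
        limsup (\<lambda>n. extended_form (En n) (Fn n) (un n)) \<le> extended_form E F u)"


section \<open>The semigroup of a closed form\<close>

definition contraction_semigroup ::
  "(real \<Rightarrow> 'h::{real_inner,complete_space} \<Rightarrow> 'h) \<Rightarrow> bool" where
  "contraction_semigroup T \<longleftrightarrow>
     (\<forall>t>0. linear (T t) \<and> (\<forall>u v. inner (T t u) v = inner u (T t v)) \<and>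
        (\<forall>u. norm (T t u) \<le> norm u)) \<and>
     (\<forall>s>0. \<forall>t>0. \<forall>u. T s (T t u) = T (s + t) u) \<and>
     (\<forall>u. ((\<lambda>t. T t u) \<longlongrightarrow> u) (at_right 0))"

text \<open>Unbounded operators are identified with their graphs.\<close>

definition semigroup_generator ::
  "(real \<Rightarrow> 'h::{real_inner,complete_space} \<Rightarrow> 'h) \<Rightarrow> ('h \<times> 'h) set" where
  "semigroup_generator T = {(u, f). ((\<lambda>t. (T t u - u) /\<^sub>R t) \<longlongrightarrow> f) (at_right 0)}"

definition form_generator ::
  "('h::{real_inner,complete_space} \<Rightarrow> 'h \<Rightarrow> real) \<Rightarrow> 'h set \<Rightarrow> ('h \<times> 'h) set" where
  "form_generator E F = {(u, f). u \<in> F \<and> (\<forall>v\<in>F. E u v = - inner f v)}"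

text \<open>For a densely defined closed form the generator is self-adjoint and nonpositive, so the
  semigroup exists and is determined at all times \<open>t > 0\<close>; only its values at \<open>t \<le> 0\<close>
  depend on the choice.\<close>

definition form_semigroup ::
  "('h::{real_inner,complete_space} \<Rightarrow> 'h \<Rightarrow> real) \<Rightarrow> 'h set \<Rightarrow> real \<Rightarrow> 'h \<Rightarrow> 'h" where
  "form_semigroup E F =
     (SOME T. contraction_semigroup T \<and> semigroup_generator T = form_generator E F)"


section \<open>Dirichlet forms\<close>

definition dirichlet_form ::
  "('a::euclidean_space L2 \<Rightarrow> 'a L2 \<Rightarrow> real) \<Rightarrow> 'a L2 set \<Rightarrow> bool" where
  "dirichlet_form E F \<longleftrightarrow>
     closed_form E F \<and> closure F = UNIV \<and>
     (\<forall>u\<in>F. let v = to_L2 (\<lambda>x. min (max (rep_L2 u x) 0) 1) in v \<in> F \<and> E v v \<le> E u u)"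

definition C_c :: "('a::euclidean_space \<Rightarrow> real) set" where
  "C_c = {f. continuous_on UNIV f \<and> compact (closure {x. f x \<noteq> 0})}"

definition regular_form ::
  "('a::euclidean_space L2 \<Rightarrow> 'a L2 \<Rightarrow> real) \<Rightarrow> 'a L2 set \<Rightarrow> bool" where
  "regular_form E F \<longleftrightarrow>
     (\<forall>u\<in>F. \<forall>e>0. \<exists>f\<in>C_c. to_L2 f \<in> F \<and> form1 E (u - to_L2 f) (u - to_L2 f) < e) \<and>
     (\<forall>g\<in>C_c. \<forall>e>0. \<exists>f\<in>C_c. to_L2 f \<in> F \<and> (\<forall>x. \<bar>g x - f x\<bar> < e))"

text \<open>A Markovian operator \<open>S\<close> on the square integrable functions extends to bounded functions
  by applying it to truncations; by positivity the truncations of a nonnegative function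
  give an a.e. increasing, hence a.e. convergent, sequence.\<close>

definition bounded_extension ::
  "('a::euclidean_space L2 \<Rightarrow> 'a L2) \<Rightarrow> ('a \<Rightarrow> real) \<Rightarrow> 'a \<Rightarrow> real" where
  "bounded_extension S f x =
     lim (\<lambda>k. rep_L2 (S (to_L2 (\<lambda>y. indicator (ball 0 (real k)) y * f y))) x)"

definition conservative ::
  "('a::euclidean_space L2 \<Rightarrow> 'a L2 \<Rightarrow> real) \<Rightarrow> 'a L2 set \<Rightarrow> bool" where
  "conservative E F \<longleftrightarrow>
     (\<forall>t>0. AE x in lborel. bounded_extension (form_semigroup E F t) (\<lambda>_. 1) x = 1)"

definition explosive ::
  "('a::euclidean_space L2 \<Rightarrow> 'a L2 \<Rightarrow> real) \<Rightarrow> 'a L2 set \<Rightarrow> bool" where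
  "explosive E F \<longleftrightarrow> \<not> conservative E F"


section \<open>Energy forms\<close>

fun C_k :: "nat \<Rightarrow> ('a::euclidean_space \<Rightarrow> real) \<Rightarrow> bool" where
  "C_k 0 f \<longleftrightarrow> continuous_on UNIV f"
| "C_k (Suc k) f \<longleftrightarrow>
     (\<forall>x. f differentiable at x) \<and>
     (\<forall>b\<in>Basis. C_k k (\<lambda>x. frechet_derivative f (at x) b))"

definition C_c_infinity :: "('a::euclidean_space \<Rightarrow> real) set" where
  "C_c_infinity = {f. (\<forall>k. C_k k f) \<and> compact (closure {x. f x \<noteq> 0})}"

definition gradient :: "('a::euclidean_space \<Rightarrow> real) \<Rightarrow> 'a \<Rightarrow> 'a" where
  "gradient f x = (\<Sum>b\<in>Basis. frechet_derivative f (at x) b *\<^sub>R b)"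

definition energy ::
  "('a::euclidean_space \<Rightarrow> real) \<Rightarrow> ('a \<Rightarrow> real) \<Rightarrow> ('a \<Rightarrow> real) \<Rightarrow> real" where
  "energy \<alpha> u v = (\<integral>x. \<alpha> x * inner (gradient u x) (gradient v x) \<partial>lborel)"

definition closed_energy_extension ::
  "('a::euclidean_space \<Rightarrow> real) \<Rightarrow> ('a L2 \<Rightarrow> 'a L2 \<Rightarrow> real) \<Rightarrow> 'a L2 set \<Rightarrow> bool" where
  "closed_energy_extension \<alpha> E F \<longleftrightarrow>
     closed_form E F \<and>
     (\<forall>u\<in>C_c_infinity. to_L2 u \<in> F) \<and>
     (\<forall>u\<in>C_c_infinity. \<forall>v\<in>C_c_infinity. E (to_L2 u) (to_L2 v) = energy \<alpha> u v)"

definition smallest_closed_energy_extension ::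
  "('a::euclidean_space \<Rightarrow> real) \<Rightarrow> ('a L2 \<Rightarrow> 'a L2 \<Rightarrow> real) \<Rightarrow> 'a L2 set \<Rightarrow> bool" where
  "smallest_closed_energy_extension \<alpha> E F \<longleftrightarrow>
     closed_energy_extension \<alpha> E F \<and>
     (\<forall>E' F'. closed_energy_extension \<alpha> E' F' \<longrightarrow>
        F \<subseteq> F' \<and> (\<forall>u\<in>F. \<forall>v\<in>F. E' u v = E u v))"

end

theory Submission
  imports Defs "HOL-Real_Asymp.Real_Asymp"
begin

text \<open>
  With \<open>a(r)\<close> the radial weight, conservativeness is governed by the divergence of \<open>\<integral> r / a(r) dr\<close>.
  If \<open>a(r)\<close> is at most of order \<open>r\<^sup>2 ln r\<close>, the cut-offs \<open>\<phi>(\<epsilon> ln ln |x|)\<close> lie in the domain of the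
  generator \<open>L\<close> and \<open>L \<phi>\<close> is uniformly small, so \<open>T t \<phi> \<ge> \<phi> - t sup |L \<phi>|\<close> forces \<open>T t 1 = 1\<close>. If
  \<open>a(r) = r\<^sup>2 (ln r)\<^bsup>1+d\<^esup>\<close>, a power of \<open>1 / ln |x|\<close> is a bounded supersolution vanishing at infinity, and
  the maximum principle for the resolvent contradicts \<open>T t 1 = 1\<close>.

  Mosco convergence: the upper bound follows from a diagonal argument in the core of test functions.
  The lower bound is weak lower semicontinuity of a single closed form; in (i) because
  \<open>\<alpha> \<le> c\<^sub>n \<alpha>\<^sub>n\<close> with \<open>c\<^sub>n \<rightarrow> 1\<close>, in (ii) because the forms increase and cut-offs of small energy identify
  the monotone limit.

  The semigroup of a form is specified only through its generator: it exists as a limit of backward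
  Euler steps, and every semigroup with that generator is such a limit, hence Markovian.
\<close>

section \<open>Resolvent and semigroup of a closed form\<close>

text \<open>The domains are known only through minimality among closed extensions, so no Sobolev
  description is at hand: a statement about a general element of \<open>F\<close> is checked on test
  functions and carried over by closedness or lower semicontinuity. For the same reason
  vector-valued integrals are replaced by averages in closed convex sets, and weak derivatives by
  smooth approximations. The basic object is the implicit step (I - hL)^{-1} of length h, which a
  variational problem provides for every closed form. The auxiliary functions depend on 4 + |x|^2
  and not on 2 + |x|: this makes them smooth at the origin, and as 4 > e the logarithm is at least
  1, so that ln ln is defined and nonnegative everywhere. In (ii) the monotone limit of increasing
  forms could have a domain larger than the closure of the test functions; excluding this is where
  the size of the cut-offs enters a second time, now through their energy instead of their
  generator.\<close>

lemma power2_le_of_quadratic_nonneg: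
  fixes a b c :: real
  assumes "\<And>t. 0 \<le> a + 2 * b * t + c * t\<^sup>2"
  shows "b\<^sup>2 \<le> a * c"
proof (cases "c = 0")
  case True
  have "b = 0"
  proof (rule ccontr)
    assume "b \<noteq> 0"
    then show False
      using assms[of "- (a + 1) / (2 * b)"] True by simp
  qed
  then show ?thesis using True by simp
next
  case False
  have "0 \<le> a" using assms[of 0] by simp
  have c: "c > 0"
  proof (rule ccontr)
    assume "\<not> c > 0"
    with False have "c < 0" by simp
    \<comment> \<open>For c < 0 this point is at least 1 and satisfies
      \<open>c * t = c - (a + 2 * \<bar>b\<bar>)\<close>, which is negative enough to make the
      quadratic negative.\<close>
    define t where "t = 1 + (a + 2 * \<bar>b\<bar>) / (-c)"
    have t1: "t \<ge> 1" using \<open>c < 0\<close> \<open>0 \<le> a\<close> by (simp add: t_def divide_nonneg_neg divide_le_0_iff)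
    have ct: "c * t = c - (a + 2 * \<bar>b\<bar>)" using \<open>c < 0\<close> by (simp add: t_def field_simps)
    have "a + 2 * b * t + c * t\<^sup>2 = a + (2 * b + c * t) * t" by (simp add: power2_eq_square algebra_simps)
    also have "\<dots> \<le> a + (c - a) * t"
      by (intro add_left_mono mult_right_mono) (use ct t1 in auto)
    also have "\<dots> \<le> a + (c - a) * 1"
      using \<open>c < 0\<close> \<open>0 \<le> a\<close> t1 by (intro add_left_mono mult_left_mono_neg) auto
    also have "\<dots> < 0" using \<open>c < 0\<close> by simp
    finally show False using assms[of t] by simp
  qed
  have "0 \<le> a + 2 * b * (- b / c) + c * (- b / c)\<^sup>2" by (rule assms)
  also have "\<dots> = a - b\<^sup>2 / c" using c by (simp add: field_simps power2_eq_square)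
  finally show ?thesis using c by (simp add: field_simps)
qed

text \<open>The explicit bound is kept beside the Cauchy property: with \<open>n = 0\<close> it
  later compares the limit of the Euler scheme with its very first step.\<close>

lemma Cauchy_of_geometric_steps:
  fixes X :: "nat \<Rightarrow> 'a::real_normed_vector"
  assumes step: "\<And>n. norm (X (Suc n) - X n) \<le> C * (1/2) ^ n"
  shows "norm (X (n + m) - X n) \<le> 2 * C * (1/2) ^ n" "Cauchy X"
proof -
  have C0: "0 \<le> C" using order_trans[OF norm_ge_zero step[of 0]] by simp
  \<comment> \<open>Subtracting the tail of the geometric series is what makes the induction on m
    close.\<close>
  have *: "norm (X (n + m) - X n) \<le> 2 * C * (1/2) ^ n - 2 * C * (1/2) ^ (n + m)" for n m
  proof (induction m)
    case (Suc m)
    have "norm (X (n + Suc m) - X n) \<le> norm (X (Suc (n + m)) - X (n + m)) + norm (X (n + m) - X n)"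
      using norm_triangle_ineq[of "X (Suc (n + m)) - X (n + m)" "X (n + m) - X n"] by simp
    also have "\<dots> \<le> C * (1/2) ^ (n + m) + (2 * C * (1/2) ^ n - 2 * C * (1/2) ^ (n + m))"
      using step Suc by (intro add_mono) auto
    finally show ?case by (simp add: field_simps)
  qed simp
  have **: "norm (X (n + m) - X n) \<le> 2 * C * (1/2) ^ n" for n m
    using *[of n m] C0 by (smt (verit) mult_nonneg_nonneg zero_le_power half_gt_zero_iff)
  then show "norm (X (n + m) - X n) \<le> 2 * C * (1/2) ^ n" .
  have lim: "(\<lambda>n. 2 * C * (1/2) ^ n) \<longlonglongrightarrow> 0"
    by (rule tendsto_mult_right_zero) (rule LIMSEQ_power_zero, simp)
  show "Cauchy X"
  proof (rule metric_CauchyI)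
    fix e :: real assume "0 < e"
    then have "\<forall>\<^sub>F n in sequentially. 2 * C * (1/2) ^ n < e / 2"
      using order_tendstoD(2)[OF lim, of "e / 2"] by simp
    then obtain N where N: "2 * C * (1/2) ^ N < e / 2" by (auto simp: eventually_sequentially)
    have "dist (X m) (X N) < e / 2" if "m \<ge> N" for m
      using **[of N "m - N"] N that by (simp add: dist_norm)
    then have "dist (X m) (X n) < e" if "m \<ge> N" "n \<ge> N" for m n
      using dist_triangle_half_r[of "X N" "X m" e "X n"] that by (metis dist_commute)
    then show "\<exists>M. \<forall>m\<ge>M. \<forall>n\<ge>M. dist (X m) (X n) < e" by blast
  qed
qed

text \<open>Stability plus consistency: local errors are measured only along the orbit of
  \<open>Q\<close>, which can stay inside the domain of a generator, and the contraction
  \<open>P\<close> carries them forward without growth.\<close>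

lemma norm_funpow_diff_le:
  fixes P Q :: "'a::real_normed_vector \<Rightarrow> 'a"
  assumes "linear P" "\<And>x. norm (P x) \<le> norm x"
    and "\<And>i. i < n \<Longrightarrow> norm (P ((Q ^^ i) u) - Q ((Q ^^ i) u)) \<le> c"
  shows "norm ((P ^^ n) u - (Q ^^ n) u) \<le> real n * c"
  using assms(3)
proof (induction n)
  case (Suc n)
  have "norm ((P ^^ Suc n) u - (Q ^^ Suc n) u)
    = norm (P ((P ^^ n) u - (Q ^^ n) u) + (P ((Q ^^ n) u) - Q ((Q ^^ n) u)))"
    by (simp add: linear_diff[OF assms(1)])
  also have "\<dots> \<le> norm (P ((P ^^ n) u - (Q ^^ n) u)) + norm (P ((Q ^^ n) u) - Q ((Q ^^ n) u))"
    by (rule norm_triangle_ineq)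
  also have "\<dots> \<le> real n * c + c"
    using assms(2)[of "(P ^^ n) u - (Q ^^ n) u"] Suc by (intro add_mono) force+
  finally show ?case by (simp add: algebra_simps)
qed simp

lemma linear_funpow: "linear (P :: 'a::real_vector \<Rightarrow> 'a) \<Longrightarrow> linear (P ^^ n)"
  by (induction n) (auto intro: linear_compose simp: linear_id o_def[symmetric])

lemma norm_funpow_le:
  fixes P :: "'a::real_normed_vector \<Rightarrow> 'a"
  assumes "\<And>x. norm (P x) \<le> norm x"
  shows "norm ((P ^^ n) x) \<le> norm x"
  by (induction n) (auto intro: order_trans[OF assms])

lemma continuous_on_linear_contraction:
  fixes P :: "'a::real_normed_vector \<Rightarrow> 'a"
  assumes "linear P" "\<And>x. norm (P x) \<le> norm x"
  shows "continuous_on UNIV P"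
proof (rule continuous_onI)
  fix x :: 'a and e :: real assume "0 < e"
  then show "\<exists>d>0. \<forall>x'\<in>UNIV. dist x' x < d \<longrightarrow> dist (P x') (P x) \<le> e"
    using assms(2) by (intro exI[of _ e])
      (auto simp: dist_norm linear_diff[OF assms(1), symmetric] intro: order_trans less_imp_le)
qed

text \<open>Uniform contractivity reduces strong convergence to a dense set. Generators give rates
  only on their domains, so several limits below are obtained in this way.\<close>

lemma tendsto_dense_contraction:
  fixes A :: "'i \<Rightarrow> 'a::real_normed_vector \<Rightarrow> 'a"
  assumes lin: "eventually (\<lambda>i. linear (A i) \<and> (\<forall>x. norm (A i x) \<le> norm x)) G"
    and T: "linear T" "\<And>x. norm (T x) \<le> norm x"
    and D: "closure D = UNIV" and conv: "\<And>x. x \<in> D \<Longrightarrow> ((\<lambda>i. A i x) \<longlongrightarrow> T x) G"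
  shows "((\<lambda>i. A i u) \<longlongrightarrow> T u) G"
proof (rule tendstoI)
  fix e :: real assume e: "0 < e"
  obtain x where x: "x \<in> D" "dist x u < e / 3"
    using D e by (metis UNIV_I closure_approachable divide_pos_pos zero_less_numeral)
  have "eventually (\<lambda>i. dist (A i x) (T x) < e / 3) G"
    using tendstoD[OF conv[OF x(1)], of "e / 3"] e by simp
  with lin show "eventually (\<lambda>i. dist (A i u) (T u) < e) G"
  proof eventually_elim
    case (elim i)
    have "A i u - T u = A i (u - x) + (A i x - T x) + T (x - u)"
      using elim T by (simp add: linear_diff)
    also have "norm \<dots> \<le> norm (A i (u - x)) + norm (A i x - T x) + norm (T (x - u))"
      by (intro order_trans[OF norm_triangle_ineq] add_mono order_refl)
    also have "\<dots> \<le> norm (u - x) + norm (A i x - T x) + norm (x - u)"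
      using elim T by (intro add_mono) auto
    also have "\<dots> < e" using x elim by (simp add: dist_norm norm_minus_commute)
    finally show ?case by (simp add: dist_norm)
  qed
qed

section \<open>Resolvents of a densely defined closed form\<close>

locale closed_dense_form =
  fixes E :: "'h::{real_inner,complete_space} \<Rightarrow> 'h \<Rightarrow> real" and F :: "'h set"
  assumes closed: "closed_form E F" and dense: "closure F = UNIV"
begin

lemma form: "symmetric_form E F" using closed by (simp add: closed_form_def)

lemma subspace: "subspace F" using form by (simp add: symmetric_form_def)

lemma mem [simp]:
  "0 \<in> F" "u \<in> F \<Longrightarrow> v \<in> F \<Longrightarrow> u + v \<in> F" "u \<in> F \<Longrightarrow> v \<in> F \<Longrightarrow> u - v \<in> F"
  "u \<in> F \<Longrightarrow> c *\<^sub>R u \<in> F" "u \<in> F \<Longrightarrow> - u \<in> F"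
  using subspace by (auto intro: subspace_0 subspace_add subspace_diff subspace_scale subspace_neg)

lemma form_sym: "u \<in> F \<Longrightarrow> v \<in> F \<Longrightarrow> E u v = E v u"
  using form by (simp add: symmetric_form_def)

lemma add_left: "u \<in> F \<Longrightarrow> v \<in> F \<Longrightarrow> w \<in> F \<Longrightarrow> E (u + v) w = E u w + E v w"
  using form unfolding symmetric_form_def by blast

lemma scale_left: "u \<in> F \<Longrightarrow> v \<in> F \<Longrightarrow> E (c *\<^sub>R u) v = c * E u v"
  using form unfolding symmetric_form_def by blast

lemma nonneg [simp]: "u \<in> F \<Longrightarrow> 0 \<le> E u u"
  using form by (simp add: symmetric_form_def)

lemma add_right: "u \<in> F \<Longrightarrow> v \<in> F \<Longrightarrow> w \<in> F \<Longrightarrow> E w (u + v) = E w u + E w v"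
  by (metis add_left form_sym mem(2))

lemma scale_right: "u \<in> F \<Longrightarrow> v \<in> F \<Longrightarrow> E v (c *\<^sub>R u) = c * E v u"
  by (metis scale_left form_sym mem(4))

lemma diff_left: "u \<in> F \<Longrightarrow> v \<in> F \<Longrightarrow> w \<in> F \<Longrightarrow> E (u - v) w = E u w - E v w"
  using add_left[of u "(-1) *\<^sub>R v" w] scale_left[of v w "-1"] by simp

lemma diff_right: "u \<in> F \<Longrightarrow> v \<in> F \<Longrightarrow> w \<in> F \<Longrightarrow> E w (u - v) = E w u - E w v"
  by (metis diff_left form_sym mem(3))

lemmas bilin = add_left add_right scale_left scale_right diff_left diff_right

lemma Cauchy_Schwarz:
  assumes "u \<in> F" "v \<in> F"
  shows "(E u v)\<^sup>2 \<le> E u u * E v v"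
proof (rule power2_le_of_quadratic_nonneg)
  fix t :: real
  have "0 \<le> E (u + t *\<^sub>R v) (u + t *\<^sub>R v)" using assms by simp
  also have "\<dots> = E u u + 2 * E u v * t + E v v * t\<^sup>2"
    using assms by (simp add: bilin form_sym[of v u] power2_eq_square algebra_simps)
  finally show "0 \<le> E u u + 2 * E u v * t + E v v * t\<^sup>2" .
qed

lemma form_tendsto_0:
  assumes "u \<in> F" "\<And>n. y n \<in> F" "(\<lambda>n. E (y n) (y n)) \<longlonglongrightarrow> 0"
  shows "(\<lambda>n. E u (y n)) \<longlonglongrightarrow> 0"
proof -
  have "(\<lambda>n. E u u * E (y n) (y n)) \<longlonglongrightarrow> 0"
    using tendsto_mult_right_zero[OF assms(3)] by simp
  then have "(\<lambda>n. (E u (y n))\<^sup>2) \<longlonglongrightarrow> 0"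
    by (rule tendsto_sandwich[OF _ _ tendsto_const, rotated 2])
      (use assms Cauchy_Schwarz in auto)
  then show ?thesis by simp
qed

lemma form_tendsto_self:
  assumes "u \<in> F" "\<And>n. y n \<in> F" "(\<lambda>n. E (y n - u) (y n - u)) \<longlonglongrightarrow> 0"
  shows "(\<lambda>n. E (y n) (y n)) \<longlonglongrightarrow> E u u"
proof -
  have "(\<lambda>n. E u u + 2 * E u (y n - u) + E (y n - u) (y n - u)) \<longlonglongrightarrow> E u u + 2 * 0 + 0"
    using assms by (intro tendsto_intros form_tendsto_0) auto
  moreover have "E u u + 2 * E u (y n - u) + E (y n - u) (y n - u) = E (y n) (y n)" for n
    using assms by (simp add: bilin form_sym[of "y n" u])
  ultimately show ?thesis by simp
qed

lemma form1_tendsto_0_iff: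
  assumes "\<And>n. y n \<in> F"
  shows "(\<lambda>n. form1 E (y n) (y n)) \<longlonglongrightarrow> 0 \<longleftrightarrow>
    (\<lambda>n. E (y n) (y n)) \<longlonglongrightarrow> 0 \<and> y \<longlonglongrightarrow> 0"
proof
  assume *: "(\<lambda>n. form1 E (y n) (y n)) \<longlonglongrightarrow> 0"
  have "(\<lambda>n. E (y n) (y n)) \<longlonglongrightarrow> 0"
    by (rule tendsto_sandwich[OF _ _ tendsto_const *]) (use assms in \<open>auto simp: form1_def\<close>)
  moreover have "(\<lambda>n. inner (y n) (y n)) \<longlonglongrightarrow> 0"
    by (rule tendsto_sandwich[OF _ _ tendsto_const *]) (use assms in \<open>auto simp: form1_def\<close>)
  then have "(\<lambda>n. (norm (y n))\<^sup>2) \<longlonglongrightarrow> 0" by (simp add: power2_norm_eq_inner)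
  then have "y \<longlonglongrightarrow> 0" by (simp add: tendsto_norm_zero_iff)
  ultimately show "(\<lambda>n. E (y n) (y n)) \<longlonglongrightarrow> 0 \<and> y \<longlonglongrightarrow> 0" ..
next
  assume *: "(\<lambda>n. E (y n) (y n)) \<longlonglongrightarrow> 0 \<and> y \<longlonglongrightarrow> 0"
  have "(\<lambda>n. form1 E (y n) (y n)) \<longlonglongrightarrow> 0 + inner (0::'h) 0"
    unfolding form1_def
    by (rule tendsto_add[OF conjunct1[OF *] tendsto_inner[OF conjunct2[OF *] conjunct2[OF *]]])
  then show "(\<lambda>n. form1 E (y n) (y n)) \<longlonglongrightarrow> 0" by simp
qed

lemma complete:
  assumes "\<And>n. u n \<in> F" "\<And>e. e > 0 \<Longrightarrow> \<exists>N. \<forall>m\<ge>N. \<forall>n\<ge>N. form1 E (u m - u n) (u m - u n) < e"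
  obtains v where "v \<in> F" "(\<lambda>n. E (u n - v) (u n - v)) \<longlonglongrightarrow> 0" "u \<longlonglongrightarrow> v"
proof -
  obtain v where v: "v \<in> F" "(\<lambda>n. form1 E (u n - v) (u n - v)) \<longlonglongrightarrow> 0"
    using closed assms unfolding closed_form_def by blast
  then show ?thesis
    using that[of v] form1_tendsto_0_iff[of "\<lambda>n. u n - v"] assms
    by (auto simp: LIM_zero_iff)
qed

text \<open>The minimiser of \<open>h E v v + \<parallel>v - f\<parallel>\<^sup>2\<close> exists because minimising sequences are Cauchy
  by the parallelogram law.\<close>

lemma resolvent_exists:
  assumes h: "h > 0"
  shows "\<exists>u\<in>F. \<forall>v\<in>F. h * E u v + inner u v = inner f v"
proof -
  define Q where "Q u v = h * E u v + inner u v" for u v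
  define \<Phi> where "\<Phi> v = Q v v - 2 * inner f v" for v
  have lower: "- (norm f)\<^sup>2 \<le> \<Phi> v" if "v \<in> F" for v
  proof -
    have "0 \<le> (norm (v - f))\<^sup>2" by simp
    also have "\<dots> = (norm v)\<^sup>2 - 2 * inner f v + (norm f)\<^sup>2"
      by (simp add: power2_norm_eq_inner algebra_simps inner_commute)
    finally show ?thesis
      using h mult_nonneg_nonneg[OF less_imp_le nonneg, of h v] that
      unfolding \<Phi>_def Q_def power2_norm_eq_inner by linarith
  qed
  define I where "I = Inf (\<Phi> ` F)"
  have bdd: "bdd_below (\<Phi> ` F)" using lower by (auto intro!: bdd_belowI)
  have I_le: "I \<le> \<Phi> v" if "v \<in> F" for v
    unfolding I_def using bdd that by (auto intro: cInf_lower)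
  have "\<exists>v\<in>F. \<Phi> v < I + 1 / real (Suc n)" for n
  proof -
    have "\<exists>y\<in>\<Phi> ` F. y < I + 1 / real (Suc n)"
      unfolding I_def by (rule cInf_lessD) (use mem(1) in \<open>auto simp del: mem\<close>)
    then show ?thesis by blast
  qed
  then obtain x where x: "\<And>n. x n \<in> F" "\<And>n. \<Phi> (x n) < I + 1 / real (Suc n)" by metis
  have Qadd: "\<Phi> (a + t *\<^sub>R b) = \<Phi> a + 2 * t * (Q a b - inner f b) + t\<^sup>2 * Q b b"
    if "a \<in> F" "b \<in> F" for a b t
    using that unfolding \<Phi>_def Q_def
    by (simp add: bilin form_sym[of b a] inner_add_left inner_add_right power2_eq_square
        inner_commute[of b a] algebra_simps)
  \<comment> \<open>The linear part of \<open>\<Phi>\<close> cancels, which leaves the parallelogram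
    law for \<open>Q\<close>; the midpoint value is bounded below by the infimum.\<close>
  have par: "Q (a - b) (a - b) = 2 * \<Phi> a + 2 * \<Phi> b - 4 * \<Phi> ((1/2) *\<^sub>R a + (1/2) *\<^sub>R b)"
    if "a \<in> F" "b \<in> F" for a b
    using that unfolding \<Phi>_def Q_def
    by (simp add: bilin form_sym[of b a] inner_add_left inner_add_right inner_diff_left inner_diff_right
        inner_commute[of b a] algebra_simps)
  \<comment> \<open>\<open>Q\<close> weighs the energy by h and the squared norm by 1, so it
    controls \<open>form1\<close> with the constant \<open>min h 1\<close>.\<close>
  have small: "form1 E (x m - x n) (x m - x n) \<le> (2 / real (Suc m) + 2 / real (Suc n)) / min h 1" for m n
  proof -
    have d: "0 \<le> E (x m - x n) (x m - x n)" using x by simp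
    have "min h 1 * form1 E (x m - x n) (x m - x n) \<le> Q (x m - x n) (x m - x n)"
      unfolding Q_def form1_def distrib_left
      by (intro add_mono mult_right_mono d) (auto intro: mult_left_le_one_le simp: h less_imp_le)
    also have "\<dots> \<le> 2 * (I + 1 / real (Suc m)) + 2 * (I + 1 / real (Suc n)) - 4 * I"
      unfolding par[OF x(1) x(1)]
      using x(2)[of m] x(2)[of n] I_le[of "(1/2) *\<^sub>R x m + (1/2) *\<^sub>R x n"] x(1)
      by (intro diff_mono add_mono) auto
    also have "\<dots> = 2 / real (Suc m) + 2 / real (Suc n)" by simp
    finally show ?thesis using h by (simp add: pos_le_divide_eq mult.commute del: of_nat_Suc)
  qed
  obtain u where u: "u \<in> F" "(\<lambda>n. E (x n - u) (x n - u)) \<longlonglongrightarrow> 0" "x \<longlonglongrightarrow> u"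
  proof (rule complete)
    show "x n \<in> F" for n by (rule x)
    fix e :: real assume e: "e > 0"
    then obtain N where N: "1 / real (Suc N) < e * min h 1 / 4"
      using nat_approx_posE[of "e * min h 1 / 4"] h by auto
    have "form1 E (x m - x n) (x m - x n) < e" if "m \<ge> N" "n \<ge> N" for m n
    proof -
      have "form1 E (x m - x n) (x m - x n) \<le> (2 / real (Suc m) + 2 / real (Suc n)) / min h 1"
        by (rule small)
      also have "\<dots> \<le> (2 / real (Suc N) + 2 / real (Suc N)) / min h 1"
        using that h by (intro divide_right_mono add_mono divide_left_mono) auto
      also have "\<dots> = 4 * (1 / real (Suc N)) / min h 1" by simp
      also have "\<dots> < e" using N h by (simp add: pos_divide_less_eq mult_ac del: of_nat_Suc)
      finally show ?thesis .
    qed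
    then show "\<exists>N. \<forall>m\<ge>N. \<forall>n\<ge>N. form1 E (x m - x n) (x m - x n) < e" by blast
  qed
  show ?thesis
  proof (intro bexI ballI)
    show "u \<in> F" by fact
    fix w assume w: "w \<in> F"
    have lim: "(\<lambda>n. Q (x n) w) \<longlonglongrightarrow> Q u w"
    proof -
      have "(\<lambda>n. h * (E u w + E w (x n - u)) + inner (x n) w) \<longlonglongrightarrow> h * (E u w + 0) + inner u w"
        using x u w by (intro tendsto_intros form_tendsto_0) auto
      moreover have "E u w + E w (x n - u) = E (x n) w" for n
        using x u w by (simp add: bilin form_sym[of w u] form_sym[of w "x n"])
      ultimately show ?thesis by (simp add: Q_def)
    qed
    have quad: "0 \<le> 0 + 2 * (Q u w - inner f w) * t + Q w w * t\<^sup>2" for t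
    proof -
      have "(\<lambda>n. 1 / real (Suc n) + 2 * t * (Q (x n) w - inner f w) + t\<^sup>2 * Q w w)
        \<longlonglongrightarrow> 0 + 2 * t * (Q u w - inner f w) + t\<^sup>2 * Q w w"
        using lim by (intro tendsto_intros LIMSEQ_Suc[OF lim_1_over_n])
      moreover have "0 \<le> 1 / real (Suc n) + 2 * t * (Q (x n) w - inner f w) + t\<^sup>2 * Q w w" for n
        using I_le[of "x n + t *\<^sub>R w"] x(1)[of n] x(2)[of n] w Qadd[of "x n" w t] by auto
      ultimately have "0 \<le> 0 + 2 * t * (Q u w - inner f w) + t\<^sup>2 * Q w w"
        using LIMSEQ_le_const by blast
      then show ?thesis by (simp add: mult_ac)
    qed
    \<comment> \<open>A nonnegative quadratic without constant term has vanishing linear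
      coefficient: this is the Euler-Lagrange equation.\<close>
    have "(Q u w - inner f w)\<^sup>2 \<le> 0 * Q w w"
      by (rule power2_le_of_quadratic_nonneg) (use quad in simp)
    then show "h * E u w + inner u w = inner f w" by (simp add: Q_def)
  qed
qed

text \<open>This is (I - hL)^{-1} for the generator L, one backward Euler step of length h, and not
  the resolvent in the spectral parameter; it tends to the identity as h tends to 0.\<close>

definition resolvent :: "real \<Rightarrow> 'h \<Rightarrow> 'h" where
  "resolvent h f = (SOME u. u \<in> F \<and> (\<forall>v\<in>F. h * E u v + inner u v = inner f v))"

text \<open>The pair (u, -Lu). The sign turns the generator into a nonnegative operator.\<close>

definition gen :: "'h \<Rightarrow> 'h \<Rightarrow> bool" where
  "gen u g \<longleftrightarrow> u \<in> F \<and> (\<forall>v\<in>F. E u v = inner g v)"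

lemma gen_iff: "gen u g \<longleftrightarrow> (u, - g) \<in> form_generator E F"
  by (simp add: gen_def form_generator_def)

lemma gen_mem: "gen u g \<Longrightarrow> u \<in> F" by (simp add: gen_def)

lemma gen_add: "gen u g \<Longrightarrow> gen v k \<Longrightarrow> gen (u + v) (g + k)"
  by (auto simp: gen_def bilin inner_add_left)

lemma gen_scale: "gen u g \<Longrightarrow> gen (c *\<^sub>R u) (c *\<^sub>R g)"
  by (auto simp: gen_def bilin)

lemma gen_diff: "gen u g \<Longrightarrow> gen v k \<Longrightarrow> gen (u - v) (g - k)"
  by (auto simp: gen_def bilin inner_diff_left)

lemma gen_sym: "gen u g \<Longrightarrow> gen v k \<Longrightarrow> inner g v = inner u k"
  by (metis gen_def form_sym inner_commute)

lemma gen_nonneg: "gen u g \<Longrightarrow> 0 \<le> inner g u"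
  by (metis gen_def nonneg)

lemma resolvent_gen:
  assumes "h > 0"
  shows "gen (resolvent h f) ((1/h) *\<^sub>R (f - resolvent h f))"
proof -
  have "\<exists>u. u \<in> F \<and> (\<forall>v\<in>F. h * E u v + inner u v = inner f v)"
    using resolvent_exists[OF assms, of f] by blast
  then have "resolvent h f \<in> F \<and> (\<forall>v\<in>F. h * E (resolvent h f) v + inner (resolvent h f) v = inner f v)"
    unfolding resolvent_def by (rule someI_ex)
  then show ?thesis using assms by (auto simp: gen_def inner_diff_left field_simps)
qed

lemma resolvent_mem: "h > 0 \<Longrightarrow> resolvent h f \<in> F"
  by (rule gen_mem[OF resolvent_gen])

text \<open>Accretivity: the cross term in the expanded square is nonnegative. Applied to a
  difference of solutions it gives uniqueness of the resolvent equation, applied to one solution its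
  contractivity.\<close>

lemma norm_le_norm_gen:
  assumes "gen u g" "h > 0"
  shows "norm u \<le> norm (u + h *\<^sub>R g)"
proof (rule power2_le_imp_le)
  have "(norm (u + h *\<^sub>R g))\<^sup>2 = (norm u)\<^sup>2 + 2 * h * inner g u + h\<^sup>2 * (norm g)\<^sup>2"
    unfolding power2_norm_eq_inner
    by (simp add: inner_add_left inner_add_right inner_commute[of u g] power2_eq_square algebra_simps)
  then show "(norm u)\<^sup>2 \<le> (norm (u + h *\<^sub>R g))\<^sup>2"
    using assms gen_nonneg[OF assms(1)] by simp
qed simp

lemma resolvent_eqI:
  assumes "gen u g" "h > 0" "f = u + h *\<^sub>R g"
  shows "resolvent h f = u"
proof -
  let ?J = "resolvent h f"
  have "gen (?J - u) ((1/h) *\<^sub>R (f - ?J) - g)"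
    by (intro gen_diff resolvent_gen assms)
  from norm_le_norm_gen[OF this assms(2)] show ?thesis
    using assms by (simp add: algebra_simps)
qed

lemma resolvent_norm: "h > 0 \<Longrightarrow> norm (resolvent h f) \<le> norm f"
  using norm_le_norm_gen[OF resolvent_gen, of h h f] by simp

lemma resolvent_linear: "h > 0 \<Longrightarrow> linear (resolvent h)"
proof (rule linearI)
  fix f g c assume h: "h > 0"
  show "resolvent h (f + g) = resolvent h f + resolvent h g"
    by (rule resolvent_eqI[OF gen_add[OF resolvent_gen[OF h] resolvent_gen[OF h]] h])
      (use h in \<open>simp add: algebra_simps\<close>)
  show "resolvent h (c *\<^sub>R f) = c *\<^sub>R resolvent h f"
    by (rule resolvent_eqI[OF gen_scale[OF resolvent_gen[OF h]] h])
      (use h in \<open>simp add: algebra_simps\<close>)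
qed

lemma resolvent_sym:
  assumes h: "h > 0"
  shows "inner (resolvent h f) k = inner f (resolvent h k)"
proof -
  let ?u = "resolvent h f" and ?v = "resolvent h k"
  have "inner ((1/h) *\<^sub>R (f - ?u)) ?v = inner ?u ((1/h) *\<^sub>R (k - ?v))"
    by (rule gen_sym[OF resolvent_gen[OF h] resolvent_gen[OF h]])
  then show ?thesis using h by (simp add: inner_diff_left inner_diff_right)
qed

text \<open>The resolvent commutes with L on the domain because u is the resolvent of u - hLu. In
  particular it maps the domain of L into that of L^2.\<close>

lemma resolvent_gen_commute:
  assumes "gen u g" "h > 0"
  shows "gen (resolvent h u) (resolvent h g)" "u - resolvent h u = h *\<^sub>R resolvent h g"
proof -
  have "resolvent h (u + h *\<^sub>R g) = u" by (rule resolvent_eqI[OF assms]) simp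
  then show eq: "u - resolvent h u = h *\<^sub>R resolvent h g"
    using resolvent_linear[OF assms(2)] by (simp add: linear_add linear_scale algebra_simps)
  then show "gen (resolvent h u) (resolvent h g)"
    using resolvent_gen[OF assms(2), of u] assms(2) by simp
qed

lemma resolvent_dist:
  assumes "gen u g" "h > 0"
  shows "norm (resolvent h u - u) \<le> h * norm g"
  using resolvent_gen_commute(2)[OF assms] resolvent_norm[OF assms(2), of g] assms(2)
  by (simp add: norm_minus_commute)

lemma resolvent_commute:
  assumes "a > 0" "b > 0"
  shows "resolvent a (resolvent b u) = resolvent b (resolvent a u)"
proof -
  define y where "y = resolvent b u"
  define g where "g = (1/b) *\<^sub>R (u - y)"
  have y: "gen y g" unfolding y_def g_def by (rule resolvent_gen) fact
  have u: "u = y + b *\<^sub>R g" using assms by (simp add: g_def)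
  have "resolvent b (resolvent a u) = resolvent a y"
    by (rule resolvent_eqI[OF resolvent_gen_commute(1)[OF y assms(1)] assms(2)])
      (use resolvent_linear[OF assms(1)] in \<open>simp add: u linear_add linear_scale\<close>)
  then show ?thesis by (simp add: y_def)
qed

text \<open>(I - aL)(I - bL) = I - (a + b)L + ab L^2, so two successive steps miss the combined step
  only by a term ab L^2 u. This is the local error from which convergence of the Euler scheme is
  derived.\<close>

lemma resolvent_compose_approx:
  assumes "gen u g" "gen g k" "a > 0" "b > 0"
  shows "norm (resolvent a (resolvent b u) - resolvent (a + b) u) \<le> a * b * norm k"
proof -
  let ?P = "\<lambda>x. resolvent a (resolvent b x)"
  have w: "gen (?P u) (?P g)" "gen (?P g) (?P k)"
    using assms by (auto intro!: resolvent_gen_commute(1))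
  have exp: "x = ?P x + (a + b) *\<^sub>R ?P y + (a * b) *\<^sub>R ?P z" if "gen x y" "gen y z" for x y z
  proof -
    have 1: "x = resolvent b x + b *\<^sub>R resolvent b y" "y = resolvent b y + b *\<^sub>R resolvent b z"
      using resolvent_gen_commute(2)[OF that(1) assms(4)] resolvent_gen_commute(2)[OF that(2) assms(4)]
      by (simp_all add: algebra_simps)
    have 2: "resolvent b x = ?P x + a *\<^sub>R ?P y" "resolvent b y = ?P y + a *\<^sub>R ?P z"
      using resolvent_gen_commute[OF resolvent_gen_commute(1)[OF that(1) assms(4)] assms(3)]
        resolvent_gen_commute[OF resolvent_gen_commute(1)[OF that(2) assms(4)] assms(3)]
      by (simp_all add: algebra_simps)
    show ?thesis by (subst 1(1), subst 2(1), subst 2(2)) (simp add: algebra_simps)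
  qed
  have ab: "a + b > 0" using assms by simp
  have "resolvent (a + b) (?P u + (a + b) *\<^sub>R ?P g) = ?P u"
    by (rule resolvent_eqI[OF w(1) ab]) simp
  moreover have "u = (?P u + (a + b) *\<^sub>R ?P g) + (a * b) *\<^sub>R ?P k"
    using exp[OF assms(1,2)] .
  ultimately have "resolvent (a + b) u = ?P u + (a * b) *\<^sub>R resolvent (a + b) (?P k)"
    using linear_add[OF resolvent_linear[OF ab], of "?P u + (a + b) *\<^sub>R ?P g" "(a * b) *\<^sub>R ?P k"]
      linear_scale[OF resolvent_linear[OF ab], of "a * b" "?P k"] by argo
  then have "norm (?P u - resolvent (a + b) u) = a * b * norm (resolvent (a + b) (?P k))"
    using assms by simp
  also have "\<dots> \<le> a * b * norm k"
    using assms ab by (intro mult_left_mono order_trans[OF resolvent_norm]) auto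
  finally show ?thesis .
qed

text \<open>An energy bound in place of a generator bound: it gives strong continuity at 0 on
  \<open>F\<close>, whose density is assumed, whereas density of the domain of L is a
  consequence.\<close>

lemma resolvent_dist_form:
  assumes "w \<in> F" "h > 0"
  shows "(norm (w - resolvent h w))\<^sup>2 \<le> h * E w w"
proof -
  let ?J = "resolvent h w"
  have J: "?J \<in> F" using assms by (intro resolvent_mem)
  have "(norm (w - ?J))\<^sup>2 = h * inner ((1/h) *\<^sub>R (w - ?J)) (w - ?J)"
    using assms by (simp add: power2_norm_eq_inner)
  also have "\<dots> = h * E ?J (w - ?J)"
    using resolvent_gen[OF assms(2), of w] assms J by (simp add: gen_def)
  also have "\<dots> \<le> h * E w w"
  proof (rule mult_left_mono)
    have "0 \<le> E (w - ?J) (w - ?J)" "0 \<le> E w w" "0 \<le> E ?J ?J" using assms J by auto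
    then show "E ?J (w - ?J) \<le> E w w" using assms J
      unfolding diff_left[OF assms(1) J mem(3)[OF assms(1) J]] diff_right[OF assms(1) J assms(1)]
        diff_right[OF assms(1) J J] form_sym[OF assms(1) J] by linarith
  qed (use assms in simp)
  finally show ?thesis .
qed

lemma resolvent_tendsto: "((\<lambda>h. resolvent h u) \<longlongrightarrow> u) (at_right 0)"
proof (rule tendsto_dense_contraction[where T = "\<lambda>x. x" and D = F])
  show "\<forall>\<^sub>F h in at_right 0. linear (resolvent h) \<and> (\<forall>x. norm (resolvent h x) \<le> norm x)"
    using eventually_at_right_less[of "0::real"]
    by eventually_elim (auto intro: resolvent_linear resolvent_norm)
  show "((\<lambda>h. resolvent h w) \<longlongrightarrow> w) (at_right 0)" if w: "w \<in> F" for w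
  proof -
    have 0: "((\<lambda>h. sqrt (h * E w w)) \<longlongrightarrow> sqrt (0 * E w w)) (at_right 0)"
      by (intro tendsto_intros)
    have "((\<lambda>h. resolvent h w - w) \<longlongrightarrow> 0) (at_right 0)"
    proof (rule Lim_null_comparison)
      show "\<forall>\<^sub>F h in at_right 0. norm (resolvent h w - w) \<le> sqrt (h * E w w)"
        using eventually_at_right_less[of "0::real"]
        by eventually_elim
          (use resolvent_dist_form[OF w] in \<open>auto simp: norm_minus_commute intro: real_le_rsqrt\<close>)
    qed (use 0 in simp)
    then show ?thesis by (simp add: LIM_zero_iff)
  qed
qed (auto simp: dense linear_ident)

text \<open>The domain of L^2, where local errors are of second order in the step length.\<close>

definition dom2 :: "'h set" where
  "dom2 = {u. \<exists>g k. gen u g \<and> gen g k}"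

text \<open>Two resolvent steps land in \<open>dom2\<close>; by contractivity the second moves the
  vector no farther than the first.\<close>

lemma dom2_dense: "closure dom2 = UNIV"
proof -
  have "u \<in> closure dom2" for u
  proof (unfold closure_approachable, intro allI impI)
    fix e :: real assume e: "e > 0"
    have "\<forall>\<^sub>F h in at_right 0. dist (resolvent h u) u < e / 2 \<and> 0 < h"
      using tendstoD[OF resolvent_tendsto, of "e / 2" u] e eventually_at_right_less[of "0::real"]
      by (auto simp: eventually_conj_iff)
    then obtain h where h: "dist (resolvent h u) u < e / 2" "0 < h"
      using eventually_happens'[of "at_right (0::real)"] by (auto simp: trivial_limit_at_right_real)
    let ?w = "resolvent h (resolvent h u)"
    have "norm (?w - resolvent h u) \<le> norm (resolvent h u - u)"
      using resolvent_norm[OF h(2), of "resolvent h u - u"] resolvent_linear[OF h(2)] by (simp add: linear_diff)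
    then have "dist ?w u < e"
      using h norm_triangle_ineq[of "?w - resolvent h u" "resolvent h u - u"] by (simp add: dist_norm)
    moreover have "?w \<in> dom2"
      using resolvent_gen_commute(1)[OF resolvent_gen[OF h(2), of u] h(2)] resolvent_gen[OF h(2)]
      unfolding dom2_def by blast
    ultimately show "\<exists>y\<in>dom2. dist y u < e" by blast
  qed
  then show ?thesis by blast
qed

lemma funpow_resolvent_gen:
  "gen u g \<Longrightarrow> h > 0 \<Longrightarrow> gen ((resolvent h ^^ n) u) ((resolvent h ^^ n) g)"
  by (induction n) (auto intro: resolvent_gen_commute(1))

lemma funpow_resolvent_norm: "h > 0 \<Longrightarrow> norm ((resolvent h ^^ n) u) \<le> norm u"
  by (rule norm_funpow_le) (rule resolvent_norm)

end

section \<open>Contraction semigroups and their difference quotients\<close>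

lemma contraction_semigroupD:
  assumes "contraction_semigroup T"
  shows "t > 0 \<Longrightarrow> linear (T t)" "t > 0 \<Longrightarrow> inner (T t u) v = inner u (T t v)"
    "t > 0 \<Longrightarrow> norm (T t u) \<le> norm u" "s > 0 \<Longrightarrow> t > 0 \<Longrightarrow> T s (T t u) = T (s + t) u"
    "((\<lambda>t. T t u) \<longlongrightarrow> u) (at_right 0)"
  using assms by (auto simp: contraction_semigroup_def)

text \<open>The count starts at one step because \<open>contraction_semigroup\<close> does not
  prescribe a value at time 0.\<close>

lemma semigroup_funpow:
  assumes T: "contraction_semigroup T" and h: "h > 0"
  shows "(T h ^^ Suc n) u = T (real (Suc n) * h) u"
proof (induction n)
  case (Suc n)
  have "(T h ^^ Suc (Suc n)) u = T h (T (real (Suc n) * h) u)" using Suc by simp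
  also have "\<dots> = T (h + real (Suc n) * h) u"
    by (rule contraction_semigroupD(4)[OF T h]) (use h in simp)
  also have "h + real (Suc n) * h = real (Suc (Suc n)) * h" by (simp add: algebra_simps)
  finally show ?case .
qed simp

text \<open>A discrete form of \<open>T t u - u = \<integral>\<^bsub>0\<^esub>\<^bsup>t\<^esup> T s f ds\<close>: the average of the
  \<open>T (i t / n) f\<close> over \<open>i < n\<close> converges to the difference quotient.\<close>

lemma semigroup_quotient_mem:
  assumes T: "contraction_semigroup T" and uf: "(u, f) \<in> semigroup_generator T"
    and S: "closed S" "convex S" and f: "f \<in> S" "\<And>s. 0 < s \<Longrightarrow> s < t \<Longrightarrow> T s f \<in> S" and t: "t > 0"
  shows "(1/t) *\<^sub>R (T t u - u) \<in> S"
proof -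
  define h where "h n = t / real (Suc n)" for n
  have h: "h n > 0" for n using t by (simp add: h_def)
  note lin = contraction_semigroupD(1)[OF T h] 
  define a where "a n = (\<Sum>i\<in>{..n}. (1 / real (Suc n)) *\<^sub>R ((T (h n) ^^ i) f))" for n
  have aS: "a n \<in> S" for n
    unfolding a_def
  proof (rule convex_sum[OF _ S(2)])
    fix i assume i: "i \<in> {..n}"
    show "(T (h n) ^^ i) f \<in> S"
    proof (cases i)
      case (Suc j)
      have "real (Suc j) < real (Suc n) \<or> j = n" using i Suc by auto
      then have "real (Suc j) * h n < t"
        using t i Suc by (simp add: h_def field_simps)
      then show ?thesis unfolding Suc semigroup_funpow[OF T h] using h[of n] by (intro f) auto
    qed (use f in simp)
  qed auto
  have h0: "filterlim h (at_right 0) sequentially"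
  proof -
    have "(\<lambda>n. t * (1 / real (Suc n))) \<longlonglongrightarrow> t * 0"
      by (intro tendsto_intros LIMSEQ_Suc[OF lim_1_over_n])
    then have "h \<longlonglongrightarrow> 0" by (simp add: h_def[abs_def])
    then show ?thesis using h by (auto simp: filterlim_at less_imp_neq[symmetric] intro!: always_eventually)
  qed
  have lim: "(\<lambda>n. (T (h n) u - u) /\<^sub>R h n) \<longlonglongrightarrow> f"
    using filterlim_compose[OF _ h0, of "\<lambda>t. (T t u - u) /\<^sub>R t" "nhds f"] uf
    by (simp add: semigroup_generator_def)
  \<comment> \<open>Telescoping \<open>T t u - u\<close> over \<open>Suc n\<close> steps exhibits
    the difference quotient as the same average as \<open>a n\<close>, taken of the quotient with
    the short step \<open>h n\<close> in place of f.\<close>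
  have diff: "norm ((1/t) *\<^sub>R (T t u - u) - a n) \<le> norm ((T (h n) u - u) /\<^sub>R h n - f)" for n
  proof -
    let ?P = "T (h n)"
    have "T t u = (?P ^^ Suc n) u"
      unfolding semigroup_funpow[OF T h] by (simp add: h_def)
    then have "T t u - u = (\<Sum>i<Suc n. (?P ^^ Suc i) u - (?P ^^ i) u)"
      by (subst sum_lessThan_telescope) simp
    also have "\<dots> = (\<Sum>i\<in>{..n}. (?P ^^ i) (?P u - u))"
      by (intro sum.cong) (auto simp: linear_diff[OF linear_funpow[OF lin]] funpow_swap1 simp del: funpow.simps(2) simp: funpow_Suc_right)
    finally have "(1/t) *\<^sub>R (T t u - u) = (\<Sum>i\<in>{..n}. (1/t) *\<^sub>R (?P ^^ i) (?P u - u))"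
      by (simp add: scaleR_sum_right)
    also have "\<dots> = (\<Sum>i\<in>{..n}. (1 / real (Suc n)) *\<^sub>R (?P ^^ i) ((?P u - u) /\<^sub>R h n))"
    proof (intro sum.cong refl)
      have "1 / real (Suc n) * inverse (h n) = 1 / t" using t by (simp add: h_def field_simps)
      then show "(1/t) *\<^sub>R (?P ^^ i) (?P u - u) = (1 / real (Suc n)) *\<^sub>R (?P ^^ i) ((?P u - u) /\<^sub>R h n)" for i
        by (simp only: linear_scale[OF linear_funpow[OF lin]] scaleR_scaleR)
    qed
    finally have "(1/t) *\<^sub>R (T t u - u) - a n
      = (\<Sum>i\<in>{..n}. (1 / real (Suc n)) *\<^sub>R (?P ^^ i) ((?P u - u) /\<^sub>R h n - f))"
      by (simp add: a_def linear_diff[OF linear_funpow[OF lin]] sum_subtractf scaleR_diff_right)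
    also have "norm \<dots> \<le> (\<Sum>i\<in>{..n}. (1 / real (Suc n)) * norm ((?P u - u) /\<^sub>R h n - f))"
      by (intro order_trans[OF norm_sum] sum_mono)
        (auto intro!: divide_right_mono norm_funpow_le contraction_semigroupD(3)[OF T h])
    also have "\<dots> = norm ((?P u - u) /\<^sub>R h n - f)" by simp
    finally show ?thesis .
  qed
  have "(\<lambda>n. (1/t) *\<^sub>R (T t u - u) - a n) \<longlonglongrightarrow> 0"
    by (rule Lim_null_comparison[OF always_eventually])
      (use diff tendsto_norm[OF LIM_zero[OF lim]] in auto)
  then have "(\<lambda>n. (1/t) *\<^sub>R (T t u - u) - ((1/t) *\<^sub>R (T t u - u) - a n)) \<longlonglongrightarrow> (1/t) *\<^sub>R (T t u - u) - 0"
    by (intro tendsto_intros)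
  then have "a \<longlonglongrightarrow> (1/t) *\<^sub>R (T t u - u)" by simp
  then show ?thesis using closed_sequentially[OF S(1)] aS by blast
qed

text \<open>The closed convex set is a ball about f. This is the mean value inequality for the
  orbit, obtained without differentiating it.\<close>

lemma semigroup_quotient_bound:
  assumes T: "contraction_semigroup T" and uf: "(u, f) \<in> semigroup_generator T"
    and c: "0 \<le> c" "\<And>s. 0 < s \<Longrightarrow> s < t \<Longrightarrow> norm (T s f - f) \<le> c" and t: "t > 0"
  shows "norm (T t u - u - t *\<^sub>R f) \<le> t * c"
proof -
  have "(1/t) *\<^sub>R (T t u - u) \<in> cball f c"
    by (rule semigroup_quotient_mem[OF T uf _ _ _ _ t])
      (use c in \<open>auto simp: dist_norm norm_minus_commute\<close>)
  then have "t * norm ((1/t) *\<^sub>R (T t u - u) - f) \<le> t * c"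
    using t by (intro mult_left_mono) (auto simp: dist_norm norm_minus_commute)
  also have "t * norm ((1/t) *\<^sub>R (T t u - u) - f) = norm (t *\<^sub>R ((1/t) *\<^sub>R (T t u - u) - f))"
    using t by simp
  also have "t *\<^sub>R ((1/t) *\<^sub>R (T t u - u) - f) = T t u - u - t *\<^sub>R f"
    using t by (simp add: algebra_simps)
  finally show ?thesis .
qed

text \<open>Serves to show that the generator of the Euler limit is not larger than the generator of
  the form.\<close>

lemma semigroup_dissipative:
  assumes T: "contraction_semigroup T" and uf: "(u, f) \<in> semigroup_generator T"
  shows "inner f u \<le> 0"
proof (rule tendsto_upperbound)
  show "((\<lambda>t. inner ((T t u - u) /\<^sub>R t) u) \<longlongrightarrow> inner f u) (at_right 0)"
    using uf by (intro tendsto_intros) (simp add: semigroup_generator_def)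
  show "\<forall>\<^sub>F t in at_right 0. inner ((T t u - u) /\<^sub>R t) u \<le> 0"
    using eventually_at_right_less[of "0::real"]
  proof eventually_elim
    case (elim t)
    have "inner (T t u) u \<le> norm (T t u) * norm u" by (rule norm_cauchy_schwarz)
    also have "\<dots> \<le> norm u * norm u"
      by (intro mult_right_mono contraction_semigroupD(3)[OF T elim]) simp
    finally show ?case using elim by (simp add: inner_diff_left norm_eq_sqrt_inner divide_inverse[symmetric] mult_le_0_iff inverse_nonpositive_iff_nonpositive)
  qed
qed (simp add: trivial_limit_at_right_real)

lemma semigroup_generator_diff:
  assumes T: "contraction_semigroup T"
    and "(u, f) \<in> semigroup_generator T" "(v, g) \<in> semigroup_generator T"
  shows "(u - v, f - g) \<in> semigroup_generator T"
proof -
  have "((\<lambda>t. (T t u - u) /\<^sub>R t - (T t v - v) /\<^sub>R t) \<longlongrightarrow> f - g) (at_right 0)"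
    using assms by (intro tendsto_intros) (auto simp: semigroup_generator_def)
  then show ?thesis unfolding semigroup_generator_def mem_Collect_eq prod.case
  proof (rule Lim_transform_eventually)
    show "\<forall>\<^sub>F t in at_right 0. (T t u - u) /\<^sub>R t - (T t v - v) /\<^sub>R t = (T t (u - v) - (u - v)) /\<^sub>R t"
      using eventually_at_right_less[of "0::real"]
      by eventually_elim (simp add: linear_diff[OF contraction_semigroupD(1)[OF T]] algebra_simps)
  qed
qed

section \<open>The Euler scheme and the generator of its limit\<close>

context closed_dense_form
begin

text \<open>Step numbers are powers of 2, so that refining by one level is the composition of two
  runs over half the time.\<close>

definition euler :: "nat \<Rightarrow> real \<Rightarrow> 'h \<Rightarrow> 'h" where
  "euler n t = resolvent (t / 2 ^ n) ^^ (2 ^ n)"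

definition euler_limit :: "real \<Rightarrow> 'h \<Rightarrow> 'h" where
  "euler_limit t u = lim (\<lambda>n. euler n t u)"

lemma euler_linear: "t > 0 \<Longrightarrow> linear (euler n t)"
  unfolding euler_def by (intro linear_funpow resolvent_linear) simp

lemma euler_norm: "t > 0 \<Longrightarrow> norm (euler n t u) \<le> norm u"
  unfolding euler_def by (intro funpow_resolvent_norm) simp

lemma funpow_resolvent_dist:
  assumes "gen u g" "h > 0"
  shows "norm ((resolvent h ^^ n) u - u) \<le> real n * h * norm g"
proof -
  have "norm ((resolvent h ^^ n) u - (id ^^ n) u) \<le> real n * (h * norm g)"
    by (rule norm_funpow_diff_le[OF resolvent_linear resolvent_norm])
      (use assms resolvent_dist[OF assms] in auto)
  then show ?thesis by (simp add: mult_ac)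
qed

lemma euler_dist: "gen u g \<Longrightarrow> t > 0 \<Longrightarrow> norm (euler n t u - u) \<le> t * norm g"
  using funpow_resolvent_dist[of u g "t / 2 ^ n" "2 ^ n"] by (simp add: euler_def)

lemma funpow_commute: "(\<And>x. f (g x) = g (f x)) \<Longrightarrow> (f ^^ n) (g x) = g ((f ^^ n) x)"
  by (induction n) auto

lemma funpow_comp: "(\<And>x. f (g x) = g (f x)) \<Longrightarrow> ((\<lambda>x. f (g x)) ^^ n) x = (f ^^ n) ((g ^^ n) x)"
proof (induction n)
  case (Suc n)
  have "(f ^^ n) (g ((g ^^ n) x)) = g ((f ^^ n) ((g ^^ n) x))"
    by (rule funpow_commute) (rule Suc.prems)
  then show ?case using Suc by simp
qed simp

text \<open>Resolvents commute, so the two runs can be interleaved into \<open>2 ^ n\<close> pairs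
  of short steps. Each pair costs \<open>s * t / 4 ^ n\<close> times the norm of k, and the costs
  add up along contractions.\<close>

lemma euler_compose_approx:
  assumes "gen u g" "gen g k" "s > 0" "t > 0"
  shows "norm (euler n s (euler n t u) - euler n (s + t) u) \<le> s * t * norm k / 2 ^ n"
proof -
  let ?a = "s / 2 ^ n" and ?b = "t / 2 ^ n"
  have ab: "?a > 0" "?b > 0" "?a + ?b > 0" using assms by (auto intro: add_pos_pos)
  have eq: "euler n s (euler n t u) = ((\<lambda>x. resolvent ?a (resolvent ?b x)) ^^ (2 ^ n)) u"
    unfolding euler_def by (rule funpow_comp[symmetric]) (rule resolvent_commute[OF ab(1,2)])
  have eq2: "euler n (s + t) u = (resolvent (?a + ?b) ^^ (2 ^ n)) u"
    unfolding euler_def by (simp add: add_divide_distrib)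
  have "norm (euler n s (euler n t u) - euler n (s + t) u) \<le> real (2 ^ n) * (?a * ?b * norm k)"
    unfolding eq eq2
  proof (rule norm_funpow_diff_le)
    show "linear (\<lambda>x. resolvent ?a (resolvent ?b x))"
      using linear_compose[OF resolvent_linear[OF ab(2)] resolvent_linear[OF ab(1)]] by (simp add: o_def)
    show "norm (resolvent ?a (resolvent ?b x)) \<le> norm x" for x
      using ab by (meson order_trans resolvent_norm)
    fix i
    let ?R = "resolvent (?a + ?b) ^^ i"
    have "norm (resolvent ?a (resolvent ?b (?R u)) - resolvent (?a + ?b) (?R u)) \<le> ?a * ?b * norm (?R k)"
      using assms ab by (intro resolvent_compose_approx[OF funpow_resolvent_gen funpow_resolvent_gen])
    also have "\<dots> \<le> ?a * ?b * norm k"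
      using ab by (intro mult_left_mono funpow_resolvent_norm mult_nonneg_nonneg less_imp_le) auto
    finally show "norm (resolvent ?a (resolvent ?b (?R u)) - resolvent (?a + ?b) (?R u)) \<le> ?a * ?b * norm k" .
  qed
  also have "\<dots> = s * t * norm k / 2 ^ n" by (simp add: field_simps)
  finally show ?thesis .
qed

text \<open>Two runs of level n over time t/2 form the run of level \<open>Suc n\<close> over time
  t, so the composition error with both times equal to t/2 bounds the refinement.\<close>

lemma euler_step:
  assumes "gen u g" "gen g k" "t > 0"
  shows "norm (euler (Suc n) t u - euler n t u) \<le> (t\<^sup>2 * norm k) * (1/2) ^ n"
proof -
  let ?t = "t / 2"
  have half: "euler n ?t (euler n ?t u) = euler (Suc n) t u"
  proof -
    have "t / 2 ^ Suc n = ?t / 2 ^ n" "(2::nat) ^ Suc n = 2 ^ n + 2 ^ n" by simp_all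
    then show ?thesis unfolding euler_def by (simp only: funpow_add o_apply)
  qed
  have "norm (euler n ?t (euler n ?t u) - euler n (?t + ?t) u) \<le> ?t * ?t * norm k / 2 ^ n"
    using assms by (intro euler_compose_approx) auto
  also have "\<dots> = (t\<^sup>2 * norm k) * (1/2) ^ n / 4"
    by (simp add: power2_eq_square power_one_over field_simps)
  also have "\<dots> \<le> (t\<^sup>2 * norm k) * (1/2) ^ n" by simp
  finally show ?thesis using half by simp
qed

lemma euler_convergent:
  assumes t: "t > 0"
  shows "(\<lambda>n. euler n t u) \<longlonglongrightarrow> euler_limit t u"
proof -
  have "Cauchy (\<lambda>n. euler n t u)"
  proof (rule metric_CauchyI)
    fix e :: real assume e: "0 < e"
    have "u \<in> closure dom2" using dom2_dense by simp
    then obtain w where w: "w \<in> dom2" "dist w u < e / 3"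
      using e unfolding closure_approachable by (meson divide_pos_pos zero_less_numeral)
    then obtain g k where gk: "gen w g" "gen g k" by (auto simp: dom2_def)
    have "Cauchy (\<lambda>n. euler n t w)"
      by (rule Cauchy_of_geometric_steps(2)) (rule euler_step[OF gk t])
    then obtain M where M: "\<And>m n. m \<ge> M \<Longrightarrow> n \<ge> M \<Longrightarrow> dist (euler m t w) (euler n t w) < e / 3"
      using e unfolding Cauchy_def by (meson divide_pos_pos zero_less_numeral)
    have near: "dist (euler n t u) (euler n t w) < e / 3" for n
      using w euler_norm[OF t, of n "u - w"] euler_linear[OF t, of n]
      by (simp add: dist_norm linear_diff norm_minus_commute)
    have "dist (euler m t u) (euler n t u) < e" if "m \<ge> M" "n \<ge> M" for m n
      using M[OF that] near[of m] near[of n]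
        dist_triangle[of "euler m t u" "euler n t u" "euler m t w"]
        dist_triangle[of "euler m t w" "euler n t u" "euler n t w"]
      by (simp add: dist_commute)
    then show "\<exists>M. \<forall>m\<ge>M. \<forall>n\<ge>M. dist (euler m t u) (euler n t u) < e" by blast
  qed
  then have "convergent (\<lambda>n. euler n t u)" by (rule Cauchy_convergent)
  then show ?thesis by (simp add: euler_limit_def convergent_LIMSEQ_iff)
qed

lemma euler_limit_linear:
  assumes "t > 0" shows "linear (euler_limit t)"
proof (rule linearI)
  fix x y c
  have "(\<lambda>n. euler n t (x + y)) \<longlonglongrightarrow> euler_limit t x + euler_limit t y"
    using assms tendsto_add[OF euler_convergent euler_convergent, OF assms assms]
    by (simp add: linear_add[OF euler_linear])
  then show "euler_limit t (x + y) = euler_limit t x + euler_limit t y"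
    using LIMSEQ_unique[OF euler_convergent[OF assms]] by blast
  have "(\<lambda>n. euler n t (c *\<^sub>R x)) \<longlonglongrightarrow> c *\<^sub>R euler_limit t x"
    using assms tendsto_scaleR[OF tendsto_const euler_convergent, OF assms]
    by (simp add: linear_scale[OF euler_linear])
  then show "euler_limit t (c *\<^sub>R x) = c *\<^sub>R euler_limit t x"
    using LIMSEQ_unique[OF euler_convergent[OF assms]] by blast
qed

lemma euler_limit_norm: "t > 0 \<Longrightarrow> norm (euler_limit t u) \<le> norm u"
  by (rule tendsto_upperbound[OF tendsto_norm[OF euler_convergent]])
    (auto intro!: always_eventually euler_norm)

lemma funpow_resolvent_sym:
  "h > 0 \<Longrightarrow> inner ((resolvent h ^^ n) u) v = inner u ((resolvent h ^^ n) v)"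
proof (induction n arbitrary: v)
  case (Suc n)
  have "inner ((resolvent h ^^ Suc n) u) v = inner ((resolvent h ^^ n) u) (resolvent h v)"
    using Suc.prems by (simp add: resolvent_sym)
  also have "\<dots> = inner u ((resolvent h ^^ n) (resolvent h v))" using Suc by blast
  finally show ?case by (simp add: funpow_swap1)
qed simp

lemma euler_limit_dist:
  assumes "gen u g" "t > 0"
  shows "norm (euler_limit t u - u) \<le> t * norm g"
  by (rule tendsto_upperbound[OF tendsto_norm[OF tendsto_diff[OF euler_convergent tendsto_const]]])
    (use assms in \<open>auto intro!: always_eventually euler_dist\<close>)

lemma dense_domain: "closure {u. \<exists>g. gen u g} = UNIV"
proof -
  have "dom2 \<subseteq> {u. \<exists>g. gen u g}" by (auto simp: dom2_def)
  then show ?thesis using dom2_dense closure_mono by blast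
qed

lemma euler_limit_semigroup: "contraction_semigroup euler_limit"
  unfolding contraction_semigroup_def
proof (intro conjI allI impI)
  fix t u v assume t: "(t::real) > 0"
  show "linear (euler_limit t)" using t by (rule euler_limit_linear)
  show "norm (euler_limit t u) \<le> norm u" using t by (rule euler_limit_norm)
  have "inner (euler n t u) v = inner u (euler n t v)" for n
    unfolding euler_def using t by (intro funpow_resolvent_sym) simp
  then have "(\<lambda>n. inner (euler n t u) v) \<longlonglongrightarrow> inner u (euler_limit t v)"
    by (simp add: tendsto_inner[OF tendsto_const euler_convergent[OF t]])
  then show "inner (euler_limit t u) v = inner u (euler_limit t v)"
    using LIMSEQ_unique tendsto_inner[OF euler_convergent[OF t] tendsto_const] by blast
next
  fix s t :: real and u assume s: "s > 0" and t: "t > 0"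
  have st: "s + t > 0" using s t by simp
  have comp: "(\<lambda>n. euler n s (euler n t u)) \<longlonglongrightarrow> euler_limit s (euler_limit t u)" for u
  proof -
    have "(\<lambda>n. euler n s (euler n t u) - euler n s (euler_limit t u)) \<longlonglongrightarrow> 0"
    proof (rule Lim_null_comparison[OF always_eventually])
      show "\<forall>n. norm (euler n s (euler n t u) - euler n s (euler_limit t u)) \<le> norm (euler n t u - euler_limit t u)"
        using euler_norm[OF s] by (simp add: linear_diff[OF euler_linear[OF s], symmetric])
      show "(\<lambda>n. norm (euler n t u - euler_limit t u)) \<longlonglongrightarrow> 0"
        using euler_convergent[OF t] by (simp add: LIM_zero_iff tendsto_norm_zero_iff)
    qed
    from tendsto_add[OF this euler_convergent[OF s, of "euler_limit t u"]] show ?thesis by simp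
  qed
  \<comment> \<open>On \<open>dom2\<close> the composition error of level n tends to 0; the set on
    which the semigroup law holds is closed.\<close>
  have dom: "euler_limit s (euler_limit t w) = euler_limit (s + t) w" if w: "w \<in> dom2" for w
  proof -
    obtain g k where gk: "gen w g" "gen g k" using w by (auto simp: dom2_def)
    have "(\<lambda>n. s * t * norm k * (1/2) ^ n) \<longlonglongrightarrow> 0"
      by (rule tendsto_mult_right_zero) (rule LIMSEQ_power_zero, simp)
    then have "(\<lambda>n. euler n s (euler n t w) - euler n (s + t) w) \<longlonglongrightarrow> 0"
      by (rule Lim_null_comparison[OF always_eventually, rotated])
        (use euler_compose_approx[OF gk s t] in \<open>simp add: power_divide\<close>)
    from LIMSEQ_unique[OF this tendsto_diff[OF comp euler_convergent[OF st]]] show ?thesis by simp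
  qed
  have "closed {w. euler_limit s (euler_limit t w) = euler_limit (s + t) w}"
    by (intro closed_Collect_eq continuous_on_compose2[of UNIV "euler_limit s" UNIV "euler_limit t"]
        continuous_on_linear_contraction euler_limit_linear euler_limit_norm s t st) auto
  then have "closure dom2 \<subseteq> {w. euler_limit s (euler_limit t w) = euler_limit (s + t) w}"
    using dom by (intro closure_minimal) auto
  then show "euler_limit s (euler_limit t u) = euler_limit (s + t) u" using dom2_dense by blast
next
  fix u
  show "((\<lambda>t. euler_limit t u) \<longlongrightarrow> u) (at_right 0)"
  proof (rule tendsto_dense_contraction[OF _ linear_ident _ dense_domain])
    show "\<forall>\<^sub>F t in at_right 0. linear (euler_limit t) \<and> (\<forall>x. norm (euler_limit t x) \<le> norm x)"
      using eventually_at_right_less[of "0::real"]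
      by eventually_elim (auto intro: euler_limit_linear euler_limit_norm)
    fix x assume "x \<in> {u. \<exists>g. gen u g}"
    then obtain g where g: "gen x g" by auto
    have "((\<lambda>t. t * norm g) \<longlongrightarrow> 0 * norm g) (at_right 0)" by (intro tendsto_intros)
    then have "((\<lambda>t. euler_limit t x - x) \<longlongrightarrow> 0) (at_right 0)"
      using Lim_null_comparison[OF eventually_mono[OF eventually_at_right_less[of "0::real"] euler_limit_dist[OF g]]]
      by simp
    then show "((\<lambda>t. euler_limit t x) \<longlongrightarrow> x) (at_right 0)" by (simp add: LIM_zero_iff)
  qed simp
qed

text \<open>Level 0 is the single step \<open>resolvent t\<close>, from which the limit differs by
  O(t^2), and the difference quotient of that single step is exactly
  \<open>- resolvent t g\<close>.\<close>

lemma euler_limit_generator_dom2: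
  assumes gk: "gen u g" "gen g k"
  shows "(u, - g) \<in> semigroup_generator euler_limit"
proof -
  have bound: "norm ((euler_limit t u - u) /\<^sub>R t - (- g)) \<le> t * (3 * norm k)" if t: "t > 0" for t
  proof -
    have "norm (euler (0 + n) t u - euler 0 t u) \<le> 2 * (t\<^sup>2 * norm k) * (1/2) ^ 0" for n
      by (rule Cauchy_of_geometric_steps(1)) (rule euler_step[OF gk t])
    then have *: "norm (euler_limit t u - resolvent t u) \<le> 2 * (t\<^sup>2 * norm k)"
      using tendsto_upperbound[OF tendsto_norm[OF tendsto_diff[OF euler_convergent[OF t] tendsto_const]]
          always_eventually trivial_limit_sequentially, of u "resolvent t u" "2 * (t\<^sup>2 * norm k)"]
      by (simp add: euler_def)
    have "(euler_limit t u - u) /\<^sub>R t - (- g)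
      = (euler_limit t u - resolvent t u) /\<^sub>R t + (g - resolvent t g)"
    proof -
      have "(u - resolvent t u) /\<^sub>R t = resolvent t g"
        using resolvent_gen_commute(2)[OF gk(1) t] t by simp
      moreover have "(euler_limit t u - u) /\<^sub>R t
        = (euler_limit t u - resolvent t u) /\<^sub>R t - (u - resolvent t u) /\<^sub>R t"
        by (simp add: scaleR_diff_right[symmetric])
      ultimately show ?thesis by simp
    qed
    also have "norm \<dots> \<le> 2 * (t\<^sup>2 * norm k) / t + t * norm k"
      using * t resolvent_dist[OF gk(2) t]
      by (intro order_trans[OF norm_triangle_ineq] add_mono)
        (auto simp: divide_inverse mult.commute norm_minus_commute intro: mult_left_mono)
    also have "\<dots> = t * (3 * norm k)" using t by (simp add: power2_eq_square field_simps)
    finally show ?thesis .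
  qed
  have "((\<lambda>t. t * (3 * norm k)) \<longlongrightarrow> 0 * (3 * norm k)) (at_right 0)" by (intro tendsto_intros)
  then have "((\<lambda>t. (euler_limit t u - u) /\<^sub>R t - (- g)) \<longlongrightarrow> 0) (at_right 0)"
    using Lim_null_comparison[OF eventually_mono[OF eventually_at_right_less[of "0::real"] bound]] by simp
  then show ?thesis by (simp add: semigroup_generator_def LIM_zero_iff del: diff_minus_eq_add)
qed

text \<open>Beyond \<open>dom2\<close> the vector is regularised by \<open>resolvent h\<close>; the
  quotient estimate is uniform in h and survives the limit. Conversely, a dissipative operator
  cannot properly extend one for which I - L is onto.\<close>

lemma semigroup_generator_euler_limit: "semigroup_generator euler_limit = form_generator E F"
proof -
  note S = euler_limit_semigroup
  have sub: "(u, - g) \<in> semigroup_generator euler_limit" if ug: "gen u g" for u g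
  proof -
    have key: "norm (euler_limit t u - u - t *\<^sub>R (- g)) \<le> t * c"
      if t: "t > 0" and c: "0 \<le> c" "\<And>s. 0 < s \<Longrightarrow> s < t \<Longrightarrow> norm (euler_limit s g - g) \<le> c" for t c
    proof -
      let ?J = "\<lambda>h. resolvent h"
      have "norm (euler_limit t (?J h u) - ?J h u - t *\<^sub>R (- ?J h g)) \<le> t * (c + 2 * norm (?J h g - g))"
        if h: "h > 0" for h
      proof (rule semigroup_quotient_bound[OF S _ _ _ t])
        show "(?J h u, - ?J h g) \<in> semigroup_generator euler_limit"
          using resolvent_gen_commute(1)[OF ug h] resolvent_gen[OF h, of g] by (rule euler_limit_generator_dom2)
        fix s assume s: "0 < s" "s < t"
        let ?d = "?J h g - g"
        have "euler_limit s (- ?J h g) - (- ?J h g) = (g - euler_limit s g) + (?d - euler_limit s ?d)"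
          by (simp add: linear_diff[OF euler_limit_linear[OF s(1)]] linear_neg[OF euler_limit_linear[OF s(1)]])
        also have "norm \<dots> \<le> norm (g - euler_limit s g) + (norm ?d + norm (euler_limit s ?d))"
          by (intro order_trans[OF norm_triangle_ineq] add_left_mono norm_triangle_ineq4)
        also have "\<dots> \<le> c + 2 * norm ?d"
          using c(2)[OF s] euler_limit_norm[OF s(1), of ?d] by (simp add: norm_minus_commute)
        finally show "norm (euler_limit s (- ?J h g) - (- ?J h g)) \<le> c + 2 * norm ?d" .
      qed (use c in simp)
      then have "\<forall>\<^sub>F h in at_right 0. norm (euler_limit t (?J h u) - ?J h u - t *\<^sub>R (- ?J h g)) \<le> t * (c + 2 * norm (?J h g - g))"
        by (intro eventually_mono[OF eventually_at_right_less[of "0::real"]]) auto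
      moreover have "((\<lambda>h. t * (c + 2 * norm (?J h g - g))) \<longlongrightarrow> t * (c + 2 * norm (g - g))) (at_right 0)"
        by (intro tendsto_intros resolvent_tendsto)
      moreover have "((\<lambda>h. euler_limit t (?J h u)) \<longlongrightarrow> euler_limit t u) (at_right 0)"
        using continuous_on_linear_contraction[OF euler_limit_linear euler_limit_norm, OF t t] resolvent_tendsto
        by (rule continuous_on_tendsto_compose) auto
      then have "((\<lambda>h. norm (euler_limit t (?J h u) - ?J h u - t *\<^sub>R (- ?J h g)))
        \<longlongrightarrow> norm (euler_limit t u - u - t *\<^sub>R (- g))) (at_right 0)"
        by (intro tendsto_intros resolvent_tendsto)
      ultimately have "norm (euler_limit t u - u - t *\<^sub>R (- g)) \<le> t * (c + 2 * norm (g - g))"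
        by (intro tendsto_le[OF trivial_limit_at_right_real])
      then show ?thesis by simp
    qed
    have "((\<lambda>t. (euler_limit t u - u) /\<^sub>R t) \<longlongrightarrow> - g) (at_right 0)"
    proof (rule tendstoI)
      fix e :: real assume e: "e > 0"
      have "\<forall>\<^sub>F t in at_right 0. dist (euler_limit t g) g < e / 2"
        using contraction_semigroupD(5)[OF S, of g] e by (intro tendstoD) auto
      then obtain b where b: "b > 0" "\<And>t. 0 < t \<Longrightarrow> t < b \<Longrightarrow> dist (euler_limit t g) g < e / 2"
        by (auto simp: eventually_at_right_field)
      have "dist ((euler_limit t u - u) /\<^sub>R t) (- g) < e" if t: "0 < t" "t < b" for t
      proof -
        have "norm (euler_limit t u - u - t *\<^sub>R (- g)) \<le> t * (e / 2)"
          by (rule key) (use t b e in \<open>force simp: dist_norm intro: less_imp_le\<close>)+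
        then have "norm ((euler_limit t u - u - t *\<^sub>R (- g)) /\<^sub>R t) \<le> e / 2"
          using t mult_left_mono[of "norm (euler_limit t u - u - t *\<^sub>R (- g))" "t * (e / 2)" "inverse t"]
          by (simp add: mult.assoc[symmetric] del: scaleR_minus_right diff_minus_eq_add)
        moreover have "(euler_limit t u - u - t *\<^sub>R (- g)) /\<^sub>R t = (euler_limit t u - u) /\<^sub>R t - (- g)"
          using t by (simp add: algebra_simps)
        ultimately have "norm ((euler_limit t u - u) /\<^sub>R t - (- g)) \<le> e / 2" by (simp only:)
        then show ?thesis using e by (simp add: dist_norm)
      qed
      then show "\<forall>\<^sub>F t in at_right 0. dist ((euler_limit t u - u) /\<^sub>R t) (- g) < e"
        using b(1) by (auto simp: eventually_at_right_field)
    qed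
    then show ?thesis by (simp add: semigroup_generator_def)
  qed
  have "gen u (- f)" if uf: "(u, f) \<in> semigroup_generator euler_limit" for u f
  proof -
    \<comment> \<open>w solves w - Lw = u - f for the form generator, so u - w is mapped to itself
      by the generator of the semigroup; dissipativity then leaves only 0.\<close>
    define w where "w = resolvent 1 (u - f)"
    have w: "gen w (u - f - w)" using resolvent_gen[of 1 "u - f"] by (simp add: w_def)
    have "(u - w, f - (- (u - f - w))) \<in> semigroup_generator euler_limit"
      by (rule semigroup_generator_diff[OF S uf sub[OF w]])
    from semigroup_dissipative[OF S this] have "inner (u - w) (u - w) \<le> 0" by simp
    then have "inner (u - w) (u - w) = 0" using inner_ge_zero[of "u - w"] by linarith
    then have "u = w" by simp
    with w show ?thesis by simp
  qed
  then have "(u, f) \<in> semigroup_generator euler_limit \<longleftrightarrow> (u, f) \<in> form_generator E F" for u f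
    using sub[of u "- f"] by (auto simp: gen_iff)
  then show ?thesis by auto
qed

text \<open>Existence gives the choice in the definition its meaning. Nothing else is known of the
  chosen semigroup, so all further facts about it come from its generator.\<close>

lemma form_semigroup:
  "contraction_semigroup (form_semigroup E F)"
  "semigroup_generator (form_semigroup E F) = form_generator E F"
  using someI_ex[of "\<lambda>T. contraction_semigroup T \<and> semigroup_generator T = form_generator E F"]
    euler_limit_semigroup semigroup_generator_euler_limit
  unfolding form_semigroup_def by blast+

abbreviation "T \<equiv> form_semigroup E F"

lemmas T_linear = contraction_semigroupD(1)[OF form_semigroup(1)]
lemmas T_norm = contraction_semigroupD(3)[OF form_semigroup(1)]
lemmas T_add = contraction_semigroupD(4)[OF form_semigroup(1)]
lemmas T_tendsto = contraction_semigroupD(5)[OF form_semigroup(1)]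

lemma gen_T: "gen u g \<Longrightarrow> (u, - g) \<in> semigroup_generator T"
  by (simp add: form_semigroup gen_iff)

lemma T_dist:
  assumes "gen u g" "t > 0"
  shows "norm (T t u - u) \<le> t * (3 * norm g)"
proof -
  have "norm (T t u - u - t *\<^sub>R (- g)) \<le> t * (2 * norm g)"
  proof (rule semigroup_quotient_bound[OF form_semigroup(1) gen_T[OF assms(1)] _ _ assms(2)])
    fix s :: real assume s: "0 < s"
    show "norm (T s (- g) - (- g)) \<le> 2 * norm g"
      using norm_triangle_ineq4[of "T s (- g)" "- g"] T_norm[OF s, of "- g"] by simp
  qed simp
  moreover have "norm (t *\<^sub>R (- g)) = t * norm g" using assms by simp
  moreover have "norm (T t u - u) \<le> norm (T t u - u - t *\<^sub>R (- g)) + norm (t *\<^sub>R (- g))"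
    using norm_triangle_ineq[of "T t u - u - t *\<^sub>R (- g)" "t *\<^sub>R (- g)"] by simp
  ultimately show ?thesis by linarith
qed

text \<open>Both vectors agree with the explicit step u - hg up to O(h^2), the semigroup with
  constant 3 and the resolvent with constant 1.\<close>

lemma T_resolvent_close:
  assumes gk: "gen u g" "gen g k" and h: "h > 0"
  shows "norm (T h u - resolvent h u) \<le> 4 * h\<^sup>2 * norm k"
proof -
  have "norm (T h u - u - h *\<^sub>R (- g)) \<le> h * (h * (3 * norm k))"
  proof (rule semigroup_quotient_bound[OF form_semigroup(1) gen_T[OF gk(1)] _ _ h])
    fix s :: real assume s: "0 < s" "s < h"
    have "norm (T s (- g) - (- g)) = norm (T s g - g)"
      using norm_minus_cancel[of "T s g - g"] by (simp add: linear_neg[OF T_linear[OF s(1)]] norm_minus_commute)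
    also have "\<dots> \<le> s * (3 * norm k)" by (rule T_dist[OF gk(2) s(1)])
    also have "\<dots> \<le> h * (3 * norm k)" using s by (intro mult_right_mono) auto
    finally show "norm (T s (- g) - (- g)) \<le> h * (3 * norm k)" .
  qed (use h in simp)
  moreover have "norm (u - h *\<^sub>R g - resolvent h u) \<le> h * (h * norm k)"
  proof -
    have "u - h *\<^sub>R g - resolvent h u = h *\<^sub>R (resolvent h g - g)"
      using resolvent_gen_commute(2)[OF gk(1) h] by (simp add: algebra_simps)
    then show ?thesis using resolvent_dist[OF gk(2) h] h by simp
  qed
  moreover have "T h u - resolvent h u = (T h u - u - h *\<^sub>R (- g)) + (u - h *\<^sub>R g - resolvent h u)" by simp
  then have "norm (T h u - resolvent h u) \<le> norm (T h u - u - h *\<^sub>R (- g)) + norm (u - h *\<^sub>R g - resolvent h u)"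
    by (simp only: norm_triangle_ineq)
  ultimately have "norm (T h u - resolvent h u) \<le> h * (h * (3 * norm k)) + h * (h * norm k)"
    by linarith
  also have "\<dots> = 4 * h\<^sup>2 * norm k" by (simp add: power2_eq_square algebra_simps)
  finally show ?thesis .
qed

text \<open>On \<open>dom2\<close> the \<open>Suc n\<close> local errors of order h^2 sum to O(1/n).
  Closed sets that all resolvents preserve are therefore preserved by the semigroup.\<close>

lemma T_eq_lim_resolvent:
  assumes t: "t > 0"
  shows "(\<lambda>n. (resolvent (t / real (Suc n)) ^^ Suc n) u) \<longlonglongrightarrow> T t u"
proof (rule tendsto_dense_contraction[OF _ T_linear[OF t] T_norm[OF t] dom2_dense])
  have h: "t / real (Suc n) > 0" for n using t by simp
  show "\<forall>\<^sub>F n in sequentially. linear (resolvent (t / real (Suc n)) ^^ Suc n) \<and>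
      (\<forall>x. norm ((resolvent (t / real (Suc n)) ^^ Suc n) x) \<le> norm x)"
    by (intro always_eventually allI conjI linear_funpow resolvent_linear funpow_resolvent_norm h)
  fix w assume "w \<in> dom2"
  then obtain g k where gk: "gen w g" "gen g k" by (auto simp: dom2_def)
  have close: "norm ((resolvent (t / real (Suc n)) ^^ Suc n) w - T t w) \<le> 4 * t\<^sup>2 * norm k * (1 / real (Suc n))" for n
  proof -
    let ?h = "t / real (Suc n)"
    have "norm ((T ?h ^^ Suc n) w - (resolvent ?h ^^ Suc n) w) \<le> real (Suc n) * (4 * ?h\<^sup>2 * norm k)"
    proof (rule norm_funpow_diff_le[OF T_linear[OF h] T_norm[OF h]])
      fix i
      have "norm (T ?h ((resolvent ?h ^^ i) w) - resolvent ?h ((resolvent ?h ^^ i) w))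
        \<le> 4 * ?h\<^sup>2 * norm ((resolvent ?h ^^ i) k)"
        by (rule T_resolvent_close[OF funpow_resolvent_gen funpow_resolvent_gen h]) (use gk h in auto)
      also have "\<dots> \<le> 4 * ?h\<^sup>2 * norm k"
        by (intro mult_left_mono funpow_resolvent_norm h) simp
      finally show "norm (T ?h ((resolvent ?h ^^ i) w) - resolvent ?h ((resolvent ?h ^^ i) w)) \<le> 4 * ?h\<^sup>2 * norm k" .
    qed
    moreover have "(T ?h ^^ Suc n) w = T t w" unfolding semigroup_funpow[OF form_semigroup(1) h] by simp
    moreover have "real (Suc n) * (4 * ?h\<^sup>2 * norm k) = 4 * t\<^sup>2 * norm k * (1 / real (Suc n))"
      by (simp add: power2_eq_square del: of_nat_Suc)
    ultimately show ?thesis by (subst norm_minus_commute) (simp only:)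
  qed
  have "(\<lambda>n. 4 * t\<^sup>2 * norm k * (1 / real (Suc n))) \<longlonglongrightarrow> 4 * t\<^sup>2 * norm k * 0"
    by (intro tendsto_intros LIMSEQ_Suc[OF lim_1_over_n])
  then have "(\<lambda>n. (resolvent (t / real (Suc n)) ^^ Suc n) w - T t w) \<longlonglongrightarrow> 0"
    unfolding mult_zero_right by (rule Lim_null_comparison[OF always_eventually[OF allI[OF close]]])
  then show "(\<lambda>n. (resolvent (t / real (Suc n)) ^^ Suc n) w) \<longlonglongrightarrow> T t w" by (rule LIM_zero_cancel)
qed

lemma T_invariant:
  assumes S: "closed S" "\<And>h u. h > 0 \<Longrightarrow> u \<in> S \<Longrightarrow> resolvent h u \<in> S" and "t > 0" "u \<in> S"
  shows "T t u \<in> S"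
proof -
  have "(resolvent h ^^ n) u \<in> S" if "h > 0" for h n
    by (induction n) (simp_all add: assms(4) S(2)[OF that])
  note * = this
  have "(resolvent (t / real (Suc n)) ^^ Suc n) u \<in> S" for n
    by (rule *) (use assms(3) in simp)
  then show ?thesis
    by (rule closed_sequentially[OF S(1) _ T_eq_lim_resolvent[OF assms(3)]])
qed

subsection \<open>Weak lower semicontinuity\<close>

text \<open>The Deny-Yosida approximation of the form: bounded and nonnegative on the whole space,
  hence weakly lower semicontinuous.\<close>

definition approx_form :: "real \<Rightarrow> 'h \<Rightarrow> real" where
  "approx_form h u = inner ((1/h) *\<^sub>R (u - resolvent h u)) u"

text \<open>With J the resolvent, the approximation equals E(Ju, u), which is at least E(Ju, Ju);
  nonnegativity of E at u - Ju then bounds it by E(u, u).\<close>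

lemma approx_form_le:
  assumes "u \<in> F" "h > 0"
  shows "approx_form h u \<le> E u u"
proof -
  let ?J = "resolvent h u" and ?g = "(1/h) *\<^sub>R (u - resolvent h u)"
  have J: "gen ?J ?g" "?J \<in> F" using resolvent_gen resolvent_mem assms by auto
  have u: "u = ?J + h *\<^sub>R ?g" using assms by simp
  have 1: "approx_form h u = E ?J u" using J assms by (simp add: approx_form_def gen_def)
  have "E ?J ?J = inner ?g ?J" using J by (simp add: gen_def)
  also have "\<dots> \<le> inner ?g (?J + h *\<^sub>R ?g)" using assms unfolding inner_add_right inner_scaleR_right by simp
  also have "\<dots> = approx_form h u" using u unfolding approx_form_def by simp
  finally have 2: "E ?J ?J \<le> E ?J u" using 1 by simp
  have "0 \<le> E (u - ?J) (u - ?J)" using assms J by simp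
  then have "2 * E ?J u \<le> E u u + E ?J ?J" using assms J by (simp add: bilin form_sym[of u ?J])
  then show ?thesis using 1 2 by linarith
qed

lemma approx_form_nonneg:
  assumes "h > 0" shows "0 \<le> approx_form h u"
proof -
  have "inner (resolvent h u) u \<le> norm (resolvent h u) * norm u" by (rule norm_cauchy_schwarz)
  also have "\<dots> \<le> norm u * norm u" by (intro mult_right_mono resolvent_norm assms) simp
  finally show ?thesis using assms
    by (simp add: approx_form_def inner_diff_left norm_eq_sqrt_inner)
qed

lemma resolvent_form_le_approx_form:
  assumes "h > 0"
  shows "E (resolvent h u) (resolvent h u) \<le> approx_form h u"
proof -
  let ?J = "resolvent h u" and ?g = "(1/h) *\<^sub>R (u - resolvent h u)"
  have "gen ?J ?g" "?J \<in> F" using resolvent_gen resolvent_mem assms by auto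
  then have "E ?J ?J = inner ?g ?J" by (simp add: gen_def)
  moreover have "inner ?g u = inner ?g ?J + h * inner ?g ?g"
    using assms by (simp add: inner_diff_right)
  moreover have "0 \<le> h * inner ?g ?g" using assms by simp
  ultimately show ?thesis unfolding approx_form_def by linarith
qed

text \<open>As the step shrinks, the energy of the resolvent grows, and the growth dominates the
  squared energy distance; so boundedness alone makes the resolvents Cauchy in energy. The cross
  term E(a, b - a) is nonnegative since (h - k)g = (b - a) + k(l - g), and l - g pairs nonnegatively
  with b - a.\<close>

lemma resolvent_form_diff:
  assumes "0 < k" "k < h"
  shows "E (resolvent k u - resolvent h u) (resolvent k u - resolvent h u)
    \<le> E (resolvent k u) (resolvent k u) - E (resolvent h u) (resolvent h u)"
proof -
  have h: "h > 0" using assms by simp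
  let ?a = "resolvent h u" and ?b = "resolvent k u"
  define g where "g = (1/h) *\<^sub>R (u - ?a)"
  define l where "l = (1/k) *\<^sub>R (u - ?b)"
  have ab: "gen ?a g" "gen ?b l" "?a \<in> F" "?b \<in> F"
    using resolvent_gen resolvent_mem h assms by (auto simp: g_def l_def)
  have u: "u = ?a + h *\<^sub>R g" "u = ?b + k *\<^sub>R l" using h assms by (simp_all add: g_def l_def)
  have eq: "(h - k) *\<^sub>R g = (?b - ?a) + k *\<^sub>R (l - g)"
    using u by (simp add: algebra_simps)
  have "(h - k) * E ?a (?b - ?a) = inner ((h - k) *\<^sub>R g) (?b - ?a)"
    using ab by (simp add: gen_def)
  also have "\<dots> = inner (?b - ?a) (?b - ?a) + k * inner (l - g) (?b - ?a)"
    unfolding eq by (simp add: inner_add_left)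
  also have "\<dots> \<ge> 0"
    using gen_nonneg[OF gen_diff[OF ab(2,1)]] assms by simp
  finally have "0 \<le> E ?a (?b - ?a)" using assms by (simp add: zero_le_mult_iff)
  then show ?thesis using ab by (simp add: bilin form_sym[of ?b ?a])
qed

text \<open>The resolvents of u have increasing bounded energy, hence form a Cauchy sequence in the
  form norm; closedness places their limit u in \<open>F\<close>.\<close>

lemma mem_if_approx_form_bounded:
  assumes C: "\<And>h. h > 0 \<Longrightarrow> approx_form h u \<le> C"
  shows "u \<in> F" "E u u \<le> C"
proof -
  define h where "h n = 1 / real (Suc n)" for n
  have h: "h n > 0" for n by (simp add: h_def)
  define w where "w n = resolvent (h n) u" for n
  have w: "w n \<in> F" for n unfolding w_def by (rule resolvent_mem[OF h])
  have wC: "E (w n) (w n) \<le> C" for n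
    unfolding w_def by (rule order_trans[OF resolvent_form_le_approx_form[OF h] C[OF h]])
  have diff: "E (w n - w m) (w n - w m) \<le> E (w n) (w n) - E (w m) (w m)" if "m \<le> n" for m n
  proof (cases "m = n")
    case False
    then show ?thesis using that h unfolding w_def
      by (intro resolvent_form_diff) (auto simp: h_def frac_less2)
  qed (use scale_left[of 0 0 0] in simp)
  have inc: "incseq (\<lambda>n. E (w n) (w n))"
    unfolding incseq_def
  proof (intro allI impI)
    fix m n :: nat assume "m \<le> n"
    then show "E (w m) (w m) \<le> E (w n) (w n)"
      using diff[of m n] nonneg[OF mem(3)[OF w w], of n m] by linarith
  qed
  have conv: "convergent (\<lambda>n. E (w n) (w n))"
    using incseq_convergent[OF inc, of C] wC by (metis convergentI)
  have h0: "filterlim h (at_right 0) sequentially"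
  proof -
    have "h \<longlonglongrightarrow> 0"
      using LIMSEQ_Suc[OF lim_1_over_n[where 'a = real]] by (simp add: h_def[abs_def])
    then show ?thesis using h by (auto simp: filterlim_at less_imp_neq[symmetric] intro!: always_eventually)
  qed
  have wu: "w \<longlonglongrightarrow> u"
    unfolding w_def using filterlim_compose[OF resolvent_tendsto h0] .
  obtain v where v: "v \<in> F" "(\<lambda>n. E (w n - v) (w n - v)) \<longlonglongrightarrow> 0" "w \<longlonglongrightarrow> v"
  proof (rule complete[OF w])
    fix e :: real assume e: "e > 0"
    from convergent_Cauchy[OF conv] e obtain M where
      M: "\<And>m n. m \<ge> M \<Longrightarrow> n \<ge> M \<Longrightarrow> dist (E (w m) (w m)) (E (w n) (w n)) < e / 2"
      unfolding Cauchy_def by (meson half_gt_zero)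
    from LIMSEQ_imp_Cauchy[OF wu] e obtain N where
      N: "\<And>m n. m \<ge> N \<Longrightarrow> n \<ge> N \<Longrightarrow> dist (w m) (w n) < sqrt (e / 2)"
      unfolding Cauchy_def by (meson half_gt_zero real_sqrt_gt_zero)
    have "form1 E (w m - w n) (w m - w n) < e" if mn: "m \<ge> max M N" "n \<ge> max M N" for m n
    proof -
      have eq: "E (w m - w n) (w m - w n) = E (w n - w m) (w n - w m)"
        using w by (simp add: bilin)
      then have "E (w m - w n) (w m - w n) < e / 2"
      proof -
        have "E (w m) (w m) - E (w n) (w n) < e / 2" "E (w n) (w n) - E (w m) (w m) < e / 2"
          using M[of m n] mn unfolding dist_real_def abs_less_iff by auto
        then show ?thesis using diff[of m n] diff[of n m] linear[of m n] eq by linarith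
      qed
      moreover have "(norm (w m - w n))\<^sup>2 < e / 2"
      proof -
        have "norm (w m - w n) < sqrt (e / 2)" using N[of m n] mn by (simp add: dist_norm)
        then have "(norm (w m - w n))\<^sup>2 < (sqrt (e / 2))\<^sup>2" by (intro power_strict_mono) auto
        then show ?thesis using e by simp
      qed
      ultimately show ?thesis by (simp add: form1_def power2_norm_eq_inner)
    qed
    then show "\<exists>N. \<forall>m\<ge>N. \<forall>n\<ge>N. form1 E (w m - w n) (w m - w n) < e" by blast
  qed
  have "u = v" using LIMSEQ_unique[OF wu v(3)] .
  then show "u \<in> F" "E u u \<le> C"
    using v LIMSEQ_le_const2[OF form_tendsto_self[OF v(1) w v(2)]] wC by auto
qed

text \<open>A nonnegative quadratic form lies above its tangent at u, and the tangent of
  \<open>approx_form h\<close> is a weakly continuous affine function. A bound uniform in h then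
  becomes a bound for E.\<close>

lemma weak_lsc:
  assumes wk: "weakly_converges un u"
  shows "extended_form E F u \<le> liminf (\<lambda>n. extended_form E F (un n))"
proof (rule dense_ge)
  fix y :: ereal assume y: "liminf (\<lambda>n. extended_form E F (un n)) < y"
  show "extended_form E F u \<le> y"
  proof (cases y)
    case (real C)
    have fr: "\<exists>\<^sub>F n in sequentially. extended_form E F (un n) < ereal C"
      using y real Liminf_bounded[of y "\<lambda>n. extended_form E F (un n)" sequentially]
      by (auto simp: frequently_def not_less)
    have "approx_form h u \<le> C" if h: "h > 0" for h
    proof (rule ccontr)
      assume "\<not> approx_form h u \<le> C"
      define g where "g = (1/h) *\<^sub>R (u - resolvent h u)"
      have le: "2 * inner (un n) g - approx_form h u \<le> approx_form h (un n)" for n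
      proof -
        have "0 \<le> approx_form h (un n - u)" by (rule approx_form_nonneg[OF h])
        also have "\<dots> = approx_form h (un n) - 2 * inner (un n) g + approx_form h u"
        proof -
          let ?J = "resolvent h"
          have "inner (un n - u - ?J (un n - u)) (un n - u)
            = inner (un n - ?J (un n)) (un n) - 2 * inner (un n) (u - ?J u) + inner (u - ?J u) u"
            using resolvent_sym[OF h, of "un n" u]
            by (simp add: linear_diff[OF resolvent_linear[OF h]] inner_diff_left inner_diff_right
                inner_commute[of u "un n"] inner_commute[of "?J u" "un n"])
          then show ?thesis unfolding approx_form_def g_def inner_scaleR_left inner_scaleR_right
            by (simp add: diff_divide_distrib add_divide_distrib)
        qed
        finally show ?thesis by simp
      qed
      have "(\<lambda>n. 2 * inner (un n) g - approx_form h u) \<longlonglongrightarrow> 2 * inner u g - approx_form h u"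
        using wk by (intro tendsto_diff tendsto_mult tendsto_const) (simp add: weakly_converges_def)
      moreover have "inner u g = approx_form h u" by (simp add: approx_form_def g_def inner_commute)
      ultimately have "\<forall>\<^sub>F n in sequentially. C < 2 * inner (un n) g - approx_form h u"
        using \<open>\<not> approx_form h u \<le> C\<close> by (intro order_tendstoD) auto
      note ev = this
      have "\<exists>n. extended_form E F (un n) < ereal C \<and> C < 2 * inner (un n) g - approx_form h u"
      proof (rule ccontr)
        assume "\<not> ?thesis"
        then have "\<forall>\<^sub>F n in sequentially. \<not> extended_form E F (un n) < ereal C"
          using ev by (auto elim: eventually_mono)
        then show False using fr by (simp add: frequently_def)
      qed
      then obtain n where n: "extended_form E F (un n) < ereal C" "C < 2 * inner (un n) g - approx_form h u"
        by blast
      then have "un n \<in> F" "E (un n) (un n) < C" by (auto simp: extended_form_def split: if_splits)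
      then show False using le[of n] n approx_form_le[OF _ h, of "un n"] by simp
    qed
    from mem_if_approx_form_bounded[OF this] show ?thesis by (simp add: extended_form_def real)
  qed (use y in auto)
qed

end

section \<open>Markov semigroups on square integrable functions\<close>

lemma L2_fun_measurable [measurable_dest]: "f \<in> L2_fun \<Longrightarrow> f \<in> borel_measurable borel"
  by (simp add: L2_fun_def)

lemma rep_L2_measurable [measurable]: "rep_L2 u \<in> borel_measurable borel"
  by (rule L2_fun_measurable) (rule rep_L2)

lemma L2_fun_bound:
  assumes "g \<in> L2_fun" "f \<in> borel_measurable borel" "AE x in lborel. \<bar>f x\<bar> \<le> \<bar>g x\<bar>"
  shows "f \<in> L2_fun"
proof -
  have "integrable lborel (\<lambda>x. (f x)\<^sup>2)"
  proof (rule Bochner_Integration.integrable_bound)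
    show "integrable lborel (\<lambda>x. (g x)\<^sup>2)" using assms by (simp add: L2_fun_def)
    show "AE x in lborel. norm ((f x)\<^sup>2) \<le> norm ((g x)\<^sup>2)"
      using assms(3) by eventually_elim (simp add: abs_le_square_iff)
  qed (use assms in measurable)
  then show ?thesis using assms by (simp add: L2_fun_def)
qed

lemma inner_to_L2: "f \<in> L2_fun \<Longrightarrow> g \<in> L2_fun \<Longrightarrow> inner (to_L2 f) (to_L2 g) = (\<integral>x. f x * g x \<partial>lborel)"
  by transfer simp

lemma to_L2_add: "f \<in> L2_fun \<Longrightarrow> g \<in> L2_fun \<Longrightarrow> to_L2 f + to_L2 g = to_L2 (\<lambda>x. f x + g x)"
  by transfer (auto simp: L2_eq_def intro: L2_fun_add)

lemma to_L2_scale: "f \<in> L2_fun \<Longrightarrow> c *\<^sub>R to_L2 f = to_L2 (\<lambda>x. c * f x)"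
  by transfer (auto simp: L2_eq_def intro: L2_fun_scale)

lemma to_L2_cong_AE:
  assumes "f \<in> L2_fun" "g \<in> L2_fun" "AE x in lborel. f x = g x"
  shows "to_L2 f = to_L2 g"
  using assms by transfer (auto simp: L2_eq_def)

lemma rep_L2_add: "AE x in lborel. rep_L2 (u + v) x = rep_L2 u x + rep_L2 v x"
  using rep_to_L2[OF L2_fun_add[OF rep_L2 rep_L2], of u v]
  by (simp add: to_L2_add[symmetric] rep_L2 to_L2_rep)

lemma rep_L2_diff: "AE x in lborel. rep_L2 (u - v) x = rep_L2 u x - rep_L2 v x"
  using rep_to_L2[OF L2_fun_diff[OF rep_L2 rep_L2], of u v]
  by (simp add: to_L2_diff[symmetric] rep_L2 to_L2_rep)

lemma rep_L2_scale: "AE x in lborel. rep_L2 (c *\<^sub>R u) x = c * rep_L2 u x"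
  using rep_to_L2[OF L2_fun_scale[OF rep_L2], of c u]
  by (simp add: to_L2_scale[symmetric] rep_L2 to_L2_rep)

lemma norm_to_L2_mono:
  assumes "f \<in> L2_fun" "g \<in> L2_fun" "AE x in lborel. \<bar>f x\<bar> \<le> \<bar>g x\<bar>"
  shows "norm (to_L2 f) \<le> norm (to_L2 g)"
proof (rule power2_le_imp_le)
  show "(norm (to_L2 f))\<^sup>2 \<le> (norm (to_L2 g))\<^sup>2"
    unfolding norm_to_L2[OF assms(1)] norm_to_L2[OF assms(2)]
  proof (rule integral_mono_AE)
    show "AE x in lborel. (f x)\<^sup>2 \<le> (g x)\<^sup>2"
      using assms(3) by eventually_elim (simp add: abs_le_square_iff)
  qed (use assms in \<open>auto simp: L2_fun_def\<close>)
qed simp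

lemma to_L2_eq_0D:
  assumes "f \<in> L2_fun" "to_L2 f = 0"
  shows "AE x in lborel. f x = 0"
proof -
  have "to_L2 (\<lambda>x. 0) = (0 :: 'a L2)" using to_L2_scale[of "\<lambda>x. 0" 0] by (simp add: L2_fun_zero)
  then have "AE x in lborel. rep_L2 (0 :: 'a L2) x = 0"
    using rep_to_L2[OF L2_fun_zero, where 'a = 'a] by simp
  with rep_to_L2[OF assms(1)] show ?thesis unfolding assms(2) by eventually_elim simp
qed

text \<open>Order intervals around 0 are the closed convex sets fed into \<open>T_invariant\<close>
  and \<open>semigroup_quotient_mem\<close>.\<close>

definition between :: "real \<Rightarrow> real \<Rightarrow> 'a::euclidean_space L2 set" where
  "between a b = {u. AE x in lborel. a \<le> rep_L2 u x \<and> rep_L2 u x \<le> b}"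

lemma to_L2_between:
  assumes "f \<in> L2_fun" "AE x in lborel. a \<le> f x \<and> f x \<le> b"
  shows "to_L2 f \<in> between a b"
  unfolding between_def mem_Collect_eq using assms(2) rep_to_L2[OF assms(1)] by eventually_elim simp

text \<open>A truncation of square integrable functions only if 0 lies between the bounds; otherwise
  the truncated function stays away from 0 at infinity and \<open>to_L2\<close> sends it to
  0.\<close>

definition clamp_L2 :: "real \<Rightarrow> real \<Rightarrow> 'a::euclidean_space L2 \<Rightarrow> 'a L2" where
  "clamp_L2 a b u = to_L2 (\<lambda>x. min (max (rep_L2 u x) a) b)"

context
  fixes a b :: real
  assumes ab: "a \<le> 0" "0 \<le> b"
begin

lemma clamp_fun: "(\<lambda>x. min (max (rep_L2 u x) a) b) \<in> L2_fun"
  by (rule L2_fun_bound[OF rep_L2[of u]]) (use ab in auto)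

lemma clamp_between: "clamp_L2 a b u \<in> between a b"
  unfolding clamp_L2_def by (rule to_L2_between[OF clamp_fun]) (use ab in auto)

lemma clamp_dist:
  assumes "v \<in> between a b"
  shows "norm (clamp_L2 a b u - v) \<le> norm (u - v)"
proof -
  have 1: "clamp_L2 a b u - v = to_L2 (\<lambda>x. min (max (rep_L2 u x) a) b - rep_L2 v x)"
    by (simp add: clamp_L2_def to_L2_diff[symmetric] clamp_fun rep_L2 to_L2_rep)
  have 2: "u - v = to_L2 (\<lambda>x. rep_L2 u x - rep_L2 v x)"
    by (simp add: to_L2_diff[symmetric] rep_L2 to_L2_rep)
  show ?thesis unfolding 1 2
  proof (rule norm_to_L2_mono)
    show "AE x in lborel. \<bar>min (max (rep_L2 u x) a) b - rep_L2 v x\<bar> \<le> \<bar>rep_L2 u x - rep_L2 v x\<bar>"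
      using assms unfolding between_def mem_Collect_eq by eventually_elim auto
  qed (intro L2_fun_diff clamp_fun rep_L2)+
qed

text \<open>A limit of points of the interval is fixed by the clamp, which brings no vector farther
  from any point of the interval. This avoids extracting an a.e. convergent subsequence.\<close>

lemma between_closed: "closed (between a b)"
proof (unfold closed_sequential_limits, intro allI impI)
  fix X :: "nat \<Rightarrow> 'a L2" and u assume X: "(\<forall>n. X n \<in> between a b) \<and> X \<longlonglongrightarrow> u"
  have "norm (clamp_L2 a b u - u) \<le> 2 * norm (u - X n)" for n
    using clamp_dist[of "X n" u] X norm_triangle_ineq4[of "clamp_L2 a b u - X n" "u - X n"] by simp
  moreover have "(\<lambda>n. 2 * norm (u - X n)) \<longlonglongrightarrow> 2 * norm (u - u)"
    using X by (intro tendsto_intros) auto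
  ultimately have "norm (clamp_L2 a b u - u) \<le> 2 * norm (u - u)"
    using LIMSEQ_le_const by blast
  then show "u \<in> between a b" using clamp_between[of u] by simp
qed

end

lemma between_convex: "convex (between a b)"
proof (rule convexI)
  fix x y :: "'a L2" and u v :: real
  assume *: "x \<in> between a b" "y \<in> between a b" "0 \<le> u" "0 \<le> v" "u + v = 1"
  show "u *\<^sub>R x + v *\<^sub>R y \<in> between a b"
    using *(1,2) rep_L2_add[of "u *\<^sub>R x" "v *\<^sub>R y"] rep_L2_scale[of u x] rep_L2_scale[of v y]
    unfolding between_def mem_Collect_eq
  proof eventually_elim
    case (elim z)
    have "u * a + v * a \<le> u * rep_L2 x z + v * rep_L2 y z"
      "u * rep_L2 x z + v * rep_L2 y z \<le> u * b + v * b"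
      using elim * by (auto intro!: add_mono mult_left_mono)
    then show ?case using elim *(5) by (simp add: distrib_right[symmetric])
  qed
qed

lemma between_scale:
  assumes "u \<in> between a b" "0 \<le> c"
  shows "c *\<^sub>R u \<in> between (c * a) (c * b)"
  using assms(1) rep_L2_scale[of c u] unfolding between_def mem_Collect_eq
  by eventually_elim (use assms(2) in \<open>auto intro: mult_left_mono\<close>)

lemma between_diff:
  assumes "u \<in> between a b" "v \<in> between c d"
  shows "u - v \<in> between (a - d) (b - c)"
  using assms rep_L2_diff[of u v] unfolding between_def mem_Collect_eq
  by eventually_elim auto

lemma indicator_L2_fun:
  assumes "A \<in> sets borel" "bounded A"
  shows "(indicator A :: 'a::euclidean_space \<Rightarrow> real) \<in> L2_fun"
proof -
  have "emeasure lborel A < \<infinity>" using emeasure_bounded_finite[OF assms(2)] by (simp add: less_top[symmetric])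
  moreover have "(\<lambda>x. (indicator A x :: real)\<^sup>2) = indicator A" by (auto simp: indicator_def)
  ultimately show ?thesis using assms by (auto simp: L2_fun_def)
qed

section \<open>The Markov property and criteria for conservativeness and explosion\<close>

locale dirichlet =
  fixes E :: "'a::euclidean_space L2 \<Rightarrow> 'a L2 \<Rightarrow> real" and F :: "'a L2 set"
  assumes dirichlet: "dirichlet_form E F"
begin

sublocale closed_dense_form E F
  using dirichlet by unfold_locales (auto simp: dirichlet_form_def)

lemma clamp_form:
  assumes "u \<in> F" shows "clamp_L2 0 1 u \<in> F" "E (clamp_L2 0 1 u) (clamp_L2 0 1 u) \<le> E u u"
  using dirichlet assms by (auto simp: dirichlet_form_def clamp_L2_def Let_def)

text \<open>The minimiser is unchanged by the unit contraction.\<close>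

lemma resolvent_between:
  assumes f: "f \<in> between 0 1" and h: "h > 0"
  shows "resolvent h f \<in> between 0 1"
proof -
  let ?u = "resolvent h f" and ?v = "clamp_L2 0 1 (resolvent h f)"
  have u: "?u \<in> F" by (rule resolvent_mem[OF h])
  note v = clamp_form[OF u]
  have "norm (?v - f) \<le> norm (?u - f)" by (rule clamp_dist[OF _ _ f]) auto
  then have "(norm (?v - f))\<^sup>2 \<le> (norm (?u - f))\<^sup>2" by (intro power_mono) auto
  then have n: "inner ?v ?v - 2 * inner f ?v \<le> inner ?u ?u - 2 * inner f ?u"
    by (simp add: power2_norm_eq_inner inner_diff_left inner_diff_right inner_commute)
  have EL: "h * E ?u w + inner ?u w = inner f w" if "w \<in> F" for w
    using resolvent_gen[OF h, of f] h that by (simp add: gen_def inner_diff_left field_simps)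
  \<comment> \<open>This is the excess of the minimised functional at \<open>?v\<close> over its
    minimum at \<open>?u\<close>; the unit contraction raises neither part of the
    functional.\<close>
  have "h * E (?v - ?u) (?v - ?u) + (norm (?v - ?u))\<^sup>2
    = h * E ?v ?v + inner ?v ?v - 2 * (h * E ?u ?v + inner ?u ?v) + (h * E ?u ?u + inner ?u ?u)"
    using u v by (simp add: bilin form_sym[of ?v ?u] power2_norm_eq_inner inner_diff_left inner_diff_right
        inner_commute[of ?v ?u] algebra_simps)
  also have "\<dots> = h * E ?v ?v + inner ?v ?v - 2 * inner f ?v + inner f ?u"
    by (simp add: EL u v)
  also have "\<dots> \<le> h * E ?u ?u + inner ?u ?u - 2 * inner f ?u + inner f ?u"
    using n mult_left_mono[OF v(2) less_imp_le[OF h]] by linarith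
  also have "\<dots> = 0" by (simp add: EL u)
  finally have "h * E (?v - ?u) (?v - ?u) + (norm (?v - ?u))\<^sup>2 \<le> 0" .
  moreover have "0 \<le> h * E (?v - ?u) (?v - ?u)" using h u v by simp
  ultimately have "(norm (?v - ?u))\<^sup>2 \<le> 0" by linarith
  then have "?v = ?u" by simp
  then show ?thesis using clamp_between[of 0 1 ?u] by simp
qed

lemma T_between:
  assumes "f \<in> between 0 1" "t > 0"
  shows "T t f \<in> between 0 1"
  by (rule T_invariant[OF between_closed _ assms(2,1)]) (auto intro: resolvent_between)

text \<open>Positive and negative part are each rescaled to the unit interval, where the Markov
  property applies.\<close>

lemma T_between_sym:
  assumes f: "f \<in> between (- c) c" and c: "c > 0" and t: "t > 0"
  shows "T t f \<in> between (- c) c"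
proof -
  let ?p = "\<lambda>x. min (max (rep_L2 f x) 0) c" and ?m = "\<lambda>x. min (max (- rep_L2 f x) 0) c"
  have L: "?p \<in> L2_fun" "?m \<in> L2_fun"
    using c by (auto intro!: L2_fun_bound[OF rep_L2[of f]])
  have "f = to_L2 (\<lambda>x. ?p x - ?m x)"
  proof (subst to_L2_rep[symmetric], rule to_L2_cong_AE[OF rep_L2 L2_fun_diff[OF L]])
    show "AE x in lborel. rep_L2 f x = ?p x - ?m x"
      using f unfolding between_def mem_Collect_eq by eventually_elim (use c in auto)
  qed
  also have "\<dots> = to_L2 ?p - to_L2 ?m" by (simp add: to_L2_diff L)
  finally have f_eq: "f = to_L2 ?p - to_L2 ?m" .
  have *: "T t (to_L2 q) \<in> between 0 c" if q: "q \<in> L2_fun" "\<And>x. 0 \<le> q x \<and> q x \<le> c" for q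
  proof -
    have "(1/c) *\<^sub>R to_L2 q \<in> between 0 1"
      using between_scale[OF to_L2_between[OF q(1)], of 0 c "1/c"] q(2) c by simp
    from between_scale[OF T_between[OF this t], of c] show ?thesis
      using c by (simp add: linear_scale[OF T_linear[OF t]])
  qed
  have "T t (to_L2 ?p) - T t (to_L2 ?m) \<in> between (0 - c) (c - 0)"
    using c by (intro between_diff * L) auto
  moreover have "T t f = T t (to_L2 ?p) - T t (to_L2 ?m)"
    using trans[OF arg_cong[OF f_eq, of "T t"] linear_diff[OF T_linear[OF t]]] .
  ultimately show ?thesis by simp
qed

definition ind :: "nat \<Rightarrow> 'a \<Rightarrow> real" where
  "ind k = indicator (ball 0 (real k))"

lemma ind_L2: "ind k \<in> L2_fun"
  unfolding ind_def by (rule indicator_L2_fun) auto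

lemma bounded_extension_one:
  "bounded_extension S (\<lambda>_. 1) x = lim (\<lambda>k. rep_L2 (S (to_L2 (ind k))) x)"
  by (simp add: bounded_extension_def ind_def)

text \<open>Increments of the indicators lie between 0 and 1, so positivity gives monotonicity in k.
  All k share one null set, which makes the pointwise limit in \<open>bounded_extension\<close>
  accessible.\<close>

lemma T_ind:
  assumes t: "t > 0"
  shows "AE x in lborel. \<forall>k. 0 \<le> rep_L2 (T t (to_L2 (ind k))) x \<and> rep_L2 (T t (to_L2 (ind k))) x \<le> 1
    \<and> rep_L2 (T t (to_L2 (ind k))) x \<le> rep_L2 (T t (to_L2 (ind (Suc k)))) x"
proof (subst AE_all_countable, intro allI)
  fix k
  have "to_L2 (ind k) \<in> between 0 1"
    by (rule to_L2_between[OF ind_L2]) (auto simp: ind_def indicator_def)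
  then have 1: "T t (to_L2 (ind k)) \<in> between 0 1" by (rule T_between[OF _ t])
  have "to_L2 (\<lambda>x. ind (Suc k) x - ind k x) \<in> between 0 1"
    by (rule to_L2_between[OF L2_fun_diff[OF ind_L2 ind_L2]]) (auto simp: ind_def indicator_def)
  then have "T t (to_L2 (ind (Suc k)) - to_L2 (ind k)) \<in> between 0 1"
    by (intro T_between[OF _ t]) (simp add: to_L2_diff ind_L2)
  then have 2: "T t (to_L2 (ind (Suc k))) - T t (to_L2 (ind k)) \<in> between 0 1"
    by (simp add: linear_diff[OF T_linear[OF t]])
  from 1 2 rep_L2_diff[of "T t (to_L2 (ind (Suc k)))" "T t (to_L2 (ind k))"]
  show "AE x in lborel. 0 \<le> rep_L2 (T t (to_L2 (ind k))) x \<and> rep_L2 (T t (to_L2 (ind k))) x \<le> 1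
    \<and> rep_L2 (T t (to_L2 (ind k))) x \<le> rep_L2 (T t (to_L2 (ind (Suc k)))) x"
    unfolding between_def mem_Collect_eq by eventually_elim auto
qed

text \<open>The quotient \<open>(T t \<phi> - \<phi>) / t\<close> stays in any order interval
  symmetric about 0 that contains L\<phi>, so at most t / (n + 1) of the mass is lost where \<phi> =
  1. Each \<phi> is supported in a ball, hence dominated by one of the truncations of 1.\<close>

lemma conservativeI:
  assumes cutoff: "\<And>n::nat. \<exists>\<phi> f. \<phi> \<in> L2_fun \<and> f \<in> L2_fun \<and> (\<forall>x. 0 \<le> \<phi> x \<and> \<phi> x \<le> 1) \<and>
     bounded {x. \<phi> x \<noteq> 0} \<and> (\<forall>x. norm x \<le> real n \<longrightarrow> \<phi> x = 1) \<and>
     (\<forall>x. \<bar>f x\<bar> \<le> 1 / real (Suc n)) \<and> (to_L2 \<phi>, to_L2 f) \<in> form_generator E F"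
  shows "conservative E F"
  unfolding conservative_def
proof (intro allI impI)
  fix t :: real assume t: "t > 0"
  obtain \<phi> f where
    L: "\<And>n. \<phi> n \<in> L2_fun" "\<And>n. f n \<in> L2_fun" and \<phi>: "\<And>n x. 0 \<le> \<phi> n x \<and> \<phi> n x \<le> 1"
    and bd: "\<And>n. bounded {x. \<phi> n x \<noteq> 0}" and one: "\<And>n x. norm x \<le> real n \<Longrightarrow> \<phi> n x = 1"
    and f: "\<And>n x. \<bar>f n x\<bar> \<le> 1 / real (Suc n)"
    and g: "\<And>n. (to_L2 (\<phi> n), to_L2 (f n)) \<in> form_generator E F"
    using cutoff by metis
  let ?s = "\<lambda>k x. rep_L2 (T t (to_L2 (ind k))) x"
  have "\<exists>k::nat. \<forall>x. \<phi> n x \<noteq> 0 \<longrightarrow> norm x < real k" for n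
  proof -
    obtain B where "\<And>x. \<phi> n x \<noteq> 0 \<Longrightarrow> norm x \<le> B" using bd[of n] by (auto simp: bounded_iff)
    then show ?thesis by (metis le_less_trans reals_Archimedean2)
  qed
  then obtain k where k: "\<And>n x. \<phi> n x \<noteq> 0 \<Longrightarrow> norm x < real (k n)" by metis
  have "AE x in lborel. \<forall>n. \<phi> n x - t / real (Suc n) \<le> ?s (k n) x"
  proof (subst AE_all_countable, intro allI)
    fix n
    let ?c = "1 / real (Suc n)"
    have c: "?c > 0" by simp
    have f_mem: "to_L2 (f n) \<in> between (- ?c) ?c"
      by (rule to_L2_between[OF L(2)]) (use f[of n] in \<open>auto simp: abs_le_iff simp del: of_nat_Suc intro: minus_le_iff[THEN iffD1]\<close>)
    have "(1/t) *\<^sub>R (T t (to_L2 (\<phi> n)) - to_L2 (\<phi> n)) \<in> between (- ?c) ?c"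
    proof (rule semigroup_quotient_mem[OF form_semigroup(1)])
      show "(to_L2 (\<phi> n), to_L2 (f n)) \<in> semigroup_generator T" using g by (simp add: form_semigroup)
      show "closed (between (- ?c) ?c)" by (rule between_closed) auto
    qed (use between_convex f_mem T_between_sym c t in blast)+
    from between_scale[OF this, of t] t
    have 1: "T t (to_L2 (\<phi> n)) - to_L2 (\<phi> n) \<in> between (t * (- ?c)) (t * ?c)" by simp
    have "to_L2 (\<lambda>x. ind (k n) x - \<phi> n x) \<in> between 0 1"
    proof (rule to_L2_between[OF L2_fun_diff[OF ind_L2 L(1)]], rule AE_I2)
      fix x show "0 \<le> ind (k n) x - \<phi> n x \<and> ind (k n) x - \<phi> n x \<le> 1"
        using \<phi>[of n x] k[of n x] by (cases "\<phi> n x = 0") (auto simp: ind_def indicator_def)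
    qed
    then have "T t (to_L2 (ind (k n)) - to_L2 (\<phi> n)) \<in> between 0 1"
      by (intro T_between[OF _ t]) (simp add: to_L2_diff ind_L2 L)
    then have 2: "T t (to_L2 (ind (k n))) - T t (to_L2 (\<phi> n)) \<in> between 0 1"
      by (simp add: linear_diff[OF T_linear[OF t]])
    from 1 2 rep_to_L2[OF L(1)[of n]] rep_L2_diff[of "T t (to_L2 (\<phi> n))" "to_L2 (\<phi> n)"]
      rep_L2_diff[of "T t (to_L2 (ind (k n)))" "T t (to_L2 (\<phi> n))"]
    show "AE x in lborel. \<phi> n x - t / real (Suc n) \<le> ?s (k n) x"
      unfolding between_def mem_Collect_eq by eventually_elim auto
  qed
  with T_ind[OF t] show "AE x in lborel. bounded_extension (T t) (\<lambda>_. 1) x = 1"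
  proof eventually_elim
    case (elim x)
    have inc: "incseq (\<lambda>k. ?s k x)" using elim(1) by (intro incseq_SucI) auto
    obtain l where l: "(\<lambda>k. ?s k x) \<longlonglongrightarrow> l" "\<And>k. ?s k x \<le> l"
      using incseq_convergent[OF inc, of 1] elim(1) by blast
    have "l \<le> 1" using LIMSEQ_le_const2[OF l(1)] elim(1) by blast
    moreover have "1 \<le> l"
    proof -
      have "(\<lambda>n. 1 - t * (1 / real (Suc n))) \<longlonglongrightarrow> 1 - t * 0"
        by (intro tendsto_intros LIMSEQ_Suc[OF lim_1_over_n])
      moreover have "\<forall>n\<ge>nat \<lceil>norm x\<rceil>. 1 - t * (1 / real (Suc n)) \<le> l"
      proof (intro allI impI)
        fix n assume "nat \<lceil>norm x\<rceil> \<le> n"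
        then have "\<phi> n x = 1" by (intro one) linarith
        then show "1 - t * (1 / real (Suc n)) \<le> l"
          using elim(2)[rule_format, of n] l(2)[of "k n"] by simp
      qed
      ultimately show ?thesis using LIMSEQ_le_const2 by fastforce
    qed
    ultimately have "(\<lambda>k. ?s k x) \<longlonglongrightarrow> 1" using l(1) by simp
    then show ?case unfolding bounded_extension_one by (rule limI)
  qed
qed

text \<open>Pairing with a bounded set turns the a.e. limit into a numerical one, so that the later
  integration over time involves no joint measurability in time and space.\<close>

lemma conservative_inner_tendsto:
  assumes cons: "conservative E F" and t: "t > 0" and A: "A \<in> sets borel" "bounded A"
  shows "(\<lambda>k. inner (T t (to_L2 (ind k))) (to_L2 (indicator A))) \<longlonglongrightarrow> measure lborel A"
proof -
  let ?s = "\<lambda>k x. rep_L2 (T t (to_L2 (ind k))) x"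
  have L: "(indicator A :: 'a \<Rightarrow> real) \<in> L2_fun" by (rule indicator_L2_fun[OF A])
  have intA: "integrable lborel (indicator A :: 'a \<Rightarrow> real)"
    using A emeasure_bounded_finite[OF A(2)] by (auto simp: less_top[symmetric])
  have eq: "inner (T t (to_L2 (ind k))) (to_L2 (indicator A)) = (\<integral>x. ?s k x * indicator A x \<partial>lborel)" for k
    using inner_to_L2[OF rep_L2 L] by (simp add: to_L2_rep)
  have "(\<lambda>k. \<integral>x. ?s k x * indicator A x \<partial>lborel) \<longlonglongrightarrow> (\<integral>x. indicator A x \<partial>lborel)"
  proof (rule integral_dominated_convergence[where w = "indicator A"])
    show "AE x in lborel. (\<lambda>k. ?s k x * indicator A x) \<longlonglongrightarrow> indicator A x"
      using T_ind[OF t] cons[unfolded conservative_def, rule_format, OF t]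
    proof eventually_elim
      case (elim x)
      have inc: "incseq (\<lambda>k. ?s k x)" using elim(1) by (intro incseq_SucI) auto
      obtain l where l: "(\<lambda>k. ?s k x) \<longlonglongrightarrow> l"
        using incseq_convergent[OF inc, of 1] elim(1) by blast
      then have "l = 1" using elim(2) unfolding bounded_extension_one by (simp add: limI)
      then have "(\<lambda>k. ?s k x * indicator A x) \<longlonglongrightarrow> 1 * indicator A x"
        using l by (intro tendsto_intros) simp
      then show ?case by simp
    qed
    show "AE x in lborel. norm (?s k x * indicator A x) \<le> indicator A x" for k
      using T_ind[OF t] by eventually_elim (auto simp: indicator_def)
  qed (use A intA in measurable)
  then show ?thesis using A by (simp add: eq)
qed

text \<open>\<open>form_semigroup\<close> is arbitrary at time 0; the value there is repaired so
  that orbits are continuous on the closed half line.\<close>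

definition T0 :: "real \<Rightarrow> 'a L2 \<Rightarrow> 'a L2" where
  "T0 t = (if t = 0 then id else T t)"

lemma T0_add: "0 \<le> s \<Longrightarrow> 0 \<le> t \<Longrightarrow> T0 s (T0 t u) = T0 (s + t) u"
  by (auto simp: T0_def T_add)

lemma T0_norm: "0 \<le> t \<Longrightarrow> norm (T0 t u) \<le> norm u"
  by (auto simp: T0_def T_norm)

lemma T0_linear: "0 \<le> t \<Longrightarrow> linear (T0 t)"
  by (auto simp: T0_def T_linear linear_id)

lemma T0_cont:
  assumes "e > 0"
  obtains d where "d > 0" "\<And>s t. 0 \<le> s \<Longrightarrow> 0 \<le> t \<Longrightarrow> \<bar>s - t\<bar> < d \<Longrightarrow> norm (T0 s u - T0 t u) < e"
proof -
  have "\<forall>\<^sub>F t in at_right 0. dist (T t u) u < e" using T_tendsto assms by (rule tendstoD)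
  then obtain d where d: "d > 0" "\<And>t. 0 < t \<Longrightarrow> t < d \<Longrightarrow> dist (T t u) u < e"
    by (auto simp: eventually_at_right_field)
  have *: "norm (T0 s u - T0 t u) < e" if "0 \<le> s" "s \<le> t" "t - s < d" for s t
  proof -
    have "norm (u - T0 (t - s) u) < e"
      using d(2)[of "t - s"] that assms by (auto simp: T0_def dist_norm norm_minus_commute)
    moreover have "T0 s u - T0 t u = T0 s (u - T0 (t - s) u)"
      using that by (simp add: linear_diff[OF T0_linear] T0_add)
    ultimately show ?thesis using T0_norm[OF that(1)] by (metis order_le_less_trans)
  qed
  show ?thesis
  proof (rule that[OF d(1)])
    fix s t :: real assume "0 \<le> s" "0 \<le> t" "\<bar>s - t\<bar> < d"
    then show "norm (T0 s u - T0 t u) < e"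
      using *[of s t] *[of t s] by (cases "s \<le> t") (auto simp: norm_minus_commute)
  qed
qed

text \<open>To the left of s the quotient estimate is based at the earlier time y, and continuity
  then exchanges \<open>T0 y g\<close> for \<open>T0 s g\<close>; each of the two errors takes half
  of e.\<close>

lemma T0_has_vector_derivative:
  assumes g: "gen u g" and s: "s \<in> {0..}"
  shows "((\<lambda>t. T0 t u) has_vector_derivative - T0 s g) (at s within {0..})"
  unfolding has_vector_derivative_def has_derivative_within_alt
proof (intro conjI allI impI)
  show "bounded_linear (\<lambda>x. x *\<^sub>R - T0 s g)" by (rule bounded_linear_scaleR_left)
  fix e :: real assume e: "0 < e"
  then obtain d where d: "d > 0" "\<And>s t. 0 \<le> s \<Longrightarrow> 0 \<le> t \<Longrightarrow> \<bar>s - t\<bar> < d \<Longrightarrow> norm (T0 s g - T0 t g) < e / 2"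
    using T0_cont[of "e / 2" g] by auto
  have key: "norm (T0 b u - T0 a u + (b - a) *\<^sub>R T0 a g) \<le> (b - a) * (e / 2)" if ab: "0 \<le> a" "a < b" "b - a < d" for a b
  proof -
    have "norm (T (b - a) u - u - (b - a) *\<^sub>R (- g)) \<le> (b - a) * (e / 2)"
    proof (rule semigroup_quotient_bound[OF form_semigroup(1) gen_T[OF g]])
      fix r :: real assume r: "0 < r" "r < b - a"
      then show "norm (T r (- g) - (- g)) \<le> e / 2"
        using d(2)[of r 0] ab norm_minus_cancel[of "T r g - g"]
        by (simp add: T0_def linear_neg[OF T_linear] norm_minus_commute)
    qed (use e ab in auto)
    moreover have "T0 b u - T0 a u + (b - a) *\<^sub>R T0 a g = T0 a (T (b - a) u - u - (b - a) *\<^sub>R (- g))"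
      using T0_add[of a "b - a" u] ab
      by (simp add: linear_diff[OF T0_linear] linear_add[OF T0_linear] linear_scale[OF T0_linear] T0_def[of "b - a"])
    ultimately show ?thesis using T0_norm[OF ab(1)] by (metis order_trans)
  qed
  show "\<exists>d>0. \<forall>y\<in>{0..}. norm (y - s) < d \<longrightarrow>
     norm (T0 y u - T0 s u - (y - s) *\<^sub>R - T0 s g) \<le> e * norm (y - s)"
  proof (intro exI[of _ d] conjI ballI impI d(1))
    fix y assume y: "y \<in> {0..}" "norm (y - s) < d"
    consider "y = s" | "s < y" | "y < s" by linarith
    then show "norm (T0 y u - T0 s u - (y - s) *\<^sub>R - T0 s g) \<le> e * norm (y - s)"
    proof cases
      case 2
      have "norm (T0 y u - T0 s u + (y - s) *\<^sub>R T0 s g) \<le> (y - s) * (e / 2)"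
        by (rule key) (use y s 2 in auto)
      also have "\<dots> \<le> e * norm (y - s)" using 2 e by simp
      finally show ?thesis by simp
    next
      case 3
      have "T0 y u - T0 s u - (y - s) *\<^sub>R - T0 s g
        = - (T0 s u - T0 y u + (s - y) *\<^sub>R T0 y g) + (s - y) *\<^sub>R (T0 y g - T0 s g)"
        by (simp add: algebra_simps)
      also have "norm \<dots> \<le> (s - y) * (e / 2) + (s - y) * (e / 2)"
      proof (intro order_trans[OF norm_triangle_ineq] add_mono)
        show "norm (- (T0 s u - T0 y u + (s - y) *\<^sub>R T0 y g)) \<le> (s - y) * (e / 2)"
          unfolding norm_minus_cancel by (rule key) (use y s 3 in auto)
        have "norm (T0 y g - T0 s g) \<le> e / 2" using d(2)[of y s] y s by simp
        then show "norm ((s - y) *\<^sub>R (T0 y g - T0 s g)) \<le> (s - y) * (e / 2)"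
          using 3 by (simp add: mult_left_mono)
      qed
      also have "\<dots> = e * norm (y - s)" using 3 by simp
      finally show ?thesis .
    qed simp
  qed
qed

text \<open>If \<open>T t 1 = 1\<close> for all \<open>t\<close> then the resolvents, being Laplace transforms of the semigroup,
  also fix \<open>1\<close>.\<close>

lemma explosiveI:
  assumes h: "h > 0" and A: "A \<in> sets borel" "bounded A" "measure lborel A > 0" and c: "c < 1"
    and bound: "\<And>k. AE x in lborel. x \<in> A \<longrightarrow> rep_L2 (resolvent h (to_L2 (ind k))) x \<le> c"
  shows "explosive E F"
  unfolding explosive_def
proof
  assume cons: "conservative E F"
  define g where "g = to_L2 (indicator A :: 'a \<Rightarrow> real)"
  define m where "m = measure lborel A"
  have LA: "(indicator A :: 'a \<Rightarrow> real) \<in> L2_fun" by (rule indicator_L2_fun[OF A(1,2)])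
  have intA: "integrable lborel (indicator A :: 'a \<Rightarrow> real)"
    using A emeasure_bounded_finite[OF A(2)] by (auto simp: less_top[symmetric])
  have ind01: "to_L2 (ind k) \<in> between 0 1" for k
    by (rule to_L2_between[OF ind_L2]) (auto simp: ind_def indicator_def)
  have inner_g: "inner u g = (\<integral>x. rep_L2 u x * indicator A x \<partial>lborel)" for u
    unfolding g_def using inner_to_L2[OF rep_L2 LA, of u] by (simp add: to_L2_rep)
  have inner_le: "inner u g \<le> b * m" if "AE x in lborel. x \<in> A \<longrightarrow> rep_L2 u x \<le> b" for u b
  proof -
    have "(\<integral>x. rep_L2 u x * indicator A x \<partial>lborel) \<le> (\<integral>x. b * indicator A x \<partial>lborel)"
    proof (rule integral_mono_AE)
      show "AE x in lborel. rep_L2 u x * indicator A x \<le> b * indicator A x"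
        using that by eventually_elim (auto simp: indicator_def)
    qed (use intA L2_fun_mult_integrable[OF rep_L2 LA] in auto)
    then show ?thesis unfolding inner_g m_def using A by simp
  qed
  have inner_ge: "0 \<le> inner u g" if "u \<in> between 0 1" for u
    unfolding inner_g
  proof (rule integral_nonneg_AE)
    show "AE x in lborel. 0 \<le> rep_L2 u x * indicator A x"
      using that unfolding between_def mem_Collect_eq by eventually_elim auto
  qed
  have T0_01: "T0 s u \<in> between 0 1" if "u \<in> between 0 1" "0 \<le> s" for u s
    using that T_between by (auto simp: T0_def)
  \<comment> \<open>The Laplace integral is cut at time t, which keeps it proper; the discarded tail
    is nonnegative.\<close>
  have step: "1 - exp (- (1/h) * t) \<le> c" if t: "t > 0" for t
  proof -
    define p where "p k s = (1/h) * exp (- (1/h) * s) * inner (T0 s (to_L2 (ind k))) g" for k s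
    have int: "(p k has_integral inner (resolvent h (to_L2 (ind k))) g
       - exp (- (1/h) * t) * inner (T0 t (resolvent h (to_L2 (ind k)))) g) {0..t}" for k
    proof -
      define f where "f = to_L2 (ind k)"
      define v where "v = resolvent h f"
      have v: "gen v ((1/h) *\<^sub>R (f - v))" unfolding v_def by (rule resolvent_gen[OF h])
      \<comment> \<open>A primitive of the integrand: as Lv = (v - f)/h, the part with v cancels
        against the derivative of the exponential and only f remains.\<close>
      define \<Phi> where "\<Phi> s = - (exp (- (1/h) * s) * inner (T0 s v) g)" for s
      have "(\<Phi> has_vector_derivative p k s) (at s within {0..t})" if s: "s \<in> {0..t}" for s
      proof -
        have "((\<lambda>t. T0 t v) has_vector_derivative - T0 s ((1/h) *\<^sub>R (f - v))) (at s within {0..})"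
          by (rule T0_has_vector_derivative[OF v]) (use s in auto)
        then have 1: "((\<lambda>t. T0 t v) has_vector_derivative - T0 s ((1/h) *\<^sub>R (f - v))) (at s within {0..t})"
          by (rule has_vector_derivative_within_subset) auto
        have 2: "((\<lambda>t. inner (T0 t v) g) has_vector_derivative inner (- T0 s ((1/h) *\<^sub>R (f - v))) g) (at s within {0..t})"
          by (rule bounded_linear.has_vector_derivative[OF bounded_linear_inner_left 1])
        have 3: "((\<lambda>s. exp (- (1/h) * s)) has_vector_derivative - (1/h) * exp (- (1/h) * s)) (at s within {0..t})"
          unfolding has_real_derivative_iff_has_vector_derivative[symmetric]
          using h by (auto intro!: derivative_eq_intros)
        have "(\<Phi> has_vector_derivative - (exp (- (1/h) * s) * inner (- T0 s ((1/h) *\<^sub>R (f - v))) g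
           + - (1/h) * exp (- (1/h) * s) * inner (T0 s v) g)) (at s within {0..t})"
          unfolding \<Phi>_def by (intro has_vector_derivative_minus has_vector_derivative_mult 2 3)
        moreover have "- (exp (- (1/h) * s) * inner (- T0 s ((1/h) *\<^sub>R (f - v))) g
           + - (1/h) * exp (- (1/h) * s) * inner (T0 s v) g) = p k s"
          using s unfolding p_def f_def[symmetric]
          by (simp add: linear_diff[OF T0_linear] linear_scale[OF T0_linear] inner_diff_left algebra_simps)
        ultimately show ?thesis by simp
      qed
      then have "(p k has_integral \<Phi> t - \<Phi> 0) {0..t}"
        by (intro fundamental_theorem_of_calculus) (use t in auto)
      moreover have "\<Phi> t - \<Phi> 0 = inner v g - exp (- (1/h) * t) * inner (T0 t v) g"
        by (simp add: \<Phi>_def T0_def)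
      ultimately show ?thesis by (simp add: v_def f_def)
    qed
    have le: "integral {0..t} (p k) \<le> c * m" for k
    proof -
      have "integral {0..t} (p k) \<le> inner (resolvent h (to_L2 (ind k))) g"
        using int[of k] inner_ge[OF T0_01[OF resolvent_between[OF ind01 h]], of t k] t
        by (simp add: integral_unique)
      also have "\<dots> \<le> c * m" by (rule inner_le[OF bound])
      finally show ?thesis .
    qed
    have lim: "(\<lambda>k. integral {0..t} (p k)) \<longlonglongrightarrow> integral {0..t} (\<lambda>s. (1/h) * exp (- (1/h) * s) * m)"
    proof (rule dominated_convergence(2)[where h = "\<lambda>s. (1/h) * exp (- (1/h) * s) * m"])
      show "p k integrable_on {0..t}" for k using int by blast
      show "(\<lambda>s. (1/h) * exp (- (1/h) * s) * m) integrable_on {0..t}"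
        by (intro integrable_continuous_real continuous_intros)
      fix s assume s: "s \<in> {0..t}"
      show "norm (p k s) \<le> (1/h) * exp (- (1/h) * s) * m" for k
      proof -
        have b: "T0 s (to_L2 (ind k)) \<in> between 0 1" using s by (intro T0_01 ind01) auto
        then have "AE x in lborel. x \<in> A \<longrightarrow> rep_L2 (T0 s (to_L2 (ind k))) x \<le> 1"
          unfolding between_def mem_Collect_eq by eventually_elim simp
        from inner_le[OF this] inner_ge[OF b] show ?thesis
          using h by (simp add: p_def abs_mult mult_left_mono divide_right_mono)
      qed
      have "(\<lambda>k. inner (T0 s (to_L2 (ind k))) g) \<longlonglongrightarrow> m"
      \<comment> \<open>Conservativeness speaks of positive times only; at time 0 the truncations
        eventually equal 1 on the bounded set \<open>A\<close>.\<close>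
      proof (cases "s = 0")
        case False
        then show ?thesis
          using conservative_inner_tendsto[OF cons _ A(1,2), of s] s by (simp add: T0_def g_def m_def)
      next
        case True
        obtain B where B: "\<And>x. x \<in> A \<Longrightarrow> norm x \<le> B" using A(2) by (auto simp: bounded_iff)
        obtain K :: nat where K: "B < real K" using reals_Archimedean2 by blast
        have "inner (T0 s (to_L2 (ind k))) g = m" if "k \<ge> K" for k
        proof -
          have "ind k x * indicator A x = indicator A x" for x
            using B[of x] K that by (auto simp: ind_def indicator_def)
          then have "(\<lambda>x. ind k x * indicator A x) = (indicator A :: 'a \<Rightarrow> real)" by (rule ext)
          then show ?thesis
            using True A by (simp add: T0_def g_def inner_to_L2[OF ind_L2 LA] m_def)
        qed
        then have "\<forall>\<^sub>F k in sequentially. inner (T0 s (to_L2 (ind k))) g = m"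
          by (auto simp: eventually_sequentially)
        then show ?thesis by (rule tendsto_eventually)
      qed
      then show "(\<lambda>k. p k s) \<longlonglongrightarrow> (1/h) * exp (- (1/h) * s) * m"
        unfolding p_def by (intro tendsto_intros)
    qed
    have "((\<lambda>s. (1/h) * exp (- (1/h) * s) * m) has_integral
       (- (exp (- (1/h) * t) * m)) - (- (exp (- (1/h) * 0) * m))) {0..t}"
      by (rule fundamental_theorem_of_calculus)
        (use t h in \<open>auto intro!: derivative_eq_intros simp: has_real_derivative_iff_has_vector_derivative[symmetric]\<close>)
    from integral_unique[OF this]
    have "integral {0..t} (\<lambda>s. (1/h) * exp (- (1/h) * s) * m) = (1 - exp (- (1/h) * t)) * m"
      by (simp only:) (simp add: algebra_simps)
    with LIMSEQ_le_const2[OF lim] le have "(1 - exp (- (1/h) * t)) * m \<le> c * m" by auto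
    then show ?thesis using A(3) by (simp add: m_def)
  qed
  have "((\<lambda>t. 1 - exp (- (1/h) * t)) \<longlongrightarrow> 1 - 0) at_top"
  proof (intro tendsto_intros filterlim_compose[OF exp_at_bot])
    show "filterlim (\<lambda>t. - (1/h) * t) at_bot at_top"
      by (rule filterlim_tendsto_neg_mult_at_bot[OF tendsto_const]) (use h in \<open>auto simp: filterlim_ident\<close>)
  qed
  then have "1 - 0 \<le> c"
    by (rule tendsto_upperbound) (use step in \<open>auto intro!: eventually_mono[OF eventually_gt_at_top[of 0]]\<close>)
  then show False using c by simp
qed

end

section \<open>Smooth functions\<close>

text \<open>The local version of \<^const>\<open>C_k\<close>, needed to compose with functions such as the logarithm.\<close>

fun C_on :: "nat \<Rightarrow> 'a::euclidean_space set \<Rightarrow> ('a \<Rightarrow> real) \<Rightarrow> bool" where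
  "C_on 0 U f \<longleftrightarrow> continuous_on U f"
| "C_on (Suc k) U f \<longleftrightarrow>
     (\<forall>x\<in>U. f differentiable at x) \<and>
     (\<forall>b\<in>Basis. C_on k U (\<lambda>x. frechet_derivative f (at x) b))"

lemma C_k_iff_C_on: "C_k k f \<longleftrightarrow> C_on k UNIV f"
  by (induction k arbitrary: f) auto

lemma C_on_cong:
  assumes "open U" "C_on k U f" "\<And>x. x \<in> U \<Longrightarrow> f x = g x"
  shows "C_on k U g"
  using assms(2,3)
proof (induction k arbitrary: f g)
  case 0
  then show ?case by (simp cong: continuous_on_cong)
next
  case (Suc k)
  have eq: "frechet_derivative f (at x) = frechet_derivative g (at x)" if "x \<in> U" for x
    using Suc.prems that by (intro frechet_derivative_transform_within_open[OF _ assms(1)]) auto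
  have "g differentiable at x" if "x \<in> U" for x
  proof -
    have "(f has_derivative frechet_derivative f (at x)) (at x)"
      using Suc.prems(1) that by (simp add: frechet_derivative_works)
    then show ?thesis
      using has_derivative_transform_within_open[OF _ assms(1) that] Suc.prems(2)
      unfolding differentiable_def by blast
  qed
  moreover have "C_on k U (\<lambda>x. frechet_derivative g (at x) b)" if "b \<in> Basis" for b
    by (rule Suc.IH[of "\<lambda>x. frechet_derivative f (at x) b"]) (use Suc.prems that eq in auto)
  ultimately show ?case by simp
qed

lemma C_on_SucI:
  assumes "open U" "\<And>x. x \<in> U \<Longrightarrow> (f has_derivative f' x) (at x)"
    "\<And>b. b \<in> Basis \<Longrightarrow> C_on k U (\<lambda>x. f' x b)"
  shows "C_on (Suc k) U f"
proof -
  have "frechet_derivative f (at x) = f' x" if "x \<in> U" for x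
    using frechet_derivative_at[OF assms(2)[OF that]] by simp
  then have "C_on k U (\<lambda>x. frechet_derivative f (at x) b)" if "b \<in> Basis" for b
    using C_on_cong[OF assms(1) assms(3)[OF that]] by simp
  then show ?thesis using assms(2) by (auto simp: differentiable_def)
qed

lemma C_on_SucD: "C_on (Suc k) U f \<Longrightarrow> C_on k U f"
proof (induction k arbitrary: f)
  case 0
  then show ?case
    by (auto intro!: continuous_at_imp_continuous_on differentiable_imp_continuous_within)
next
  case (Suc k)
  from Suc.prems have "C_on (Suc k) U (\<lambda>x. frechet_derivative f (at x) b)" if "b \<in> Basis" for b
    using that by (simp only: C_on.simps(2)[of "Suc k"])
  with Suc show ?case by simp
qed

lemma C_on_has_derivative:
  assumes "C_on (Suc k) U f" "x \<in> U"
  shows "(f has_derivative frechet_derivative f (at x)) (at x)"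
  using assms by (simp add: frechet_derivative_works)

lemma C_on_partial: "C_on (Suc k) U f \<Longrightarrow> b \<in> Basis \<Longrightarrow> C_on k U (\<lambda>x. frechet_derivative f (at x) b)"
  by simp

lemma C_on_const [intro]: "open U \<Longrightarrow> C_on k U (\<lambda>x. c)"
proof (induction k arbitrary: c)
  case (Suc k)
  show ?case by (rule C_on_SucI[OF Suc.prems has_derivative_const]) (rule Suc.IH[OF Suc.prems])
qed simp

lemma C_on_linear: "open U \<Longrightarrow> bounded_linear f \<Longrightarrow> C_on k U f"
proof (cases k)
  case (Suc j)
  assume "open U" "bounded_linear f"
  then show ?thesis unfolding Suc
    by (intro C_on_SucI[where f' = "\<lambda>x. f"]) (auto intro: bounded_linear_imp_has_derivative)
qed (simp add: linear_continuous_on)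

lemma C_on_add: "open U \<Longrightarrow> C_on k U f \<Longrightarrow> C_on k U g \<Longrightarrow> C_on k U (\<lambda>x. f x + g x)"
proof (induction k arbitrary: f g)
  case (Suc k)
  show ?case
    by (rule C_on_SucI[OF Suc.prems(1) has_derivative_add[OF C_on_has_derivative C_on_has_derivative]])
      (use Suc in auto)
qed (auto intro: continuous_intros)

lemma C_on_mult: "open U \<Longrightarrow> C_on k U f \<Longrightarrow> C_on k U g \<Longrightarrow> C_on k U (\<lambda>x. f x * g x)"
proof (induction k arbitrary: f g)
  case (Suc k)
  show ?case
    by (rule C_on_SucI[OF Suc.prems(1) has_derivative_mult[OF C_on_has_derivative C_on_has_derivative]])
      (use Suc.prems in \<open>auto simp del: C_on.simps intro!: C_on_add[OF Suc.prems(1)] Suc.IH C_on_SucD[of k U f] C_on_SucD[of k U g]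
        intro: C_on_partial\<close>)
qed (auto intro: continuous_intros)

lemma C_on_minus: "open U \<Longrightarrow> C_on k U f \<Longrightarrow> C_on k U (\<lambda>x. - f x)"
  using C_on_mult[OF _ C_on_const, of U k f "-1"] by simp

lemma C_on_diff: "open U \<Longrightarrow> C_on k U f \<Longrightarrow> C_on k U g \<Longrightarrow> C_on k U (\<lambda>x. f x - g x)"
  using C_on_add[OF _ _ C_on_minus, of U k f g] by simp

lemma C_on_sum:
  assumes "open U" "\<And>i. i \<in> I \<Longrightarrow> C_on k U (f i)"
  shows "C_on k U (\<lambda>x. \<Sum>i\<in>I. f i x)"
  using assms(2) by (induction I rule: infinite_finite_induct) (auto intro!: C_on_add assms(1))

text \<open>Induction with the inner function fixed: by the chain rule a partial derivative is a
  product of \<open>g'\<close> composed with the same f and a partial derivative of f.\<close>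

lemma C_on_compose:
  fixes g :: "real \<Rightarrow> real"
  assumes "open U"
  shows "C_on k V g \<Longrightarrow> C_on k U f \<Longrightarrow> (\<And>x. x \<in> U \<Longrightarrow> f x \<in> V) \<Longrightarrow> C_on k U (\<lambda>x. g (f x))"
proof (induction k arbitrary: g)
  case 0
  then show ?case by (auto intro: continuous_on_compose2)
next
  case (Suc k)
  have g: "(g has_derivative frechet_derivative g (at s)) (at s)" if "s \<in> V" for s
    by (rule C_on_has_derivative[OF Suc.prems(1) that])
  have lin: "frechet_derivative g (at s) y = frechet_derivative g (at s) 1 * y" if "s \<in> V" for s y
    using linear_scale[OF has_derivative_linear[OF g[OF that]], of y 1] by simp
  show ?case
  proof (rule C_on_SucI[OF assms])
    fix x assume x: "x \<in> U"
    have "((\<lambda>x. g (f x)) has_derivative (\<lambda>h. frechet_derivative g (at (f x)) (frechet_derivative f (at x) h))) (at x)"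
      by (rule has_derivative_compose[OF C_on_has_derivative[OF Suc.prems(2) x] g]) (use Suc.prems x in auto)
    then show "((\<lambda>x. g (f x)) has_derivative (\<lambda>h. frechet_derivative g (at (f x)) 1 * frechet_derivative f (at x) h)) (at x)"
      unfolding lin[OF Suc.prems(3)[OF x], of "frechet_derivative f (at x) _"] .
  next
    fix b :: 'a assume b: "b \<in> Basis"
    have "C_on k V (\<lambda>s. frechet_derivative g (at s) 1)" using Suc.prems(1) by simp
    then have "C_on k U (\<lambda>x. frechet_derivative g (at (f x)) 1)"
      using Suc.IH[OF _ C_on_SucD[OF Suc.prems(2)] Suc.prems(3)] by simp
    then show "C_on k U (\<lambda>x. frechet_derivative g (at (f x)) 1 * frechet_derivative f (at x) b)"
      using Suc.prems(2) b by (intro C_on_mult[OF assms]) auto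
  qed
qed

lemma C_on_SucI_real:
  fixes g :: "real \<Rightarrow> real"
  assumes "open V" "\<And>s. s \<in> V \<Longrightarrow> (g has_real_derivative g' s) (at s)" "C_on k V g'"
  shows "C_on (Suc k) V g"
  by (rule C_on_SucI[OF assms(1) assms(2)[unfolded has_field_derivative_def]]) (use assms in auto)

lemma C_on_inverse: "C_on k {0<..} (inverse :: real \<Rightarrow> real)"
proof (induction k)
  case (Suc k)
  show ?case
  proof (rule C_on_SucI_real)
    show "(inverse has_real_derivative - (inverse s * inverse s)) (at s)" if "s \<in> {0<..}" for s :: real
      using that by (auto intro!: derivative_eq_intros)
    show "C_on k {0<..} (\<lambda>s::real. - (inverse s * inverse s))"
      by (intro C_on_minus C_on_mult Suc) auto
  qed simp
qed (auto intro!: continuous_intros)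

lemma C_on_ln: "C_on k {0<..} (ln :: real \<Rightarrow> real)"
proof (cases k)
  case 0
  then show ?thesis by (auto intro!: continuous_intros)
next
  case (Suc j)
  show ?thesis unfolding Suc
    by (rule C_on_SucI_real[where g' = inverse]) (auto intro!: derivative_eq_intros C_on_inverse simp: inverse_eq_divide)
qed

lemma C_on_powr: "C_on k {0<..} (\<lambda>s::real. s powr p)"
proof (induction k arbitrary: p)
  case 0
  then show ?case by (auto intro!: continuous_intros)
next
  case (Suc k)
  show ?case
  proof (rule C_on_SucI_real)
    show "((\<lambda>s. s powr p) has_real_derivative p * s powr (p - 1)) (at s)" if "s \<in> {0<..}" for s :: real
      using that by (auto intro!: derivative_eq_intros)
    show "C_on k {0<..} (\<lambda>s::real. p * s powr (p - 1))"
      by (intro C_on_mult C_on_const Suc) auto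
  qed simp
qed

subsection \<open>Bump functions\<close>

text \<open>The index m makes the family closed under differentiation up to linear combinations, so
  smoothness is one induction over all m at once.\<close>

definition bump :: "nat \<Rightarrow> real \<Rightarrow> real" where
  "bump m s = (if 0 < s then inverse s ^ m * exp (- inverse s) else 0)"

lemma bump_tendsto_0: "(bump m \<longlongrightarrow> 0) (at 0)"
proof -
  have 1: "((\<lambda>s::real. inverse s ^ m / exp (inverse s)) \<longlongrightarrow> 0) (at_right 0)"
    by (rule filterlim_compose[OF tendsto_power_div_exp_0 filterlim_inverse_at_top_right])
  have "(bump m \<longlongrightarrow> 0) (at_right 0)"
    by (rule Lim_transform_eventually[OF 1 eventually_mono[OF eventually_at_right_less[of 0]]])
      (simp add: bump_def exp_minus divide_inverse)
  moreover have "(bump m \<longlongrightarrow> 0) (at_left 0)"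
  proof (rule tendsto_eventually)
    show "\<forall>\<^sub>F s in at_left 0. bump m s = 0"
      by (auto simp: eventually_at_filter bump_def)
  qed
  ultimately show ?thesis by (simp add: filterlim_split_at)
qed

lemma bump_has_derivative:
  "(bump m has_real_derivative bump (m + 2) s - real m * bump (m + 1) s) (at s)"
proof -
  consider "s < 0" | "s = 0" | "s > 0" by linarith
  then show ?thesis
  proof cases
    case 1
    have "(bump m has_real_derivative 0) (at s)"
      by (rule has_field_derivative_transform_within_open[of "\<lambda>_. 0" _ _ "{..<0}"])
        (use 1 in \<open>auto simp: bump_def\<close>)
    then show ?thesis using 1 by (simp add: bump_def)
  next
    case 2
    \<comment> \<open>The difference quotient at 0 is again a member of the family,
      \<open>bump (m + 1)\<close>.\<close>
    have "((\<lambda>h. (bump m (0 + h) - bump m 0) / h) \<longlongrightarrow> 0) (at 0)"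
    proof (rule Lim_transform_eventually[OF bump_tendsto_0[of "m + 1"]])
      show "\<forall>\<^sub>F h in at 0. bump (m + 1) h = (bump m (0 + h) - bump m 0) / h"
        by (auto simp: eventually_at_filter bump_def divide_inverse mult_ac)
    qed
    then have "(bump m has_real_derivative 0) (at 0)" by (simp add: DERIV_def)
    then show ?thesis using 2 by (simp add: bump_def)
  next
    case 3
    have "((\<lambda>s. inverse s ^ m * exp (- inverse s)) has_real_derivative
      bump (m + 2) s - real m * bump (m + 1) s) (at s)"
    proof -
      have "((\<lambda>s. inverse s ^ m) has_real_derivative - (real m * inverse s ^ (m + 1))) (at s)"
      proof (rule DERIV_cong[OF DERIV_power[OF DERIV_inverse[of s]]])
        show "s \<noteq> 0" using 3 by simp
        show "real m * (- (inverse s ^ Suc (Suc 0)) * inverse s ^ (m - Suc 0)) = - (real m * inverse s ^ (m + 1))"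
          by (cases m) (simp_all add: power2_eq_square algebra_simps)
      qed
      moreover have "((\<lambda>s. exp (- inverse s)) has_real_derivative exp (- inverse s) * inverse s ^ 2) (at s)"
        using 3 by (auto intro!: derivative_eq_intros simp: power2_eq_square)
      ultimately show ?thesis
        by (rule DERIV_cong[OF DERIV_mult]) (use 3 in \<open>simp add: bump_def power2_eq_square algebra_simps\<close>)
    qed
    then show ?thesis
      by (rule has_field_derivative_transform_within_open[of _ _ _ "{0<..}"]) (use 3 in \<open>auto simp: bump_def\<close>)
  qed
qed

lemma C_on_bump: "C_on k UNIV (bump m)"
proof (induction k arbitrary: m)
  case 0
  then show ?case
    using bump_has_derivative by (auto intro!: continuous_at_imp_continuous_on DERIV_isCont)
next
  case (Suc k)
  show ?case
    by (rule C_on_SucI_real[OF open_UNIV bump_has_derivative])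
      (intro C_on_diff C_on_mult C_on_const Suc open_UNIV)
qed

lemma bump_nonneg: "0 \<le> bump m s" by (simp add: bump_def)

lemma bump_pos: "0 < s \<Longrightarrow> 0 < bump m s" by (simp add: bump_def)

text \<open>A single term of the exponential series. The cases m = 1 and m = 2 supply the constants
  in the maximum principle.\<close>

lemma bump_le: "bump m s \<le> fact m"
proof (cases "0 < s")
  case True
  have "inverse s ^ m /\<^sub>R fact m \<le> (\<Sum>n. inverse s ^ n /\<^sub>R fact n)"
    using True sum_le_suminf[OF summable_exp_generic[of "inverse s"], of "{m}"] by simp
  then have "inverse s ^ m / fact m \<le> exp (inverse s)"
    by (simp add: exp_def scaleR_conv_of_real divide_inverse mult.commute)
  then have "inverse s ^ m \<le> fact m * exp (inverse s)"
    by (simp add: pos_divide_le_eq mult.commute)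
  then show ?thesis using True by (simp add: bump_def exp_minus field_simps)
qed (simp add: bump_def)

text \<open>Equal to 1 to the left of 0 and to 0 to the right of 1. The denominator is positive
  because s and 1 - s are never both nonpositive.\<close>

definition smooth_step :: "real \<Rightarrow> real" where
  "smooth_step s = bump 0 (1 - s) * inverse (bump 0 (1 - s) + bump 0 s)"

lemma smooth_step_denominator_pos: "0 < bump 0 (1 - s) + bump 0 s"
  using bump_pos[of s 0] bump_pos[of "1 - s" 0] bump_nonneg[of 0 s] bump_nonneg[of 0 "1 - s"]
  by (cases "0 < s") (auto intro: add_nonneg_pos add_pos_nonneg)

lemma C_on_smooth_step: "C_on k UNIV smooth_step"
proof -
  have "C_on k UNIV (\<lambda>s::real. s)" by (rule C_on_linear) (auto intro: bounded_linear_ident)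
  then have "C_on k UNIV (\<lambda>s::real. 1 - s)" by (intro C_on_diff C_on_const) auto
  then have 1: "C_on k UNIV (\<lambda>s. bump 0 (1 - s))" by (intro C_on_compose[OF _ C_on_bump]) auto
  have "C_on k UNIV (\<lambda>s. bump 0 (1 - s) + bump 0 s)" by (intro C_on_add 1 C_on_bump) auto
  then have "C_on k UNIV (\<lambda>s. inverse (bump 0 (1 - s) + bump 0 s))"
    by (intro C_on_compose[OF _ C_on_inverse]) (auto simp: smooth_step_denominator_pos)
  with 1 show ?thesis unfolding smooth_step_def[abs_def] by (intro C_on_mult) auto
qed

lemma smooth_step_bounds: "0 \<le> smooth_step s" "smooth_step s \<le> 1"
  using smooth_step_denominator_pos[of s] bump_nonneg[of 0 s] bump_nonneg[of 0 "1 - s"]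
  by (auto simp: smooth_step_def divide_inverse[symmetric])

lemma smooth_step_eq_1: "s \<le> 0 \<Longrightarrow> smooth_step s = 1"
  using smooth_step_denominator_pos[of s] by (simp add: smooth_step_def bump_def)

lemma smooth_step_eq_0: "1 \<le> s \<Longrightarrow> smooth_step s = 0"
  by (simp add: smooth_step_def bump_def)

lemma C_on_deriv:
  fixes g :: "real \<Rightarrow> real"
  assumes "\<And>k. C_on k UNIV g"
  shows "(g has_real_derivative deriv g s) (at s)" "C_on k UNIV (deriv g)"
proof -
  have *: "(g has_real_derivative frechet_derivative g (at s) 1) (at s)" for s
  proof -
    have d: "(g has_derivative frechet_derivative g (at s)) (at s)"
      using C_on_has_derivative[OF assms[of "Suc 0"]] by simp
    moreover have "frechet_derivative g (at s) = (*) (frechet_derivative g (at s) 1)"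
    proof (rule ext)
      show "frechet_derivative g (at s) y = frechet_derivative g (at s) 1 * y" for y
        using linear_scale[OF has_derivative_linear[OF d], of y 1] by simp
    qed
    ultimately show ?thesis by (simp add: has_field_derivative_def)
  qed
  then have eq: "deriv g = (\<lambda>s. frechet_derivative g (at s) 1)" by (auto intro: DERIV_imp_deriv)
  show "(g has_real_derivative deriv g s) (at s)" using * by (simp add: eq)
  show "C_on k UNIV (deriv g)" using assms[of "Suc k"] by (simp add: eq)
qed

lemma deriv_smooth_step_eq_0:
  assumes "s < 0 \<or> 1 < s"
  shows "deriv smooth_step s = 0"
proof -
  have "(smooth_step has_real_derivative 0) (at s)"
  proof (cases "s < 0")
    case True
    show ?thesis
      by (rule has_field_derivative_transform_within_open[of "\<lambda>_. 1" 0 s "{..<0}"])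
        (use True in \<open>auto simp: smooth_step_eq_1\<close>)
  next
    case False
    show ?thesis
      by (rule has_field_derivative_transform_within_open[of "\<lambda>_. 0" 0 s "{1<..}"])
        (use False assms in \<open>auto simp: smooth_step_eq_0\<close>)
  qed
  then show ?thesis by (rule DERIV_imp_deriv)
qed

lemma deriv2_smooth_step_eq_0:
  assumes "s < 0 \<or> 1 < s"
  shows "deriv (deriv smooth_step) s = 0"
proof -
  have "(deriv smooth_step has_real_derivative 0) (at s)"
    by (rule has_field_derivative_transform_within_open[of "\<lambda>_. 0" 0 s "{..<0} \<union> {1<..}"])
      (use assms in \<open>auto simp: deriv_smooth_step_eq_0\<close>)
  then show ?thesis by (rule DERIV_imp_deriv)
qed

text \<open>Both derivatives vanish off the unit interval, which is compact.\<close>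

lemma smooth_step_derivs_bounded:
  obtains C where "C > 0" "\<And>s. \<bar>deriv smooth_step s\<bar> \<le> C" "\<And>s. \<bar>deriv (deriv smooth_step) s\<bar> \<le> C"
proof -
  have bnd: "\<exists>C. \<forall>s. \<bar>f s\<bar> \<le> C" if "continuous_on UNIV f" "\<And>s. s < 0 \<or> 1 < s \<Longrightarrow> f s = 0" for f :: "real \<Rightarrow> real"
  proof -
    have "compact (f ` {0..1})"
      using that(1) by (intro compact_continuous_image) (auto intro: continuous_on_subset)
    then obtain C where "\<And>s. s \<in> {0..1} \<Longrightarrow> \<bar>f s\<bar> \<le> C"
      using compact_imp_bounded by (fastforce simp: bounded_iff)
    then have "\<bar>f s\<bar> \<le> max C 0" for s using that(2)[of s] by (cases "s \<in> {0..1}") force+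
    then show ?thesis by blast
  qed
  have c1: "C_on k UNIV (deriv smooth_step)" for k by (rule C_on_deriv(2)) (rule C_on_smooth_step)
  have c2: "C_on k UNIV (deriv (deriv smooth_step))" for k by (rule C_on_deriv(2)) (rule c1)
  obtain C1 where "\<And>s. \<bar>deriv smooth_step s\<bar> \<le> C1"
    using bnd[of "deriv smooth_step"] c1[of 0] deriv_smooth_step_eq_0 by auto
  moreover obtain C2 where "\<And>s. \<bar>deriv (deriv smooth_step) s\<bar> \<le> C2"
    using bnd[of "deriv (deriv smooth_step)"] c2[of 0] deriv2_smooth_step_eq_0 by auto
  ultimately show ?thesis
    by (intro that[of "max 1 (max C1 C2)"]) (simp_all add: le_max_iff_disj)
qed

subsection \<open>Compactly supported smooth functions\<close>

lemma C_c_infinity_iff: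
  "f \<in> C_c_infinity \<longleftrightarrow> (\<forall>k. C_on k UNIV f) \<and> (\<exists>R. \<forall>x. R < norm x \<longrightarrow> f x = 0)"
proof -
  have "bounded {x. f x \<noteq> 0} \<longleftrightarrow> (\<exists>R. \<forall>x. R < norm x \<longrightarrow> f x = 0)"
    by (auto simp: bounded_iff not_le[symmetric])
  then show ?thesis by (simp add: C_c_infinity_def C_k_iff_C_on)
qed

lemma smoothD:
  assumes 1: "\<And>k. C_on k UNIV f"
  shows "continuous_on A f" "f \<in> borel_measurable borel"
    "(f has_derivative (\<lambda>h. inner (gradient f x) h)) (at x)" "continuous_on A (gradient f)"
proof -
  have "continuous_on UNIV f" using 1[of 0] by simp
  then show "continuous_on A f" "f \<in> borel_measurable borel"
    by (auto intro: continuous_on_subset borel_measurable_continuous_onI)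
  have d: "(f has_derivative frechet_derivative f (at x)) (at x)"
    using C_on_has_derivative[OF 1[of "Suc 0"]] by simp
  have "frechet_derivative f (at x) h = inner (gradient f x) h" for h
  proof -
    have "frechet_derivative f (at x) h = frechet_derivative f (at x) (\<Sum>b\<in>Basis. inner h b *\<^sub>R b)"
      by (simp add: euclidean_representation)
    also have "\<dots> = (\<Sum>b\<in>Basis. inner h b * frechet_derivative f (at x) b)"
      by (simp add: linear_sum[OF has_derivative_linear[OF d]] linear_scale[OF has_derivative_linear[OF d]])
    also have "\<dots> = inner (gradient f x) h"
      unfolding gradient_def inner_sum_left inner_scaleR_left
      by (intro sum.cong) (auto simp: inner_commute mult.commute)
    finally show ?thesis .
  qed
  then have "frechet_derivative f (at x) = (\<lambda>h. inner (gradient f x) h)" by (rule ext)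
  then show "(f has_derivative (\<lambda>h. inner (gradient f x) h)) (at x)" using d by (simp only:)
  have "continuous_on UNIV (\<lambda>x. frechet_derivative f (at x) b)" if "b \<in> Basis" for b
    using 1[of "Suc 0"] that by simp
  then have "continuous_on UNIV (gradient f)"
    unfolding gradient_def by (intro continuous_intros)
  then show "continuous_on A (gradient f)" by (rule continuous_on_subset) simp
qed

lemma C_c_infinityD:
  assumes "f \<in> C_c_infinity"
  shows "C_on k UNIV f" "\<exists>R. \<forall>x. R < norm x \<longrightarrow> f x = 0" "continuous_on A f" "f \<in> borel_measurable borel"
    "(f has_derivative (\<lambda>h. inner (gradient f x) h)) (at x)" "continuous_on A (gradient f)"
  using assms smoothD[of f] by (simp_all add: C_c_infinity_iff)

lemma gradient_eqI:
  assumes "(f has_derivative (\<lambda>h. inner g h)) (at x)"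
  shows "gradient f x = g"
  using frechet_derivative_at[OF assms, symmetric] 
  by (simp add: gradient_def euclidean_representation)

lemma gradient_support:
  assumes "\<And>x. R < norm x \<Longrightarrow> f x = 0" "R < norm x"
  shows "gradient f x = 0"
proof (rule gradient_eqI)
  have "((\<lambda>_. 0::real) has_derivative (\<lambda>h. inner 0 h)) (at x)" by simp
  then show "(f has_derivative (\<lambda>h. inner 0 h)) (at x)"
  proof (rule has_derivative_transform_within_open)
    show "open {x::'a. R < norm x}" by (intro open_Collect_less continuous_intros)
  qed (use assms in auto)
qed

lemma integrable_compact_support:
  fixes f :: "'a::euclidean_space \<Rightarrow> real"
  assumes "continuous_on UNIV f" "\<And>x. R < norm x \<Longrightarrow> f x = 0"
  shows "integrable lborel f"
proof -
  have "integrable lborel (\<lambda>x. indicator (cball 0 R) x *\<^sub>R f x)"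
    by (intro borel_integrable_compact continuous_on_subset[OF assms(1)]) auto
  moreover have "(\<lambda>x. indicator (cball 0 R) x *\<^sub>R f x) = f"
    using assms(2) by (auto simp: indicator_def fun_eq_iff not_le)
  ultimately show ?thesis by simp
qed

lemma C_c_infinity_L2: 
  assumes "f \<in> C_c_infinity" shows "f \<in> L2_fun"
proof -
  obtain R where R: "\<And>x. R < norm x \<Longrightarrow> f x = 0" using C_c_infinityD(2)[OF assms] by blast
  have "integrable lborel (\<lambda>x. (f x)\<^sup>2)"
    by (rule integrable_compact_support[of _ R]) (use R C_c_infinityD(3)[OF assms] in \<open>auto intro!: continuous_intros\<close>)
  then show ?thesis using C_c_infinityD(4)[OF assms] by (simp add: L2_fun_def)
qed

lemma C_c_infinity_mult:
  assumes "f \<in> C_c_infinity" "\<And>k. C_on k UNIV g"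
  shows "(\<lambda>x. f x * g x) \<in> C_c_infinity"
proof -
  obtain R where "\<And>x. R < norm x \<Longrightarrow> f x = 0" using C_c_infinityD(2)[OF assms(1)] by blast
  then have "\<exists>R. \<forall>x. R < norm x \<longrightarrow> f x * g x = 0" by auto
  then show ?thesis using assms by (auto simp: C_c_infinity_iff intro!: C_on_mult)
qed

lemma C_c_infinity_add:
  assumes "f \<in> C_c_infinity" "g \<in> C_c_infinity"
  shows "(\<lambda>x. f x + g x) \<in> C_c_infinity"
proof -
  obtain R S where "\<And>x. R < norm x \<Longrightarrow> f x = 0" "\<And>x. S < norm x \<Longrightarrow> g x = 0"
    using C_c_infinityD(2) assms by metis
  then have "\<exists>R. \<forall>x. R < norm x \<longrightarrow> f x + g x = 0" by (intro exI[of _ "max R S"]) auto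
  then show ?thesis using assms by (auto simp: C_c_infinity_iff intro!: C_on_add)
qed

lemma C_c_infinity_scale: "f \<in> C_c_infinity \<Longrightarrow> (\<lambda>x. c * f x) \<in> C_c_infinity"
  using C_c_infinity_mult[of f "\<lambda>_. c"] by (auto simp: mult.commute intro!: C_on_const)

lemma energy_integrable:
  assumes "u \<in> C_c_infinity" "v \<in> C_c_infinity" "continuous_on UNIV \<alpha>"
  shows "integrable lborel (\<lambda>x. \<alpha> x * inner (gradient u x) (gradient v x))"
proof -
  obtain R where "\<And>x. R < norm x \<Longrightarrow> u x = 0" using C_c_infinityD(2)[OF assms(1)] by blast
  then have "R < norm x \<Longrightarrow> gradient u x = 0" for x by (rule gradient_support)
  then show ?thesis
    by (intro integrable_compact_support[of _ R])
      (auto intro!: continuous_intros assms C_c_infinityD(6))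
qed

subsection \<open>Integration by parts\<close>

lemma integral_translation:
  fixes f :: "'a::euclidean_space \<Rightarrow> real"
  assumes [measurable]: "f \<in> borel_measurable borel"
  shows "(\<integral>x. f (c + x) \<partial>lborel) = (\<integral>x. f x \<partial>lborel)"
proof -
  have "(\<integral>x. f x \<partial>lborel) = (\<integral>x. f x \<partial>distr lborel borel ((+) c))" by (simp add: lborel_distr_plus)
  also have "\<dots> = (\<integral>x. f (c + x) \<partial>lborel)" by (rule integral_distr) auto
  finally show ?thesis by simp
qed

text \<open>Translation invariance makes the integral of each difference quotient 0, and dominated
  convergence passes to the derivative; iterated integrals are avoided.\<close>

lemma integral_partial_derivative_eq_0:
  fixes w :: "'a::euclidean_space \<Rightarrow> real"
  assumes w: "\<And>x. (w has_derivative w' x) (at x)" and supp: "\<And>x. R < norm x \<Longrightarrow> w x = 0"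
    and b: "b \<in> Basis" and B: "\<And>x. \<bar>w' x b\<bar> \<le> B"
  shows "(\<integral>x. w' x b \<partial>lborel) = 0"
proof -
  define q where "q n x = real (Suc n) * (w ((1 / real (Suc n)) *\<^sub>R b + x) - w x)" for n x
  have cont: "continuous_on UNIV w"
    using w by (auto intro!: continuous_at_imp_continuous_on has_derivative_continuous)
  have wm [measurable]: "w \<in> borel_measurable borel" by (rule borel_measurable_continuous_onI[OF cont])
  have qm [measurable]: "q n \<in> borel_measurable borel" for n unfolding q_def by measurable
  have path: "((\<lambda>t. w (t *\<^sub>R b + x)) has_real_derivative w' (t *\<^sub>R b + x) b) (at t)" for t x
  proof -
    have "((\<lambda>t. w (t *\<^sub>R b + x)) has_derivative (\<lambda>h. w' (t *\<^sub>R b + x) (h *\<^sub>R b))) (at t)"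
      by (rule has_derivative_compose[OF _ w]) (auto intro!: derivative_eq_intros)
    then show ?thesis
      unfolding has_field_derivative_def
      by (simp add: linear_scale[OF has_derivative_linear[OF w]] mult.commute[of _ "w' _ b"])
  qed
  have lim: "(\<lambda>n. q n x) \<longlonglongrightarrow> w' x b" for x
  proof -
    have "((\<lambda>h. (w ((0 + h) *\<^sub>R b + x) - w (0 *\<^sub>R b + x)) / h) \<longlongrightarrow> w' x b) (at 0)"
      using path[of x 0] unfolding DERIV_def by simp
    moreover have "filterlim (\<lambda>n. 1 / real (Suc n)) (at 0) sequentially"
      using LIMSEQ_Suc[OF lim_1_over_n[where 'a = real]] by (auto simp: filterlim_at)
    ultimately have "(\<lambda>n. (w ((0 + 1 / real (Suc n)) *\<^sub>R b + x) - w (0 *\<^sub>R b + x)) / (1 / real (Suc n))) \<longlonglongrightarrow> w' x b"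
      by (rule filterlim_compose)
    then show ?thesis by (simp add: q_def mult.commute)
  qed
  \<comment> \<open>The mean value theorem gives the bound \<open>B\<close>. The increments have
    length at most 1, so all quotients vanish beyond radius \<open>R + 1\<close>.\<close>
  have bound: "\<bar>q n x\<bar> \<le> B * indicator (cball 0 (R + 1)) x" for n x
  proof -
    let ?h = "1 / real (Suc n)"
    have h: "0 < ?h" "?h \<le> 1" by auto
    obtain z where z: "w (?h *\<^sub>R b + x) - w (0 *\<^sub>R b + x) = (?h - 0) * w' (z *\<^sub>R b + x) b"
      using MVT2[OF h(1), of "\<lambda>t. w (t *\<^sub>R b + x)" "\<lambda>t. w' (t *\<^sub>R b + x) b"] path by blast
    have "q n x = w' (z *\<^sub>R b + x) b" using z by (simp add: q_def del: of_nat_Suc)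
    moreover have "q n x = 0" if "R + 1 < norm x"
    proof -
      have "norm x \<le> norm (?h *\<^sub>R b + x) + norm (?h *\<^sub>R b)"
        using norm_triangle_ineq4[of "?h *\<^sub>R b + x" "?h *\<^sub>R b"] by simp
      also have "norm (?h *\<^sub>R b) \<le> 1" using b h by simp
      finally show ?thesis using that supp[of x] supp[of "?h *\<^sub>R b + x"] by (simp add: q_def)
    qed
    ultimately show ?thesis using B[of "z *\<^sub>R b + x"] by (auto simp: indicator_def not_le)
  qed
  have int0: "(\<integral>x. q n x \<partial>lborel) = 0" for n
  proof -
    have iw: "integrable lborel w" by (rule integrable_compact_support[OF cont supp])
    have "integrable (distr lborel borel ((+) ((1 / real (Suc n)) *\<^sub>R b))) w"
      using iw by (simp add: lborel_distr_plus)
    then have iw': "integrable lborel (\<lambda>x. w ((1 / real (Suc n)) *\<^sub>R b + x))"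
      by (subst (asm) integrable_distr_eq) auto
    show ?thesis unfolding q_def using iw iw' integral_translation[OF wm] by simp
  qed
  have "(\<lambda>n. \<integral>x. q n x \<partial>lborel) \<longlonglongrightarrow> (\<integral>x. w' x b \<partial>lborel)"
  proof (rule integral_dominated_convergence[where w = "\<lambda>x. B * indicator (cball 0 (R + 1)) x"])
    show "(\<lambda>x. w' x b) \<in> borel_measurable lborel"
    proof (rule borel_measurable_LIMSEQ_real)
      show "(\<lambda>n. q n x) \<longlonglongrightarrow> w' x b" for x by (rule lim)
    qed simp
    have "emeasure lborel (cball 0 (R + 1) :: 'a set) < \<infinity>"
      using emeasure_bounded_finite[of "cball 0 (R + 1) :: 'a set"] by (simp add: less_top[symmetric])
    then show "integrable lborel (\<lambda>x. B * indicator (cball 0 (R + 1) :: 'a set) x)" by simp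
  qed (use lim bound in auto)
  then show ?thesis using int0 by (simp add: LIMSEQ_const_iff)
qed

text \<open>The factor \<open>inner x b\<close> compensates for the norm not being differentiable at
  the origin. There the last quotient is 0 by the convention for division by zero, which is the
  correct value.\<close>

lemma has_derivative_radial_component:
  fixes b x :: "'a::euclidean_space" and m m' :: "real \<Rightarrow> real"
  assumes m: "\<And>r. 0 \<le> r \<Longrightarrow> (m has_real_derivative m' r) (at r)"
  shows "((\<lambda>x. inner x b * m (norm x)) has_derivative
    (\<lambda>h. inner h b * m (norm x) + inner x b * m' (norm x) * inner x h / norm x)) (at x)"
proof (cases "x = 0")
  case False
  have "(norm has_derivative (\<lambda>h. inner x h / norm x)) (at x)"
    using has_derivative_norm[OF False] by (simp add: sgn_div_norm inner_commute divide_inverse mult.commute)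
  from has_derivative_compose[OF this m[OF norm_ge_zero, unfolded has_field_derivative_def]]
  have "((\<lambda>x. m (norm x)) has_derivative (\<lambda>h. m' (norm x) * (inner x h / norm x))) (at x)" .
  from has_derivative_mult[OF bounded_linear_imp_has_derivative[OF bounded_linear_inner_left] this, of b]
  show ?thesis by (rule has_derivative_eq_rhs) (simp add: fun_eq_iff)
next
  case True
  have cont: "(m \<longlongrightarrow> m 0) (at 0)" using DERIV_isCont[OF m[of 0]] by (simp add: isCont_def)
  have "((\<lambda>h. norm (inner h b * m (norm h) - inner h b * m 0) / norm h) \<longlongrightarrow> 0) (at 0)"
  proof (rule Lim_null_comparison)
    show "\<forall>\<^sub>F h in at 0. norm (norm (inner h b * m (norm h) - inner h b * m 0) / norm h) \<le> norm b * \<bar>m (norm h) - m 0\<bar>"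
      unfolding eventually_at_filter
    proof (intro always_eventually allI impI)
      fix h :: 'a assume h: "h \<noteq> 0"
      have "norm (inner h b * m (norm h) - inner h b * m 0) = \<bar>inner h b\<bar> * \<bar>m (norm h) - m 0\<bar>"
        by (simp add: abs_mult[symmetric] right_diff_distrib)
      also have "\<dots> \<le> (norm h * norm b) * \<bar>m (norm h) - m 0\<bar>"
        by (intro mult_right_mono Cauchy_Schwarz_ineq2) auto
      finally show "norm (norm (inner h b * m (norm h) - inner h b * m 0) / norm h) \<le> norm b * \<bar>m (norm h) - m 0\<bar>"
        using h by (simp add: field_simps)
    qed
    have "filterlim (norm :: 'a \<Rightarrow> real) (at 0) (at 0)"
      by (auto simp: filterlim_at eventually_at_filter tendsto_norm_zero)
    from filterlim_compose[OF cont this]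
    have "((\<lambda>h::'a. norm b * \<bar>m (norm h) - m 0\<bar>) \<longlongrightarrow> norm b * \<bar>m 0 - m 0\<bar>) (at 0)"
      by (intro tendsto_intros)
    then show "((\<lambda>h::'a. norm b * \<bar>m (norm h) - m 0\<bar>) \<longlongrightarrow> 0) (at 0)" by simp
  qed
  then show ?thesis unfolding True
    by (simp add: has_derivative_at bounded_linear_mult_const bounded_linear_inner_left)
qed

text \<open>The divergence theorem for the field v(x) m(|x|) x, coordinate by coordinate; the
  divergence of m(|x|) x is d m + r m' with d the dimension. The field need not be smooth at 0, so
  its partial derivatives are examined there separately.\<close>

lemma radial_integration_by_parts:
  fixes v :: "'a::euclidean_space \<Rightarrow> real" and m m' :: "real \<Rightarrow> real"
  assumes v: "v \<in> C_c_infinity"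
    and m: "\<And>r. 0 \<le> r \<Longrightarrow> (m has_real_derivative m' r) (at r)" and m': "continuous_on {0..} m'"
  shows "(\<integral>x. m (norm x) * inner x (gradient v x) \<partial>lborel)
    = - (\<integral>x. (DIM('a) * m (norm x) + norm x * m' (norm x)) * v x \<partial>lborel)"
    "integrable lborel (\<lambda>x. (DIM('a) * m (norm x) + norm x * m' (norm x)) * v x)"
proof -
  obtain R where R: "\<And>x. R < norm x \<Longrightarrow> v x = 0" using C_c_infinityD(2)[OF v] by blast
  have gR: "\<And>x. R < norm x \<Longrightarrow> gradient v x = 0" using R by (rule gradient_support)
  have mc: "continuous_on {0..} m"
    using m by (auto intro!: continuous_at_imp_continuous_on DERIV_isCont)
  have cm [continuous_intros]: "continuous_on A (\<lambda>x::'a. m (norm x))" for A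
    by (rule continuous_on_compose2[OF mc]) (auto intro: continuous_intros)
  have cm' [continuous_intros]: "continuous_on A (\<lambda>x::'a. m' (norm x))" for A
    by (rule continuous_on_compose2[OF m']) (auto intro: continuous_intros)
  note cv = C_c_infinityD(3)[OF v] C_c_infinityD(6)[OF v]
  have ints: "integrable lborel (\<lambda>x. m (norm x) * inner x (gradient v x))"
    "integrable lborel (\<lambda>x. (DIM('a) * m (norm x) + norm x * m' (norm x)) * v x)"
    by (rule integrable_compact_support[of _ R]; use R gR in \<open>auto intro!: continuous_intros cv\<close>)+
  show "integrable lborel (\<lambda>x. (DIM('a) * m (norm x) + norm x * m' (norm x)) * v x)" by (rule ints)
  define D where "D b x h = v x * (inner h b * m (norm x) + inner x b * m' (norm x) * inner x h / norm x)
     + inner (gradient v x) h * (inner x b * m (norm x))" for b x h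
  have der: "((\<lambda>x. v x * (inner x b * m (norm x))) has_derivative D b x) (at x)" for b x
    unfolding D_def by (rule has_derivative_mult[OF C_c_infinityD(5)[OF v] has_derivative_radial_component[OF m]])
  have zero: "(\<integral>x. D b x b \<partial>lborel) = 0" "integrable lborel (\<lambda>x. D b x b)" if b: "b \<in> Basis" for b
  proof -
    have Dc: "continuous_on UNIV (\<lambda>x. v x * m (norm x) + inner (gradient v x) b * (inner x b * m (norm x)))"
      by (intro continuous_intros cv)
    have e: "D b x b = (v x * m (norm x) + inner (gradient v x) b * (inner x b * m (norm x)))
      + v x * m' (norm x) * ((inner x b)\<^sup>2 / norm x)" for x
      using b by (simp add: D_def power2_eq_square algebra_simps)
    \<comment> \<open>At the origin the quotient 0/0 is 0, which is also the limit.\<close>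
    have sq: "continuous_on UNIV (\<lambda>x. (inner x b)\<^sup>2 / norm x)"
    proof (rule continuous_at_imp_continuous_on, intro ballI)
      fix x :: 'a
      show "isCont (\<lambda>x. (inner x b)\<^sup>2 / norm x) x"
      proof (cases "x = 0")
        case True
        have "((\<lambda>x. (inner x b)\<^sup>2 / norm x) \<longlongrightarrow> 0) (at (0::'a))"
        proof (rule Lim_null_comparison)
          show "\<forall>\<^sub>F x in at 0. norm ((inner x b)\<^sup>2 / norm x) \<le> norm x"
            unfolding eventually_at_filter
          proof (intro always_eventually allI impI)
            fix x :: 'a assume "x \<noteq> 0"
            have "(inner x b)\<^sup>2 \<le> (norm x)\<^sup>2"
              using Cauchy_Schwarz_ineq2[of x b] b by (simp add: abs_le_square_iff[symmetric])
            then show "norm ((inner x b)\<^sup>2 / norm x) \<le> norm x"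
              using \<open>x \<noteq> 0\<close> by (simp add: field_simps power2_eq_square)
          qed
        qed (rule tendsto_norm_zero, rule tendsto_ident_at)
        then show ?thesis using True by (simp add: isCont_def)
      qed (auto intro!: continuous_intros)
    qed
    have Dcont: "continuous_on UNIV (\<lambda>x. D b x b)"
      unfolding e by (intro continuous_intros cv Dc sq)
    have Dsupp: "R < norm x \<Longrightarrow> D b x b = 0" for x using R gR by (simp add: D_def)
    show "integrable lborel (\<lambda>x. D b x b)" by (rule integrable_compact_support[OF Dcont Dsupp])
    have "compact ((\<lambda>x. D b x b) ` cball 0 R)"
      by (intro compact_continuous_image continuous_on_subset[OF Dcont]) auto
    then obtain B where B: "\<And>x. norm x \<le> R \<Longrightarrow> \<bar>D b x b\<bar> \<le> B"
      using compact_imp_bounded by (fastforce simp: bounded_iff)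
    have "\<bar>D b x b\<bar> \<le> max B 0" for x using B[of x] Dsupp[of x] by (cases "norm x \<le> R") auto
    then show "(\<integral>x. D b x b \<partial>lborel) = 0"
      by (intro integral_partial_derivative_eq_0[OF der _ b]) (use R in auto)
  qed
  have pw: "(\<Sum>b\<in>Basis. D b x b)
    = m (norm x) * inner x (gradient v x) + (DIM('a) * m (norm x) + norm x * m' (norm x)) * v x" for x
  proof -
    have s1: "(\<Sum>b\<in>Basis. inner x b * inner x b) = norm x * norm x"
      by (simp add: euclidean_inner[of x x, symmetric] power2_norm_eq_inner[symmetric] power2_eq_square)
    have s2: "(\<Sum>b\<in>Basis. inner (gradient v x) b * inner x b) = inner x (gradient v x)"
      by (simp add: euclidean_inner[of x "gradient v x"] mult.commute)
    have "(\<Sum>b\<in>Basis. D b x b) = (\<Sum>b\<in>Basis. v x * m (norm x)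
       + v x * m' (norm x) / norm x * (inner x b * inner x b) + m (norm x) * (inner (gradient v x) b * inner x b))"
      by (intro sum.cong) (auto simp: D_def field_simps)
    also have "\<dots> = v x * (DIM('a) * m (norm x)) + v x * m' (norm x) / norm x * (norm x * norm x)
       + m (norm x) * inner x (gradient v x)"
      by (simp only: sum.distrib sum_distrib_left[symmetric] s1 s2 sum_constant)
    finally show ?thesis by (cases "x = 0") (simp_all add: algebra_simps)
  qed
  have "0 = (\<integral>x. (\<Sum>b\<in>Basis. D b x b) \<partial>lborel)"
    using zero by (simp add: Bochner_Integration.integral_sum)
  also have "\<dots> = (\<integral>x. m (norm x) * inner x (gradient v x) \<partial>lborel)
    + (\<integral>x. (DIM('a) * m (norm x) + norm x * m' (norm x)) * v x \<partial>lborel)"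
    unfolding pw using ints by (rule Bochner_Integration.integral_add)
  finally show "(\<integral>x. m (norm x) * inner x (gradient v x) \<partial>lborel)
    = - (\<integral>x. (DIM('a) * m (norm x) + norm x * m' (norm x)) * v x \<partial>lborel)" by simp
qed

section \<open>Energy forms\<close>

text \<open>Nonnegativity at u - v. The factor 2 takes the place of the triangle inequality and
  accounts for the tolerances e / 4 below.\<close>

lemma (in closed_dense_form) form1_add_le:
  assumes "u \<in> F" "v \<in> F"
  shows "form1 E (u + v) (u + v) \<le> 2 * form1 E u u + 2 * form1 E v v"
proof -
  have "0 \<le> E (u - v) (u - v) + inner (u - v) (u - v)" using assms by simp
  then show ?thesis using assms
    by (simp add: form1_def bilin form_sym[of v u] inner_add_left inner_add_right inner_diff_left
        inner_diff_right inner_commute[of v u])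
qed

lemma (in closed_dense_form) form1_scale:
  "u \<in> F \<Longrightarrow> form1 E (c *\<^sub>R u) (c *\<^sub>R u) = c\<^sup>2 * form1 E u u"
  by (simp add: form1_def bilin power2_eq_square algebra_simps)

locale energy_form = dirichlet E F
  for \<alpha> :: "'a::euclidean_space \<Rightarrow> real" and E :: "'a L2 \<Rightarrow> 'a L2 \<Rightarrow> real" and F :: "'a L2 set" +
  assumes smallest: "smallest_closed_energy_extension \<alpha> E F"
    and weight_continuous: "continuous_on UNIV \<alpha>" and weight_nonneg: "\<And>x. 0 \<le> \<alpha> x"
begin

lemma extension: "closed_energy_extension \<alpha> E F"
  using smallest by (simp add: smallest_closed_energy_extension_def)

lemma smooth_mem: "\<phi> \<in> C_c_infinity \<Longrightarrow> to_L2 \<phi> \<in> F"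
  using extension by (simp add: closed_energy_extension_def)

lemma form_smooth: "\<phi> \<in> C_c_infinity \<Longrightarrow> \<psi> \<in> C_c_infinity \<Longrightarrow> E (to_L2 \<phi>) (to_L2 \<psi>) = energy \<alpha> \<phi> \<psi>"
  using extension by (simp add: closed_energy_extension_def)

text \<open>The vectors of \<open>F\<close> that test functions approximate in the form norm again
  carry a closed extension of the energy, so minimality forces them to exhaust
  \<open>F\<close>.\<close>

lemma core:
  assumes u: "u \<in> F" and e: "e > 0"
  shows "\<exists>\<phi>\<in>C_c_infinity. form1 E (to_L2 \<phi> - u) (to_L2 \<phi> - u) < e"
proof -
  define F' where "F' = {u\<in>F. \<forall>e>0. \<exists>\<phi>\<in>C_c_infinity. form1 E (to_L2 \<phi> - u) (to_L2 \<phi> - u) < e}"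
  have F': "u \<in> F" if "u \<in> F'" for u using that by (simp add: F'_def)
  have approx: "\<exists>\<phi>\<in>C_c_infinity. form1 E (to_L2 \<phi> - u) (to_L2 \<phi> - u) < e" if "u \<in> F'" "e > 0" for u e
    using that by (simp add: F'_def)
  have smooth': "to_L2 \<phi> \<in> F'" if "\<phi> \<in> C_c_infinity" for \<phi>
  proof -
    have "form1 E (to_L2 \<phi> - to_L2 \<phi>) (to_L2 \<phi> - to_L2 \<phi>) = 0"
      using scale_left[of 0 0 0] by (simp add: form1_def)
    then show ?thesis using that smooth_mem[OF that] unfolding F'_def by force
  qed
  have zero: "0 \<in> F'"
  proof -
    have "(\<lambda>x. 0 :: real) \<in> (C_c_infinity :: ('a \<Rightarrow> real) set)"
      by (auto simp: C_c_infinity_iff intro!: C_on_const)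
    moreover have "to_L2 (\<lambda>x. 0) = (0 :: 'a L2)" using to_L2_scale[of "\<lambda>x. 0" 0] by (simp add: L2_fun_zero)
    ultimately show ?thesis using smooth' by force
  qed
  have add: "u + v \<in> F'" if uv: "u \<in> F'" "v \<in> F'" for u v
    unfolding F'_def
  proof (intro CollectI conjI allI impI)
    show "u + v \<in> F" using that F' by simp
    fix e :: real assume e: "e > 0"
    obtain \<phi> \<psi> where *: "\<phi> \<in> C_c_infinity" "form1 E (to_L2 \<phi> - u) (to_L2 \<phi> - u) < e / 4"
      "\<psi> \<in> C_c_infinity" "form1 E (to_L2 \<psi> - v) (to_L2 \<psi> - v) < e / 4"
      using approx[OF uv(1), of "e / 4"] approx[OF uv(2), of "e / 4"] e by auto
    have eq: "to_L2 (\<lambda>x. \<phi> x + \<psi> x) - (u + v) = (to_L2 \<phi> - u) + (to_L2 \<psi> - v)"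
      using * by (simp add: to_L2_add[symmetric] C_c_infinity_L2)
    have "form1 E (to_L2 (\<lambda>x. \<phi> x + \<psi> x) - (u + v)) (to_L2 (\<lambda>x. \<phi> x + \<psi> x) - (u + v)) < e"
      unfolding eq using form1_add_le[of "to_L2 \<phi> - u" "to_L2 \<psi> - v"] * that F' smooth_mem by fastforce
    then show "\<exists>\<phi>\<in>C_c_infinity. form1 E (to_L2 \<phi> - (u + v)) (to_L2 \<phi> - (u + v)) < e"
      using C_c_infinity_add[OF *(1,3)] by (rule rev_bexI[rotated])
  qed
  have scale: "c *\<^sub>R u \<in> F'" if u': "u \<in> F'" for c u
    unfolding F'_def
  proof (intro CollectI conjI allI impI)
    show "c *\<^sub>R u \<in> F" using that F' by simp
    fix e :: real assume e: "e > 0"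
    obtain \<phi> where *: "\<phi> \<in> C_c_infinity" "form1 E (to_L2 \<phi> - u) (to_L2 \<phi> - u) < e / (c\<^sup>2 + 1)"
      using approx[OF u', of "e / (c\<^sup>2 + 1)"] e by (metis add_nonneg_pos divide_pos_pos zero_le_power2 zero_less_one)
    have m: "to_L2 \<phi> - u \<in> F" using * that F' smooth_mem by simp
    have eq: "to_L2 (\<lambda>x. c * \<phi> x) - c *\<^sub>R u = c *\<^sub>R (to_L2 \<phi> - u)"
      using * by (simp add: to_L2_scale[symmetric] C_c_infinity_L2 scaleR_diff_right)
    have "c\<^sup>2 * form1 E (to_L2 \<phi> - u) (to_L2 \<phi> - u) \<le> (c\<^sup>2 + 1) * form1 E (to_L2 \<phi> - u) (to_L2 \<phi> - u)"
      using m by (intro mult_right_mono) (auto simp: form1_def)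
    also have "\<dots> < e" using *(2) by (simp add: pos_less_divide_eq add_nonneg_pos mult.commute)
    finally have "form1 E (to_L2 (\<lambda>x. c * \<phi> x) - c *\<^sub>R u) (to_L2 (\<lambda>x. c * \<phi> x) - c *\<^sub>R u) < e"
      unfolding eq form1_scale[OF m] .
    then show "\<exists>\<phi>\<in>C_c_infinity. form1 E (to_L2 \<phi> - c *\<^sub>R u) (to_L2 \<phi> - c *\<^sub>R u) < e"
      using C_c_infinity_scale[OF *(1)] by (rule rev_bexI[rotated])
  qed
  have "closed_form E F'"
    unfolding closed_form_def
  proof (intro conjI allI impI)
    have "subspace F'" using zero add scale by (auto intro: subspaceI)
    then show "symmetric_form E F'"
      unfolding symmetric_form_def using F' by (auto simp: bilin intro: form_sym)
    fix x :: "nat \<Rightarrow> 'a L2"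
    assume x: "\<forall>n. x n \<in> F'"
      and cauchy: "\<forall>e>0. \<exists>N. \<forall>m\<ge>N. \<forall>n\<ge>N. form1 E (x m - x n) (x m - x n) < e"
    then obtain v where v: "v \<in> F" "(\<lambda>n. form1 E (x n - v) (x n - v)) \<longlonglongrightarrow> 0"
      using closed F' unfolding closed_form_def by blast
    have "v \<in> F'"
      unfolding F'_def
    proof (intro CollectI conjI allI impI v)
      fix e :: real assume e: "e > 0"
      have "\<forall>\<^sub>F n in sequentially. form1 E (x n - v) (x n - v) < e / 4"
        using e by (intro order_tendstoD(2)[OF v(2)]) simp
      then obtain n where n: "form1 E (x n - v) (x n - v) < e / 4"
        using eventually_happens'[OF trivial_limit_sequentially] by blast
      obtain \<phi> where \<phi>: "\<phi> \<in> C_c_infinity" "form1 E (to_L2 \<phi> - x n) (to_L2 \<phi> - x n) < e / 4"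
        using approx[of "x n" "e / 4"] x e by auto
      have "form1 E (to_L2 \<phi> - v) (to_L2 \<phi> - v) < e"
        using form1_add_le[of "to_L2 \<phi> - x n" "x n - v"] n \<phi> smooth_mem F' x v by fastforce
      then show "\<exists>\<phi>\<in>C_c_infinity. form1 E (to_L2 \<phi> - v) (to_L2 \<phi> - v) < e" using \<phi> by blast
    qed
    then show "\<exists>v\<in>F'. (\<lambda>n. form1 E (x n - v) (x n - v)) \<longlonglongrightarrow> 0" using v by blast
  qed
  then have "closed_energy_extension \<alpha> E F'"
    unfolding closed_energy_extension_def using smooth' form_smooth by blast
  then have "F \<subseteq> F'" using smallest unfolding smallest_closed_energy_extension_def by blast
  then show ?thesis using approx u e by blast
qed

lemma core_sequence:
  assumes u: "u \<in> F"
  obtains \<phi> where "\<And>n::nat. \<phi> n \<in> C_c_infinity" "(\<lambda>n. to_L2 (\<phi> n)) \<longlonglongrightarrow> u"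
    "(\<lambda>n. E (to_L2 (\<phi> n) - u) (to_L2 (\<phi> n) - u)) \<longlonglongrightarrow> 0"
    "(\<lambda>n. energy \<alpha> (\<phi> n) (\<phi> n)) \<longlonglongrightarrow> E u u"
proof -
  have "\<exists>\<phi>\<in>C_c_infinity. form1 E (to_L2 \<phi> - u) (to_L2 \<phi> - u) < 1 / real (Suc n)" for n
    by (rule core[OF u]) simp
  then obtain \<phi> where \<phi>: "\<And>n. \<phi> n \<in> C_c_infinity"
    "\<And>n. form1 E (to_L2 (\<phi> n) - u) (to_L2 (\<phi> n) - u) < 1 / real (Suc n)" by metis
  have mem: "to_L2 (\<phi> n) - u \<in> F" for n using \<phi> smooth_mem u by simp
  have "(\<lambda>n. form1 E (to_L2 (\<phi> n) - u) (to_L2 (\<phi> n) - u)) \<longlonglongrightarrow> 0"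
  proof (rule tendsto_sandwich[OF always_eventually always_eventually tendsto_const LIMSEQ_Suc[OF lim_1_over_n]], safe)
    fix n show "0 \<le> form1 E (to_L2 (\<phi> n) - u) (to_L2 (\<phi> n) - u)" using mem by (simp add: form1_def)
    show "form1 E (to_L2 (\<phi> n) - u) (to_L2 (\<phi> n) - u) \<le> 1 / real (Suc n)" using \<phi>(2) by (rule less_imp_le)
  qed
  then have 1: "(\<lambda>n. E (to_L2 (\<phi> n) - u) (to_L2 (\<phi> n) - u)) \<longlonglongrightarrow> 0" "(\<lambda>n. to_L2 (\<phi> n) - u) \<longlonglongrightarrow> 0"
    using form1_tendsto_0_iff[of "\<lambda>n. to_L2 (\<phi> n) - u", OF mem] by blast+
  have "(\<lambda>n. E (to_L2 (\<phi> n)) (to_L2 (\<phi> n))) \<longlonglongrightarrow> E u u"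
    using form_tendsto_self[OF u _ 1(1)] \<phi> smooth_mem by blast
  then have 2: "(\<lambda>n. energy \<alpha> (\<phi> n) (\<phi> n)) \<longlonglongrightarrow> E u u" by (simp add: form_smooth \<phi>)
  have "(\<lambda>n. to_L2 (\<phi> n)) \<longlonglongrightarrow> u" using 1(2) by (rule LIM_zero_cancel)
  then show ?thesis using that \<phi>(1) 1(1) 2 by blast
qed

text \<open>Testing with smooth functions suffices: both sides are continuous in the form norm, in
  which test functions are dense.\<close>

lemma form_generatorI:
  assumes \<phi>: "\<phi> \<in> C_c_infinity" and f: "f \<in> L2_fun"
    and eq: "\<And>v. v \<in> C_c_infinity \<Longrightarrow> energy \<alpha> \<phi> v = - (\<integral>x. f x * v x \<partial>lborel)"
  shows "(to_L2 \<phi>, to_L2 f) \<in> form_generator E F"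
  unfolding form_generator_def
proof (intro CollectI case_prodI conjI ballI)
  show m: "to_L2 \<phi> \<in> F" using smooth_mem[OF \<phi>] .
  fix v assume v: "v \<in> F"
  obtain \<psi> where \<psi>: "\<And>n::nat. \<psi> n \<in> C_c_infinity" "(\<lambda>n. to_L2 (\<psi> n)) \<longlonglongrightarrow> v"
    "(\<lambda>n. E (to_L2 (\<psi> n) - v) (to_L2 (\<psi> n) - v)) \<longlonglongrightarrow> 0"
    "(\<lambda>n. energy \<alpha> (\<psi> n) (\<psi> n)) \<longlonglongrightarrow> E v v"
    by (rule core_sequence[OF v]) (rule that)
  have "(\<lambda>n. E (to_L2 \<phi>) (to_L2 (\<psi> n) - v) + E (to_L2 \<phi>) v) \<longlonglongrightarrow> 0 + E (to_L2 \<phi>) v"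
    using \<psi> v smooth_mem by (intro tendsto_intros form_tendsto_0 m) auto
  moreover have "E (to_L2 \<phi>) (to_L2 (\<psi> n) - v) + E (to_L2 \<phi>) v = - inner (to_L2 f) (to_L2 (\<psi> n))" for n
    unfolding diff_right[OF smooth_mem[OF \<psi>(1)] v m] form_smooth[OF \<phi> \<psi>(1)] eq[OF \<psi>(1)]
      inner_to_L2[OF f C_c_infinity_L2[OF \<psi>(1)]] by simp
  moreover have "(\<lambda>n. - inner (to_L2 f) (to_L2 (\<psi> n))) \<longlonglongrightarrow> - inner (to_L2 f) v"
    by (intro tendsto_intros \<psi>)
  ultimately show "E (to_L2 \<phi>) v = - inner (to_L2 f) v" using LIMSEQ_unique by fastforce
qed

text \<open>A weak maximum principle. Testing with \<open>\<eta>(\<phi> - U)\<close> for smooth \<open>\<phi>\<close> close to the resolvent,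
  where \<open>0 \<le> \<eta>' \<le> 1\<close> and \<open>\<eta>\<close> vanishes exactly on the negative half line, avoids weak derivatives;
  positivity of \<open>U\<close> makes the test function compactly supported.\<close>

lemma resolvent_le_supersolution:
  assumes h: "h > 0" and f: "f \<in> between 0 1"
    and U: "\<And>k. C_on k UNIV U" "\<And>x. 0 < U x"
    and super: "\<And>w. w \<in> C_c_infinity \<Longrightarrow> (\<And>x. 0 \<le> w x) \<Longrightarrow>
      (\<integral>x. w x \<partial>lborel) \<le> h * (\<integral>x. \<alpha> x * inner (gradient U x) (gradient w x) \<partial>lborel) + (\<integral>x. U x * w x \<partial>lborel)"
  shows "AE x in lborel. rep_L2 (resolvent h f) x \<le> U x"
proof -
  define u where "u = resolvent h f"
  have u: "u \<in> F" unfolding u_def by (rule resolvent_mem[OF h])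
  \<comment> \<open>The derivative of \<open>bump 0\<close> is \<open>bump 2\<close>, which is at
    most 2; the factor 1/2 makes \<eta> Lipschitz with constant 1.\<close>
  define \<eta> where "\<eta> s = (1/2) * bump 0 s" for s
  define \<eta>' where "\<eta>' s = (1/2) * bump 2 s" for s
  have \<eta>_smooth: "C_on k UNIV \<eta>" for k
    unfolding \<eta>_def[abs_def] by (intro C_on_mult C_on_const C_on_bump) auto
  have \<eta>_deriv: "(\<eta> has_real_derivative \<eta>' s) (at s)" for s
    using DERIV_cmult[OF bump_has_derivative[of 0 s], of "1/2"] by (simp add: \<eta>_def[abs_def] \<eta>'_def numeral_2_eq_2)
  have \<eta>': "0 \<le> \<eta>' s" "\<eta>' s \<le> 1" for s
    using bump_nonneg[of 2 s] bump_le[of 2 s] by (auto simp: \<eta>'_def numeral_2_eq_2)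
  have \<eta>_nonneg: "0 \<le> \<eta> s" for s using bump_nonneg by (simp add: \<eta>_def)
  have \<eta>_sq: "(\<eta> s)\<^sup>2 \<le> s * \<eta> s" for s
  proof (cases "0 < s")
    case True
    have "inverse s * bump 0 s \<le> 1" using bump_le[of 1 s] True by (simp add: bump_def)
    then have "\<eta> s \<le> s" using True by (simp add: \<eta>_def field_simps)
    then show ?thesis using \<eta>_nonneg[of s] by (simp add: power2_eq_square mult_right_mono)
  qed (simp add: \<eta>_def bump_def)
  have \<eta>_lip: "\<bar>\<eta> s - \<eta> t\<bar> \<le> \<bar>s - t\<bar>" for s t
  proof -
    have "norm (\<eta> s - \<eta> t) \<le> 1 * norm (s - t)"
      by (rule field_differentiable_bound[of UNIV \<eta> \<eta>' 1]) (use \<eta>_deriv \<eta>' in auto)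
    then show ?thesis by simp
  qed
  obtain \<phi> where \<phi>: "\<And>n::nat. \<phi> n \<in> C_c_infinity" "(\<lambda>n. to_L2 (\<phi> n)) \<longlonglongrightarrow> u"
    "(\<lambda>n. E (to_L2 (\<phi> n) - u) (to_L2 (\<phi> n) - u)) \<longlonglongrightarrow> 0"
    "(\<lambda>n. energy \<alpha> (\<phi> n) (\<phi> n)) \<longlonglongrightarrow> E u u"
    by (rule core_sequence[OF u]) (rule that)
  define w where "w n x = \<eta> (\<phi> n x - U x)" for n x
  have w: "w n \<in> C_c_infinity" for n
  proof -
    obtain R where R: "\<And>x. R < norm x \<Longrightarrow> \<phi> n x = 0" using C_c_infinityD(2)[OF \<phi>(1)] by blast
    have "w n x = 0" if "R < norm x" for x
      using R[OF that] U(2)[of x] by (simp add: w_def \<eta>_def bump_def)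
    moreover have "C_on k UNIV (w n)" for k
      unfolding w_def[abs_def]
      by (rule C_on_compose[OF open_UNIV \<eta>_smooth C_on_diff[OF open_UNIV C_c_infinityD(1)[OF \<phi>(1)] U(1)]]) simp
    ultimately show ?thesis unfolding C_c_infinity_iff by blast
  qed
  have gw: "gradient (w n) x = \<eta>' (\<phi> n x - U x) *\<^sub>R (gradient (\<phi> n) x - gradient U x)" for n x
  proof (rule gradient_eqI)
    have "((\<lambda>x. \<phi> n x - U x) has_derivative (\<lambda>h. inner (gradient (\<phi> n) x) h - inner (gradient U x) h)) (at x)"
      by (intro has_derivative_diff C_c_infinityD(5)[OF \<phi>(1)] smoothD(3) U)
    from has_derivative_compose[OF this \<eta>_deriv[unfolded has_field_derivative_def]]
    show "(w n has_derivative (\<lambda>h. inner (\<eta>' (\<phi> n x - U x) *\<^sub>R (gradient (\<phi> n) x - gradient U x)) h)) (at x)"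
      by (simp add: w_def[abs_def] inner_diff_left)
  qed
  \<comment> \<open>The right side only measures how well \<phi> approximates u; with no
    approximation error it would say w = 0.\<close>
  have key: "(norm (to_L2 (w n)))\<^sup>2 \<le> h / 2 * E (to_L2 (\<phi> n) - u) (to_L2 (\<phi> n) - u) + (norm (to_L2 (\<phi> n) - u))\<^sup>2" for n
  proof -
    define p where "p = to_L2 (\<phi> n)"
    define q where "q = to_L2 (w n)"
    define I where "I = (\<integral>x. \<alpha> x * inner (gradient U x) (gradient (w n) x) \<partial>lborel)"
    define X where "X = (\<integral>x. w n x \<partial>lborel)"
    define Y where "Y = (\<integral>x. U x * w n x \<partial>lborel)"
    have p: "p \<in> F" and q: "q \<in> F" using \<phi> w smooth_mem by (auto simp: p_def q_def)
    obtain R where R: "\<And>x. R < norm x \<Longrightarrow> w n x = 0" using C_c_infinityD(2)[OF w] by blast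
    have gR: "\<And>x. R < norm x \<Longrightarrow> gradient (w n) x = 0" using R by (rule gradient_support)
    note cont = C_c_infinityD(3,6)[OF w] C_c_infinityD(3,6)[OF \<phi>(1)] smoothD(1,4)[OF U(1)] weight_continuous
    have int_I: "integrable lborel (\<lambda>x. \<alpha> x * inner (gradient U x) (gradient (w n) x))"
      by (rule integrable_compact_support[of _ R]) (use gR in \<open>auto intro!: continuous_intros cont\<close>)
    have int_X: "integrable lborel (w n)"
      by (rule integrable_compact_support[of _ R]) (use R in \<open>auto intro!: continuous_intros cont\<close>)
    have int_Y: "integrable lborel (\<lambda>x. U x * w n x)"
      by (rule integrable_compact_support[of _ R]) (use R in \<open>auto intro!: continuous_intros cont\<close>)
    have 1: "X \<le> h * I + Y" unfolding X_def I_def Y_def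
      by (rule super[OF w]) (simp add: w_def \<eta>_nonneg)
    \<comment> \<open>As \<eta>' lies between 0 and 1, its square is at most \<eta>', so the squared
      gradient of w is bounded by its pairing with the gradient of \<phi> - U.\<close>
    have 2: "E q q + I \<le> E p q"
    proof -
      have "E q q + I = (\<integral>x. \<alpha> x * inner (gradient (w n) x) (gradient (w n) x) + \<alpha> x * inner (gradient U x) (gradient (w n) x) \<partial>lborel)"
        unfolding q_def form_smooth[OF w w] energy_def I_def
        using energy_integrable[OF w w weight_continuous] int_I by simp
      also have "\<dots> \<le> (\<integral>x. \<alpha> x * inner (gradient (\<phi> n) x) (gradient (w n) x) \<partial>lborel)"
      proof (rule integral_mono)
        show "integrable lborel (\<lambda>x. \<alpha> x * inner (gradient (w n) x) (gradient (w n) x) + \<alpha> x * inner (gradient U x) (gradient (w n) x))"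
          using energy_integrable[OF w w weight_continuous] int_I by simp
        show "integrable lborel (\<lambda>x. \<alpha> x * inner (gradient (\<phi> n) x) (gradient (w n) x))"
          by (rule energy_integrable[OF \<phi>(1) w weight_continuous])
        fix x
        let ?d = "gradient (\<phi> n) x - gradient U x" and ?e = "\<eta>' (\<phi> n x - U x)"
        have "inner (gradient (w n) x) (gradient (w n) x) = ?e * (?e * inner ?d ?d)"
          unfolding gw by (simp only: inner_scaleR_left inner_scaleR_right)
        also have "\<dots> \<le> ?e * (1 * inner ?d ?d)"
          by (intro mult_left_mono mult_right_mono \<eta>') auto
        also have "\<dots> = inner ?d (gradient (w n) x)" unfolding gw by (simp only: inner_scaleR_right mult_1)
        finally have "inner (gradient (w n) x) (gradient (w n) x) + inner (gradient U x) (gradient (w n) x)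
          \<le> inner (gradient (\<phi> n) x) (gradient (w n) x)" by (simp add: inner_diff_left)
        from mult_left_mono[OF this weight_nonneg[of x]]
        show "\<alpha> x * inner (gradient (w n) x) (gradient (w n) x) + \<alpha> x * inner (gradient U x) (gradient (w n) x)
          \<le> \<alpha> x * inner (gradient (\<phi> n) x) (gradient (w n) x)" by (simp add: distrib_left)
      qed
      also have "\<dots> = E p q" by (simp add: p_def q_def form_smooth[OF \<phi>(1) w] energy_def)
      finally show ?thesis .
    qed
    have 3: "(norm q)\<^sup>2 + Y \<le> inner p q"
    proof -
      have int_q: "integrable lborel (\<lambda>x. (w n x)\<^sup>2)" using C_c_infinity_L2[OF w] by (simp add: L2_fun_def)
      have "(norm q)\<^sup>2 + Y = (\<integral>x. (w n x)\<^sup>2 + U x * w n x \<partial>lborel)"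
        unfolding q_def norm_to_L2[OF C_c_infinity_L2[OF w]] Y_def using int_q int_Y by simp
      also have "\<dots> \<le> (\<integral>x. \<phi> n x * w n x \<partial>lborel)"
      proof (rule integral_mono)
        show "integrable lborel (\<lambda>x. (w n x)\<^sup>2 + U x * w n x)" using int_q int_Y by simp
        show "integrable lborel (\<lambda>x. \<phi> n x * w n x)"
          by (intro L2_fun_mult_integrable C_c_infinity_L2 w \<phi>)
        show "(w n x)\<^sup>2 + U x * w n x \<le> \<phi> n x * w n x" for x
          using \<eta>_sq[of "\<phi> n x - U x"] by (simp add: w_def algebra_simps)
      qed
      also have "\<dots> = inner p q"
        unfolding p_def q_def by (rule inner_to_L2[symmetric]) (intro C_c_infinity_L2 w \<phi>)+
      finally show ?thesis .
    qed
    have 4: "h * E u q + inner u q = inner f q"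
      using resolvent_gen[OF h, of f] q h by (simp add: u_def gen_def inner_diff_left field_simps)
    have 5: "inner f q \<le> X"
    proof -
      have "inner f q = (\<integral>x. rep_L2 f x * w n x \<partial>lborel)"
        unfolding q_def using inner_to_L2[OF rep_L2 C_c_infinity_L2[OF w], of f] by (simp add: to_L2_rep)
      also have "\<dots> \<le> X"
        unfolding X_def
      proof (rule integral_mono_AE)
        show "integrable lborel (\<lambda>x. rep_L2 f x * w n x)"
          by (intro L2_fun_mult_integrable rep_L2 C_c_infinity_L2 w)
        show "AE x in lborel. rep_L2 f x * w n x \<le> w n x"
          using f unfolding between_def mem_Collect_eq
        proof eventually_elim
          case (elim x)
          then show ?case using mult_right_mono[of "rep_L2 f x" 1 "w n x"] \<eta>_nonneg by (simp add: w_def)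
        qed
      qed (rule int_X)
      finally show ?thesis .
    qed
    \<comment> \<open>The weights are chosen so that this \<open>E q q\<close> cancels exactly
      against the one gained in fact 2. In fact 7 only half of the squared norm of q is spent, and
      the other half remains as the conclusion.\<close>
    have 6: "E (p - u) q \<le> E (p - u) (p - u) / 4 + E q q"
    proof -
      have "0 \<le> E ((1/2) *\<^sub>R (p - u) - q) ((1/2) *\<^sub>R (p - u) - q)" using p q u by simp
      also have "\<dots> = E (p - u) (p - u) / 4 - E (p - u) q + E q q"
        using p q u by (simp add: diff_left[of "(1/2) *\<^sub>R (p - u)" q] diff_right[of "(1/2) *\<^sub>R (p - u)" q]
            scale_left scale_right form_sym[of q "p - u"]) (simp add: field_simps)
      finally show ?thesis by simp
    qed
    have 7: "inner (p - u) q \<le> (norm (p - u))\<^sup>2 / 2 + (norm q)\<^sup>2 / 2"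
    proof -
      have "0 \<le> (norm ((p - u) - q))\<^sup>2" by simp
      also have "\<dots> = (norm (p - u))\<^sup>2 - 2 * inner (p - u) q + (norm q)\<^sup>2"
        unfolding power2_norm_eq_inner using inner_commute[of q "p - u"]
        by (simp only: inner_diff_left[of "p - u" q] inner_diff_right[of _ "p - u" q])
      finally show ?thesis by simp
    qed
    have "h * (E q q + I) + ((norm q)\<^sup>2 + Y) \<le> h * E p q + inner p q"
      using 3 mult_left_mono[OF 2 less_imp_le[OF h]] by linarith
    also have "\<dots> = (h * E u q + inner u q) + (h * E (p - u) q + inner (p - u) q)"
      using p q u by (simp add: bilin inner_diff_left algebra_simps)
    also have "\<dots> \<le> X + (h * (E (p - u) (p - u) / 4 + E q q) + ((norm (p - u))\<^sup>2 / 2 + (norm q)\<^sup>2 / 2))"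
      using 4 5 7 mult_left_mono[OF 6 less_imp_le[OF h]] by linarith
    finally have "(norm q)\<^sup>2 / 2 \<le> h * E (p - u) (p - u) / 4 + (norm (p - u))\<^sup>2 / 2"
      using 1 by (simp add: distrib_left)
    then show ?thesis by (simp add: p_def q_def)
  qed
  \<comment> \<open>The limit of the test functions, as \<eta> is Lipschitz. Since \<eta> is
    positive on the positive half line, z = 0 is the claim.\<close>
  define z where "z x = \<eta> (rep_L2 u x - U x)" for x
  have Um [measurable]: "U \<in> borel_measurable borel" by (rule smoothD(2)[OF U(1)])
  have \<eta>m [measurable]: "\<eta> \<in> borel_measurable borel"
    using \<eta>_smooth[of 0] by (auto intro: borel_measurable_continuous_onI)
  have zm [measurable]: "z \<in> borel_measurable borel" unfolding z_def by measurable
  have near: "\<bar>z x - w n x\<bar> \<le> \<bar>rep_L2 u x - \<phi> n x\<bar>" for n x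
    using \<eta>_lip[of "rep_L2 u x - U x" "\<phi> n x - U x"] by (simp add: z_def w_def)
  have d: "(\<lambda>x. z x - w n x) \<in> L2_fun" for n
    by (rule L2_fun_bound[OF L2_fun_diff[OF rep_L2 C_c_infinity_L2[OF \<phi>(1)]]])
      (use C_c_infinityD(4)[OF w] near in auto)
  have z: "z \<in> L2_fun" using L2_fun_add[OF d[of 0] C_c_infinity_L2[OF w[of 0]]] by simp
  have zw: "norm (to_L2 z) \<le> norm (to_L2 (\<phi> n) - u) + norm (to_L2 (w n))" for n
  proof -
    have "norm (to_L2 z - to_L2 (w n)) \<le> norm (to_L2 (\<lambda>x. rep_L2 u x - \<phi> n x))"
      unfolding to_L2_diff[OF z C_c_infinity_L2[OF w]]
      by (intro norm_to_L2_mono d L2_fun_diff rep_L2 C_c_infinity_L2 \<phi> AE_I2 near)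
    also have "to_L2 (\<lambda>x. rep_L2 u x - \<phi> n x) = u - to_L2 (\<phi> n)"
      by (simp add: to_L2_diff[symmetric] rep_L2 C_c_infinity_L2 \<phi> to_L2_rep)
    finally show ?thesis
      using norm_triangle_ineq[of "to_L2 z - to_L2 (w n)" "to_L2 (w n)"] by (simp add: norm_minus_commute)
  qed
  have "(\<lambda>n. norm (to_L2 (\<phi> n) - u) + sqrt (h / 2 * E (to_L2 (\<phi> n) - u) (to_L2 (\<phi> n) - u) + (norm (to_L2 (\<phi> n) - u))\<^sup>2))
     \<longlonglongrightarrow> 0 + sqrt (h / 2 * 0 + 0\<^sup>2)"
    using \<phi> by (intro tendsto_intros) (auto simp: tendsto_norm_zero_iff LIM_zero_iff)
  moreover have "norm (to_L2 z) \<le> norm (to_L2 (\<phi> n) - u)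
     + sqrt (h / 2 * E (to_L2 (\<phi> n) - u) (to_L2 (\<phi> n) - u) + (norm (to_L2 (\<phi> n) - u))\<^sup>2)" for n
    using zw[of n] real_le_rsqrt[OF key[of n]] by linarith
  ultimately have "norm (to_L2 z) \<le> 0 + sqrt (h / 2 * 0 + 0\<^sup>2)" using LIMSEQ_le_const by blast
  then have "to_L2 z = 0" by simp
  from to_L2_eq_0D[OF z this] show ?thesis
    unfolding u_def[symmetric]
  proof eventually_elim
    case (elim x)
    then show ?case using bump_pos[of "rep_L2 u x - U x" 0] by (force simp: z_def \<eta>_def)
  qed
qed

end

subsection \<open>Comparison of energy forms\<close>

lemma tendsto_imp_weakly_converges: "un \<longlonglongrightarrow> u \<Longrightarrow> weakly_converges un u"
  unfolding weakly_converges_def by (auto intro: tendsto_intros)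

text \<open>Bounded energies also put the limit into \<open>F\<close>; domain inclusions between
  different forms are proved in this way.\<close>

lemma (in closed_dense_form) strong_lsc:
  assumes "un \<longlonglongrightarrow> u" "\<And>n. un n \<in> F" "\<And>n. E (un n) (un n) \<le> c n" "c \<longlonglongrightarrow> C"
  shows "u \<in> F" "E u u \<le> C"
proof -
  have "extended_form E F u \<le> liminf (\<lambda>n. extended_form E F (un n))"
    by (rule weak_lsc[OF tendsto_imp_weakly_converges[OF assms(1)]])
  also have "\<dots> \<le> liminf (\<lambda>n. ereal (c n))"
    by (intro Liminf_mono always_eventually) (simp add: extended_form_def assms)
  also have "\<dots> = ereal C"
    by (rule lim_imp_Liminf) (use assms(4) in auto)
  finally show "u \<in> F" "E u u \<le> C" by (auto simp: extended_form_def split: if_splits)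
qed

lemma energy_mono:
  assumes \<phi>: "\<phi> \<in> C_c_infinity" and "continuous_on UNIV \<alpha>" "continuous_on UNIV \<beta>"
    and le: "\<And>x. \<alpha> x \<le> c * \<beta> x"
  shows "energy \<alpha> \<phi> \<phi> \<le> c * energy \<beta> \<phi> \<phi>"
proof -
  have "energy \<alpha> \<phi> \<phi> \<le> (\<integral>x. c * (\<beta> x * inner (gradient \<phi> x) (gradient \<phi> x)) \<partial>lborel)"
    unfolding energy_def
  proof (rule integral_mono)
    show "\<alpha> x * inner (gradient \<phi> x) (gradient \<phi> x) \<le> c * (\<beta> x * inner (gradient \<phi> x) (gradient \<phi> x))" for x
      using mult_right_mono[OF le inner_ge_zero] by (simp add: mult.assoc)
  qed (use energy_integrable[OF \<phi> \<phi>] assms in auto)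
  then show ?thesis by (simp add: energy_def)
qed

text \<open>On test functions the comparison is pointwise. A vector of \<open>F'\<close> is
  approximated in the core of \<open>E'\<close>, and lower semicontinuity of \<open>E\<close>
  transfers both membership and bound.\<close>

lemma energy_form_mono:
  assumes "energy_form \<alpha> E F" "energy_form \<beta> E' F'" and le: "\<And>x. \<alpha> x \<le> c * \<beta> x" and v: "v \<in> F'"
  shows "v \<in> F" "E v v \<le> c * E' v v"
proof -
  interpret A: energy_form \<alpha> E F by fact
  interpret B: energy_form \<beta> E' F' by fact
  obtain \<phi> where \<phi>: "\<And>n::nat. \<phi> n \<in> C_c_infinity" "(\<lambda>n. to_L2 (\<phi> n)) \<longlonglongrightarrow> v"
    "(\<lambda>n. E' (to_L2 (\<phi> n) - v) (to_L2 (\<phi> n) - v)) \<longlonglongrightarrow> 0"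
    "(\<lambda>n. energy \<beta> (\<phi> n) (\<phi> n)) \<longlonglongrightarrow> E' v v"
    by (rule B.core_sequence[OF v]) (rule that)
  have b: "E (to_L2 (\<phi> n)) (to_L2 (\<phi> n)) \<le> c * energy \<beta> (\<phi> n) (\<phi> n)" for n
    unfolding A.form_smooth[OF \<phi>(1) \<phi>(1)]
    by (rule energy_mono[OF \<phi>(1) A.weight_continuous B.weight_continuous le])
  have "(\<lambda>n. c * energy \<beta> (\<phi> n) (\<phi> n)) \<longlonglongrightarrow> c * E' v v" by (intro tendsto_intros \<phi>)
  from A.strong_lsc[OF \<phi>(2) A.smooth_mem[OF \<phi>(1)] b this]
  show "v \<in> F" "E v v \<le> c * E' v v" .
qed

lemma bounded_mult_L2:
  assumes "f \<in> L2_fun" "\<kappa> \<in> borel_measurable borel" "\<And>x. \<bar>\<kappa> x\<bar> \<le> 1"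
  shows "(\<lambda>x. f x * \<kappa> x) \<in> L2_fun"
  by (rule L2_fun_bound[OF assms(1)])
    (use assms in \<open>auto simp: abs_mult intro!: AE_I2 mult_right_le_one_le\<close>)

definition mult_L2 :: "('a::euclidean_space \<Rightarrow> real) \<Rightarrow> 'a L2 \<Rightarrow> 'a L2" where
  "mult_L2 \<kappa> u = to_L2 (\<lambda>x. rep_L2 u x * \<kappa> x)"

text \<open>Young's inequality for the product rule. The main term must keep a factor arbitrarily
  close to 1, as the Mosco lower bound allows no loss; the price \<open>1 + 1/t\<close> falls on the
  small gradient of \<kappa>.\<close>

lemma energy_cutoff_le:
  assumes \<phi>: "\<phi> \<in> C_c_infinity" and \<kappa>: "\<kappa> \<in> C_c_infinity" "\<And>x. 0 \<le> \<kappa> x \<and> \<kappa> x \<le> 1"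
    and cont: "continuous_on UNIV \<alpha>" "continuous_on UNIV \<beta>" and nonneg: "\<And>x. 0 \<le> \<alpha> x" "\<And>x. 0 \<le> \<beta> x"
    and K: "\<And>x. \<kappa> x \<noteq> 0 \<Longrightarrow> \<alpha> x \<le> K * \<beta> x" "0 \<le> K"
    and e: "\<And>x. \<alpha> x * inner (gradient \<kappa> x) (gradient \<kappa> x) \<le> e" and t: "t > 0"
  shows "energy \<alpha> (\<lambda>x. \<phi> x * \<kappa> x) (\<lambda>x. \<phi> x * \<kappa> x)
    \<le> (1 + t) * K * energy \<beta> \<phi> \<phi> + (1 + 1/t) * e * (norm (to_L2 \<phi>))\<^sup>2"
proof -
  have p: "(\<lambda>x. \<phi> x * \<kappa> x) \<in> C_c_infinity" by (rule C_c_infinity_mult[OF \<phi> C_c_infinityD(1)[OF \<kappa>(1)]])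
  have g: "gradient (\<lambda>x. \<phi> x * \<kappa> x) x = \<kappa> x *\<^sub>R gradient \<phi> x + \<phi> x *\<^sub>R gradient \<kappa> x" for x
    by (rule gradient_eqI, rule has_derivative_eq_rhs[OF has_derivative_mult[OF C_c_infinityD(5)[OF \<phi>] C_c_infinityD(5)[OF \<kappa>(1)]]])
      (auto simp: fun_eq_iff inner_add_left)
  have int: "integrable lborel (\<lambda>x. \<beta> x * inner (gradient \<phi> x) (gradient \<phi> x))" "integrable lborel (\<lambda>x. (\<phi> x)\<^sup>2)"
    using energy_integrable[OF \<phi> \<phi> cont(2)] C_c_infinity_L2[OF \<phi>] by (auto simp: L2_fun_def)
  have "energy \<alpha> (\<lambda>x. \<phi> x * \<kappa> x) (\<lambda>x. \<phi> x * \<kappa> x)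
    \<le> (\<integral>x. (1 + t) * K * (\<beta> x * inner (gradient \<phi> x) (gradient \<phi> x)) + (1 + 1/t) * e * (\<phi> x)\<^sup>2 \<partial>lborel)"
    unfolding energy_def
  proof (rule integral_mono)
    fix x
    let ?a = "\<kappa> x *\<^sub>R gradient \<phi> x" and ?b = "\<phi> x *\<^sub>R gradient \<kappa> x"
    have "0 \<le> (norm (sqrt t *\<^sub>R ?a - (1 / sqrt t) *\<^sub>R ?b))\<^sup>2" by simp
    also have "\<dots> = t * inner ?a ?a - 2 * inner ?a ?b + (1/t) * inner ?b ?b"
    proof -
      have "(norm (c *\<^sub>R y - d *\<^sub>R z))\<^sup>2 = c\<^sup>2 * inner y y - 2 * (c * d) * inner y z + d\<^sup>2 * inner z z" for c d and y z :: 'a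
        unfolding power2_norm_eq_inner
        by (simp add: inner_diff_left inner_diff_right inner_commute[of z y] power2_eq_square algebra_simps)
      from this[of "sqrt t" ?a "1 / sqrt t" ?b] show ?thesis using t by (simp add: power_divide)
    qed
    finally have "inner (?a + ?b) (?a + ?b) \<le> (1 + t) * inner ?a ?a + (1 + 1/t) * inner ?b ?b"
      by (simp add: inner_add_left inner_add_right inner_commute[of "gradient \<kappa> x"] algebra_simps del: inner_scaleR_left inner_scaleR_right)
        (simp add: inner_commute[of "gradient \<kappa> x" "gradient \<phi> x"] algebra_simps)
    from mult_left_mono[OF this nonneg(1)[of x]]
    have "\<alpha> x * inner (?a + ?b) (?a + ?b) \<le> (1 + t) * (\<alpha> x * inner ?a ?a) + (1 + 1/t) * (\<alpha> x * inner ?b ?b)"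
      by (simp add: algebra_simps)
    also have "\<dots> \<le> (1 + t) * (K * (\<beta> x * inner (gradient \<phi> x) (gradient \<phi> x))) + (1 + 1/t) * (e * (\<phi> x)\<^sup>2)"
    proof (intro add_mono mult_left_mono)
      show "\<alpha> x * inner ?a ?a \<le> K * (\<beta> x * inner (gradient \<phi> x) (gradient \<phi> x))"
      proof (cases "\<kappa> x = 0")
        case True
        then show ?thesis using K(2) nonneg(2)[of x] by simp
      next
        case False
        have "\<alpha> x * inner ?a ?a = (\<kappa> x)\<^sup>2 * (\<alpha> x * inner (gradient \<phi> x) (gradient \<phi> x))"
          by (simp add: power2_eq_square)
        also have "\<dots> \<le> 1 * ((K * \<beta> x) * inner (gradient \<phi> x) (gradient \<phi> x))"
          using \<kappa>(2)[of x] nonneg[of x] K(1)[OF False]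
          by (intro mult_mono mult_right_mono) (auto simp: power_le_one)
        finally show ?thesis by simp
      qed
      have "\<alpha> x * inner ?b ?b = (\<phi> x)\<^sup>2 * (\<alpha> x * inner (gradient \<kappa> x) (gradient \<kappa> x))"
        by (simp add: power2_eq_square)
      also have "\<dots> \<le> (\<phi> x)\<^sup>2 * e" by (intro mult_left_mono e) simp
      finally show "\<alpha> x * inner ?b ?b \<le> e * (\<phi> x)\<^sup>2" by (simp add: mult.commute)
    qed (use t in auto)
    finally show "\<alpha> x * inner (gradient (\<lambda>x. \<phi> x * \<kappa> x) x) (gradient (\<lambda>x. \<phi> x * \<kappa> x) x)
      \<le> (1 + t) * K * (\<beta> x * inner (gradient \<phi> x) (gradient \<phi> x)) + (1 + 1/t) * e * (\<phi> x)\<^sup>2"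
      unfolding g by (simp only: mult.assoc)
  qed (use energy_integrable[OF p p cont(1)] int in auto)
  also have "\<dots> = (1 + t) * K * energy \<beta> \<phi> \<phi> + (1 + 1/t) * e * (norm (to_L2 \<phi>))\<^sup>2"
    unfolding energy_def norm_to_L2[OF C_c_infinity_L2[OF \<phi>]] using int by simp
  finally show ?thesis .
qed

text \<open>Cutting off carries the domain for \<beta> into the domain for \<alpha>: the weights are
  compared on the support of \<kappa> only, where K can be close to 1 although \<alpha> / \<beta>
  may be unbounded globally.\<close>

lemma mult_L2_form_le:
  assumes "energy_form \<alpha> E F" "energy_form \<beta> E' F'"
    and \<kappa>: "\<kappa> \<in> C_c_infinity" "\<And>x. 0 \<le> \<kappa> x \<and> \<kappa> x \<le> 1"
    and K: "\<And>x. \<kappa> x \<noteq> 0 \<Longrightarrow> \<alpha> x \<le> K * \<beta> x" "0 \<le> K"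
    and e: "\<And>x. \<alpha> x * inner (gradient \<kappa> x) (gradient \<kappa> x) \<le> e" and t: "t > 0" and u: "u \<in> F'"
  shows "mult_L2 \<kappa> u \<in> F"
    "E (mult_L2 \<kappa> u) (mult_L2 \<kappa> u) \<le> (1 + t) * K * E' u u + (1 + 1/t) * e * (norm u)\<^sup>2"
proof -
  interpret A: energy_form \<alpha> E F by fact
  interpret B: energy_form \<beta> E' F' by fact
  obtain \<phi> where \<phi>: "\<And>n::nat. \<phi> n \<in> C_c_infinity" "(\<lambda>n. to_L2 (\<phi> n)) \<longlonglongrightarrow> u"
    "(\<lambda>n. E' (to_L2 (\<phi> n) - u) (to_L2 (\<phi> n) - u)) \<longlonglongrightarrow> 0"
    "(\<lambda>n. energy \<beta> (\<phi> n) (\<phi> n)) \<longlonglongrightarrow> E' u u"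
    by (rule B.core_sequence[OF u]) (rule that)
  define \<psi> where "\<psi> n x = \<phi> n x * \<kappa> x" for n x
  have \<psi>: "\<psi> n \<in> C_c_infinity" for n
    unfolding \<psi>_def[abs_def] by (rule C_c_infinity_mult[OF \<phi>(1) C_c_infinityD(1)[OF \<kappa>(1)]])
  have \<kappa>1: "\<bar>\<kappa> x\<bar> \<le> 1" for x using \<kappa>(2)[of x] by auto
  have ux: "(\<lambda>x. rep_L2 u x * \<kappa> x) \<in> L2_fun"
    by (rule bounded_mult_L2[OF rep_L2 C_c_infinityD(4)[OF \<kappa>(1)] \<kappa>1])
  have "norm (to_L2 (\<psi> n) - mult_L2 \<kappa> u) \<le> norm (to_L2 (\<phi> n) - u)" for n
  proof -
    have "to_L2 (\<phi> n) - u = to_L2 (\<lambda>x. \<phi> n x - rep_L2 u x)"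
      by (simp add: to_L2_diff[symmetric] rep_L2 C_c_infinity_L2 \<phi> to_L2_rep)
    moreover have "norm (to_L2 (\<psi> n) - mult_L2 \<kappa> u) \<le> norm (to_L2 (\<lambda>x. \<phi> n x - rep_L2 u x))"
      unfolding mult_L2_def to_L2_diff[OF C_c_infinity_L2[OF \<psi>] ux]
    proof (rule norm_to_L2_mono[OF L2_fun_diff[OF C_c_infinity_L2[OF \<psi>] ux]
          L2_fun_diff[OF C_c_infinity_L2[OF \<phi>(1)] rep_L2] AE_I2])
      fix x
      have "\<psi> n x - rep_L2 u x * \<kappa> x = (\<phi> n x - rep_L2 u x) * \<kappa> x" by (simp add: \<psi>_def algebra_simps)
      then show "\<bar>\<psi> n x - rep_L2 u x * \<kappa> x\<bar> \<le> \<bar>\<phi> n x - rep_L2 u x\<bar>"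
        using \<kappa>1[of x] by (simp add: abs_mult mult_right_le_one_le)
    qed
    ultimately show ?thesis by simp
  qed
  then have "\<forall>\<^sub>F n in sequentially. norm (to_L2 (\<psi> n) - mult_L2 \<kappa> u) \<le> norm (to_L2 (\<phi> n) - u)"
    by (rule always_eventually[OF allI])
  from LIM_zero_cancel[OF Lim_null_comparison[OF this tendsto_norm_zero[OF LIM_zero[OF \<phi>(2)]]]]
  have lim: "(\<lambda>n. to_L2 (\<psi> n)) \<longlonglongrightarrow> mult_L2 \<kappa> u" .
  have bound: "E (to_L2 (\<psi> n)) (to_L2 (\<psi> n)) \<le> (1 + t) * K * energy \<beta> (\<phi> n) (\<phi> n) + (1 + 1/t) * e * (norm (to_L2 (\<phi> n)))\<^sup>2" for n
    unfolding A.form_smooth[OF \<psi> \<psi>] unfolding \<psi>_def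
    by (rule energy_cutoff_le[OF \<phi>(1) \<kappa> A.weight_continuous B.weight_continuous A.weight_nonneg B.weight_nonneg K e t])
  have "(\<lambda>n. (1 + t) * K * energy \<beta> (\<phi> n) (\<phi> n) + (1 + 1/t) * e * (norm (to_L2 (\<phi> n)))\<^sup>2)
    \<longlonglongrightarrow> (1 + t) * K * E' u u + (1 + 1/t) * e * (norm u)\<^sup>2"
    by (intro tendsto_intros \<phi>)
  from A.strong_lsc[OF lim A.smooth_mem[OF \<psi>] bound this]
  show "mult_L2 \<kappa> u \<in> F"
    "E (mult_L2 \<kappa> u) (mult_L2 \<kappa> u) \<le> (1 + t) * K * E' u u + (1 + 1/t) * e * (norm u)\<^sup>2" .
qed

section \<open>Radial weights\<close>

lemma C_on_inner_self: "C_on k UNIV (\<lambda>x::'a::euclidean_space. inner x x)"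
proof -
  have "C_on k UNIV (\<lambda>x::'a. \<Sum>b\<in>Basis. inner x b * inner x b)"
    by (intro C_on_sum C_on_mult C_on_linear bounded_linear_inner_left open_UNIV)
  then show ?thesis by (simp add: euclidean_inner[symmetric])
qed

text \<open>Radial functions are written in terms of |x|^2, so that smoothness in one variable
  suffices also at the origin.\<close>

lemma gradient_radial:
  fixes x :: "'a::euclidean_space"
  assumes "(g has_real_derivative d) (at (inner x x))"
  shows "gradient (\<lambda>x. g (inner x x)) x = (2 * d) *\<^sub>R x"
proof (rule gradient_eqI)
  have "((\<lambda>x::'a. inner x x) has_derivative (\<lambda>h. inner x h + inner h x)) (at x)"
    by (rule has_derivative_inner[OF has_derivative_ident has_derivative_ident])
  from has_derivative_compose[OF this assms[unfolded has_field_derivative_def]]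
  show "((\<lambda>x. g (inner x x)) has_derivative (\<lambda>h. inner ((2 * d) *\<^sub>R x) h)) (at x)"
    by (rule has_derivative_eq_rhs) (simp add: fun_eq_iff inner_commute)
qed

lemma ln_4_plus_ge_1: "0 \<le> s \<Longrightarrow> 1 \<le> ln (4 + s :: real)"
  using exp_le by (subst ln_ge_iff) auto

lemma ln_4_plus_pos: "-1 < s \<Longrightarrow> 0 < ln (4 + s :: real)"
  by (rule ln_gt_zero) simp

text \<open>The open half line contains all values of |x|^2 and keeps 4 + s above 1, so that the
  second logarithm is smooth on it too.\<close>

lemma C_on_ln_4_plus: "C_on k {-1<..} (\<lambda>s::real. ln (4 + s))"
  by (intro C_on_compose[OF _ C_on_ln] C_on_add C_on_const C_on_linear bounded_linear_ident open_greaterThan) auto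

lemma C_on_lnln_4_plus: "C_on k {-1<..} (\<lambda>s::real. ln (ln (4 + s)))"
  by (rule C_on_compose[OF open_greaterThan C_on_ln C_on_ln_4_plus]) (simp add: ln_4_plus_pos)

text \<open>The critical growth r^2 ln r, regularised near 0. Its reciprocal is the derivative of ln
  ln (4 + s) at s = r^2, which ties the cut-offs to the critical weight.\<close>

definition log_scale :: "real \<Rightarrow> real" where
  "log_scale r = (4 + r\<^sup>2) * ln (4 + r\<^sup>2)"

lemma log_scale_ge: "4 + r\<^sup>2 \<le> log_scale r"
  using mult_left_mono[OF ln_4_plus_ge_1[of "r\<^sup>2"], of "4 + r\<^sup>2"] by (simp add: log_scale_def)

lemma log_scale_pos: "0 < log_scale r"
  using log_scale_ge[of r] by (smt (verit) zero_le_power2)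

lemma log_scale_has_derivative:
  "(log_scale has_real_derivative 2 * r * ln (4 + r\<^sup>2) + 2 * r) (at r)"
proof -
  have pos: "0 < 4 + r\<^sup>2" by (smt (verit) zero_le_power2)
  then have "((\<lambda>r. ln (4 + r\<^sup>2)) has_real_derivative 2 * r / (4 + r\<^sup>2)) (at r)"
    by (auto intro!: derivative_eq_intros)
  moreover have "((\<lambda>r. 4 + r\<^sup>2) has_real_derivative 2 * r) (at r)" by (auto intro!: derivative_eq_intros)
  ultimately show ?thesis unfolding log_scale_def[abs_def]
    by (intro DERIV_cong[OF DERIV_mult]) (use pos in auto)
qed

lemma lnln_has_derivative:
  "((\<lambda>s. ln (ln (4 + s))) has_real_derivative inverse (log_scale r)) (at (r\<^sup>2))"
proof -
  have "0 < ln (4 + r\<^sup>2)" "0 < 4 + r\<^sup>2" using ln_4_plus_ge_1[of "r\<^sup>2"] by (auto intro: add_pos_nonneg)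
  then show ?thesis
    by (auto intro!: derivative_eq_intros simp: log_scale_def field_simps)
qed

lemma less_ln_if_exp_less: "exp c < x \<Longrightarrow> c < ln (x::real)"
  by (metis exp_gt_zero less_trans ln_exp ln_less_cancel_iff)

lemma two_plus_le: "0 \<le> r \<Longrightarrow> (2 + r)\<^sup>2 \<le> 2 * (4 + r\<^sup>2 :: real)"
  using zero_le_power2[of "r - 2"] by (simp add: power2_eq_square algebra_simps)

lemma ln_two_plus_le:
  assumes "0 \<le> (r::real)" shows "ln (2 + r) \<le> ln (4 + r\<^sup>2)"
proof -
  have "0 \<le> (r - 1/2)\<^sup>2" by simp
  then have "2 + r \<le> 4 + r\<^sup>2" by (simp add: power2_eq_square algebra_simps)
  then show ?thesis using assms by simp
qed

text \<open>\<open>ln ln\<close> is the right scale for cut-offs: its gradient is of order \<open>1 / (r ln r)\<close>, the inverse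
  of the largest square root of a weight considered here.\<close>

definition cutoff :: "real \<Rightarrow> real \<Rightarrow> 'a::euclidean_space \<Rightarrow> real" where
  "cutoff e n x = smooth_step (e * (ln (ln (4 + inner x x)) - ln (ln (4 + n\<^sup>2))))"

lemma cutoff_bounds: "0 \<le> cutoff e n x \<and> cutoff e n x \<le> 1"
  by (simp add: cutoff_def smooth_step_bounds)

lemma cutoff_eq_1:
  assumes "e > 0" "norm x \<le> n"
  shows "cutoff e n x = 1"
  unfolding cutoff_def
proof (rule smooth_step_eq_1)
  have "inner x x \<le> n\<^sup>2" using power_mono[OF assms(2) norm_ge_zero, of 2] by (simp add: power2_norm_eq_inner)
  moreover have "0 < ln (4 + inner x x)" by (intro ln_4_plus_pos) (smt (verit) inner_ge_zero)
  ultimately have "ln (ln (4 + inner x x)) \<le> ln (ln (4 + n\<^sup>2))"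
    by (smt (verit) inner_ge_zero ln_le_cancel_iff ln_mono)
  then show "e * (ln (ln (4 + inner x x)) - ln (ln (4 + n\<^sup>2))) \<le> 0"
    using assms by (simp add: mult_le_0_iff)
qed

lemma cutoff_smooth:
  assumes "e > 0"
  shows "cutoff e n \<in> C_c_infinity"
  unfolding C_c_infinity_iff
proof
  show "\<forall>k. C_on k UNIV (cutoff e n :: 'a \<Rightarrow> real)"
  proof
    fix k
    have "C_on k UNIV (\<lambda>x::'a. ln (ln (4 + inner x x)))"
      by (rule C_on_compose[OF open_UNIV C_on_lnln_4_plus C_on_inner_self]) (smt (verit) inner_ge_zero greaterThan_iff)
    then show "C_on k UNIV (cutoff e n :: 'a \<Rightarrow> real)"
      unfolding cutoff_def[abs_def]
      by (intro C_on_compose[OF open_UNIV C_on_smooth_step C_on_mult[OF open_UNIV C_on_const[OF open_UNIV] C_on_diff[OF open_UNIV _ C_on_const[OF open_UNIV]]]]) auto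
  qed
  \<comment> \<open>The value of ln ln (4 + |x|^2) at which the argument of the step reaches 1; the
    support has a doubly exponential radius.\<close>
  define c where "c = ln (ln (4 + n\<^sup>2)) + 1 / e"
  have "cutoff e n x = 0" if "sqrt (exp (exp c)) < norm x" for x :: 'a
    unfolding cutoff_def
  proof (rule smooth_step_eq_0)
    have "(sqrt (exp (exp c)))\<^sup>2 \<le> (norm x)\<^sup>2" using that by (intro power_mono) auto
    then have "exp (exp c) \<le> 4 + inner x x" by (simp add: power2_norm_eq_inner)
    then have "exp c \<le> ln (4 + inner x x)" by (subst ln_ge_iff) (auto intro: add_pos_nonneg)
    then have "c \<le> ln (ln (4 + inner x x))" by (subst ln_ge_iff) (auto intro: less_le_trans[OF exp_gt_zero])
    then have "e * (1 / e) \<le> e * (ln (ln (4 + inner x x)) - ln (ln (4 + n\<^sup>2)))"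
      using assms by (intro mult_left_mono) (auto simp: c_def)
    then show "1 \<le> e * (ln (ln (4 + inner x x)) - ln (ln (4 + n\<^sup>2)))" using assms by simp
  qed
  then show "\<exists>R. \<forall>x::'a. R < norm x \<longrightarrow> cutoff e n x = 0" by blast
qed

lemma gradient_cutoff:
  fixes x :: "'a::euclidean_space"
  shows "gradient (cutoff e n) x
    = (2 * (deriv smooth_step (e * (ln (ln (4 + (norm x)\<^sup>2)) - ln (ln (4 + n\<^sup>2)))) * e / log_scale (norm x))) *\<^sub>R x"
proof -
  let ?g = "\<lambda>s. smooth_step (e * (ln (ln (4 + s)) - ln (ln (4 + n\<^sup>2))))"
  have "((\<lambda>s. e * (ln (ln (4 + s)) - ln (ln (4 + n\<^sup>2)))) has_real_derivative e * inverse (log_scale (norm x))) (at ((norm x)\<^sup>2))"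
    using DERIV_cmult[OF DERIV_diff[OF lnln_has_derivative DERIV_const], of e] by simp
  from DERIV_chain2[OF C_on_deriv(1)[OF C_on_smooth_step] this]
  have "(?g has_real_derivative deriv smooth_step (e * (ln (ln (4 + (norm x)\<^sup>2)) - ln (ln (4 + n\<^sup>2)))) * e / log_scale (norm x)) (at (inner x x))"
    by (simp add: power2_norm_eq_inner divide_inverse mult.assoc)
  from gradient_radial[OF this] show ?thesis by (simp add: cutoff_def[abs_def])
qed

text \<open>If \<alpha> times the gradient of the cut-off is m(|x|) x, its image under L is d m + r
  m' with d the dimension. Both terms are bounded by a multiple of the slope e, since a, r a' and r
  times the derivative of \<open>log_scale\<close> are all of order
  \<open>log_scale\<close>.\<close>

lemma conservative_radial:
  fixes a a' :: "real \<Rightarrow> real"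
  assumes form: "energy_form \<alpha> E F" and \<alpha>: "\<And>x. \<alpha> x = a (norm x)"
    and a: "\<And>r. 0 \<le> r \<Longrightarrow> (a has_real_derivative a' r) (at r)" "continuous_on {0..} a'"
    and C: "0 < C" "\<And>r. 0 \<le> r \<Longrightarrow> \<bar>a r\<bar> \<le> C * log_scale r" "\<And>r. 0 \<le> r \<Longrightarrow> r * \<bar>a' r\<bar> \<le> C * log_scale r"
  shows "conservative (E :: 'a::euclidean_space L2 \<Rightarrow> 'a L2 \<Rightarrow> real) F"
proof -
  interpret energy_form \<alpha> E F by fact
  obtain C1 where C1: "C1 > 0" "\<And>s. \<bar>deriv smooth_step s\<bar> \<le> C1" "\<And>s. \<bar>deriv (deriv smooth_step) s\<bar> \<le> C1"
    using smooth_step_derivs_bounded by blast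
  have d1: "(deriv smooth_step has_real_derivative deriv (deriv smooth_step) s) (at s)" for s
    by (rule C_on_deriv(1)[OF C_on_deriv(2)[OF C_on_smooth_step]])
  have c2: "continuous_on A (deriv (deriv smooth_step))" for A
    using C_on_deriv(2)[OF C_on_deriv(2)[OF C_on_smooth_step], of 0] by (auto intro: continuous_on_subset)
  have c1: "continuous_on A (deriv smooth_step)" for A
    using C_on_deriv(2)[OF C_on_smooth_step, of 0] by (auto intro: continuous_on_subset)
  have ca: "continuous_on {0..} a"
    using a(1) by (auto intro!: continuous_at_imp_continuous_on DERIV_isCont)
  have cD: "continuous_on A log_scale" for A
    using log_scale_has_derivative by (auto intro!: continuous_at_imp_continuous_on DERIV_isCont)
  show ?thesis
  proof (rule conservativeI)
    fix n :: nat
    \<comment> \<open>The dimension comes from m. The 7 comes from r m': 2 from the second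
      derivative of the step, and 5 from differentiating a / \<open>log_scale\<close>, namely 1 for
      a' and 4 for the denominator.\<close>
    define K where "K = 2 * C1 * C * (real DIM('a) + 7)"
    have K: "K > 0" using C(1) C1(1) by (simp add: K_def)
    \<comment> \<open>The bound e \<le> 1 lets the term quadratic in e count as linear.\<close>
    define e where "e = min 1 (1 / (K * real (Suc n)))"
    have e: "0 < e" "e \<le> 1" "K * e \<le> 1 / real (Suc n)"
      using K by (auto simp: e_def min_def field_simps simp del: of_nat_Suc)
    define s where "s r = e * (ln (ln (4 + r\<^sup>2)) - ln (ln (4 + (real n)\<^sup>2)))" for r
    define D where "D r = 2 * r * ln (4 + r\<^sup>2) + 2 * r" for r :: real
    define m where "m r = 2 * e * (deriv smooth_step (s r) * (a r / log_scale r))" for r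
    define m' where "m' r = 2 * e * (deriv (deriv smooth_step) (s r) * (e * (2 * r / log_scale r)) * (a r / log_scale r)
       + deriv smooth_step (s r) * ((a' r * log_scale r - a r * D r) / (log_scale r * log_scale r)))" for r
    define f where "f x = real DIM('a) * m (norm x) + norm x * m' (norm x)" for x :: 'a
    have s: "(s has_real_derivative e * (2 * r / log_scale r)) (at r)" for r
    proof -
      have "((\<lambda>r. ln (ln (4 + r\<^sup>2))) has_real_derivative inverse (log_scale r) * (2 * r)) (at r)"
        by (rule DERIV_chain2[of "\<lambda>s. ln (ln (4 + s))" _ "\<lambda>r. r\<^sup>2"])
          (rule lnln_has_derivative, auto intro!: derivative_eq_intros)
      from DERIV_cmult[OF DERIV_diff[OF this DERIV_const], of e]
      show ?thesis by (simp add: s_def[abs_def] divide_inverse mult_ac)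
    qed
    have m: "(m has_real_derivative m' r) (at r)" if "0 \<le> r" for r
    proof -
      have "((\<lambda>r. a r / log_scale r) has_real_derivative (a' r * log_scale r - a r * D r) / (log_scale r * log_scale r)) (at r)"
        unfolding D_def by (rule DERIV_divide[OF a(1)[OF that] log_scale_has_derivative]) (use log_scale_pos[of r] in simp)
      from DERIV_cmult[OF DERIV_mult[OF DERIV_chain2[OF d1 s] this], of "2 * e"]
      show ?thesis by (simp add: m_def[abs_def] m'_def mult_ac add.commute)
    qed
    have cs: "continuous_on A s" for A
      using s by (auto intro!: continuous_at_imp_continuous_on DERIV_isCont)
    have cDD: "continuous_on A D" for A
      unfolding D_def by (intro continuous_intros) (smt (verit) zero_le_power2)
    have cm': "continuous_on {0..} m'"
      unfolding m'_def using log_scale_pos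
      by (intro continuous_intros continuous_on_compose2[OF c2 cs] continuous_on_compose2[OF c1 cs] cD ca a cDD)
        (auto simp: less_imp_neq[symmetric])
    have cm: "continuous_on {0..} m"
      using m by (auto intro!: continuous_at_imp_continuous_on DERIV_isCont)
    have mb: "\<bar>m r\<bar> \<le> 2 * e * (C1 * C)" if r: "0 \<le> r" for r
    proof -
      have "\<bar>a r / log_scale r\<bar> \<le> C" using C(2)[OF r] log_scale_pos[of r] by (simp add: field_simps)
      then have "\<bar>deriv smooth_step (s r)\<bar> * \<bar>a r / log_scale r\<bar> \<le> C1 * C"
        using C1 by (intro mult_mono) auto
      then have "2 * e * (\<bar>deriv smooth_step (s r)\<bar> * \<bar>a r / log_scale r\<bar>) \<le> 2 * e * (C1 * C)"
        using e by (intro mult_left_mono) auto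
      then show ?thesis using e by (simp add: m_def abs_mult)
    qed
    have mb': "r * \<bar>m' r\<bar> \<le> 2 * e * (C1 * C * 7)" if r: "0 \<le> r" for r
    proof -
      have pos: "log_scale r > 0" by (rule log_scale_pos)
      have l1: "1 \<le> ln (4 + r\<^sup>2)" by (rule ln_4_plus_ge_1) simp
      have rD: "r * D r \<le> 4 * log_scale r" "0 \<le> r * D r"
      proof -
        have "r * D r = 2 * r\<^sup>2 * (ln (4 + r\<^sup>2) + 1)" by (simp add: D_def power2_eq_square algebra_simps)
        also have "\<dots> \<le> (2 * (4 + r\<^sup>2)) * (2 * ln (4 + r\<^sup>2))" using l1 by (intro mult_mono) auto
        also have "\<dots> = 4 * log_scale r" by (simp add: log_scale_def)
        finally show "r * D r \<le> 4 * log_scale r" .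
        show "0 \<le> r * D r" using r l1 by (simp add: D_def)
      qed
      have q1: "\<bar>a r / log_scale r\<bar> \<le> C" using C(2)[OF r] pos by (simp add: field_simps)
      have q2: "\<bar>r * (2 * r / log_scale r)\<bar> \<le> 2"
      proof -
        have "2 * r * r \<le> 2 * log_scale r" using log_scale_ge[of r] by (simp add: power2_eq_square)
        then show ?thesis using pos r by (simp add: field_simps)
      qed
      have q3: "\<bar>r * ((a' r * log_scale r - a r * D r) / (log_scale r * log_scale r))\<bar> \<le> 5 * C"
      proof -
        have eq: "r * ((a' r * log_scale r - a r * D r) / (log_scale r * log_scale r))
          = (r * a' r) / log_scale r - (a r / log_scale r) * ((r * D r) / log_scale r)"
          using pos by (simp add: field_simps)
        have "\<bar>(r * a' r) / log_scale r\<bar> \<le> C"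
          using C(3)[OF r] pos r by (simp add: abs_mult field_simps)
        moreover have "\<bar>a r / log_scale r\<bar> * \<bar>(r * D r) / log_scale r\<bar> \<le> C * 4"
          using q1 rD pos C(1) by (intro mult_mono) (auto simp: field_simps)
        ultimately show ?thesis unfolding eq
          by (intro order_trans[OF abs_triangle_ineq4]) (simp only: abs_mult)
      qed
      have "r * m' r = 2 * e * (deriv (deriv smooth_step) (s r) * (e * (r * (2 * r / log_scale r))) * (a r / log_scale r)
         + deriv smooth_step (s r) * (r * ((a' r * log_scale r - a r * D r) / (log_scale r * log_scale r))))"
        unfolding m'_def by (simp only: distrib_left mult_ac)
      also have "\<bar>\<dots>\<bar> \<le> 2 * e * (C1 * (1 * 2) * C + C1 * (5 * C))"
        unfolding abs_mult[of "2 * e"]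
      proof (rule mult_mono)
        show "\<bar>deriv (deriv smooth_step) (s r) * (e * (r * (2 * r / log_scale r))) * (a r / log_scale r)
         + deriv smooth_step (s r) * (r * ((a' r * log_scale r - a r * D r) / (log_scale r * log_scale r)))\<bar>
         \<le> C1 * (1 * 2) * C + C1 * (5 * C)"
        proof (rule order_trans[OF abs_triangle_ineq add_mono])
          show "\<bar>deriv (deriv smooth_step) (s r) * (e * (r * (2 * r / log_scale r))) * (a r / log_scale r)\<bar> \<le> C1 * (1 * 2) * C"
            unfolding abs_mult[of _ "a r / log_scale r"] abs_mult[of "deriv (deriv smooth_step) (s r)"] abs_mult[of e]
            using C1 C(1) e q1 q2 by (intro mult_mono) auto
          show "\<bar>deriv smooth_step (s r) * (r * ((a' r * log_scale r - a r * D r) / (log_scale r * log_scale r)))\<bar> \<le> C1 * (5 * C)"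
            unfolding abs_mult[of "deriv smooth_step (s r)"]
            using C1 q3 by (intro mult_mono) auto
        qed
      qed (use e in auto)
      finally show ?thesis using r by (simp add: abs_mult algebra_simps)
    qed
    have fb: "\<bar>f x\<bar> \<le> 1 / real (Suc n)" for x
    proof -
      have "\<bar>f x\<bar> \<le> real DIM('a) * \<bar>m (norm x)\<bar> + norm x * \<bar>m' (norm x)\<bar>"
        unfolding f_def by (rule order_trans[OF abs_triangle_ineq]) (simp add: abs_mult)
      also have "\<dots> \<le> real DIM('a) * (2 * e * (C1 * C)) + 2 * e * (C1 * C * 7)"
        by (intro add_mono mult_left_mono mb mb') auto
      also have "\<dots> = K * e" by (simp add: K_def algebra_simps)
      finally show ?thesis using e(3) by linarith
    qed
    let ?\<phi> = "cutoff e (real n) :: 'a \<Rightarrow> real"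
    have \<phi>: "?\<phi> \<in> C_c_infinity" by (rule cutoff_smooth) fact
    obtain R where R: "\<And>x. R < norm x \<Longrightarrow> ?\<phi> x = 0" using C_c_infinityD(2)[OF \<phi>] by blast
    have fL: "f \<in> L2_fun"
    proof -
      \<comment> \<open>Strictly beyond this radius the argument of the step exceeds 1, where its
        derivatives are known to vanish.\<close>
      define S where "S = sqrt (exp (exp (ln (ln (4 + (real n)\<^sup>2)) + 1 / e)))"
      have "f x = 0" if "S < norm x" for x
      proof -
        define c where "c = ln (ln (4 + (real n)\<^sup>2)) + 1 / e"
        have "S\<^sup>2 < (norm x)\<^sup>2" using that by (intro power_strict_mono) (auto simp: S_def)
        then have "exp (exp c) < 4 + (norm x)\<^sup>2" by (simp add: S_def c_def)
        then have "exp c < ln (4 + (norm x)\<^sup>2)" by (rule less_ln_if_exp_less)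
        then have "c < ln (ln (4 + (norm x)\<^sup>2))" by (rule less_ln_if_exp_less)
        then have "e * (1 / e) < s (norm x)"
          unfolding s_def using e by (intro mult_strict_left_mono) (auto simp: c_def)
        then have "1 < s (norm x)" using e by simp
        then show ?thesis by (simp add: f_def m_def m'_def deriv_smooth_step_eq_0 deriv2_smooth_step_eq_0)
      qed
      moreover have cf: "continuous_on UNIV f"
        unfolding f_def
        by (intro continuous_intros continuous_on_compose2[OF cm] continuous_on_compose2[OF cm']) auto
      ultimately have "integrable lborel (\<lambda>x. (f x)\<^sup>2)"
        by (intro integrable_compact_support[of _ S]) (auto intro!: continuous_intros)
      then show ?thesis using cf by (simp add: L2_fun_def borel_measurable_continuous_onI)
    qed
    have "(to_L2 ?\<phi>, to_L2 f) \<in> form_generator E F"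
    proof (rule form_generatorI[OF \<phi> fL])
      fix v :: "'a \<Rightarrow> real" assume v: "v \<in> C_c_infinity"
      have "energy \<alpha> ?\<phi> v = (\<integral>x. m (norm x) * inner x (gradient v x) \<partial>lborel)"
        unfolding energy_def gradient_cutoff \<alpha> m_def s_def
        by (intro Bochner_Integration.integral_cong) (auto simp: mult_ac)
      also have "\<dots> = - (\<integral>x. f x * v x \<partial>lborel)"
        unfolding f_def by (rule radial_integration_by_parts(1)[OF v m cm'])
      finally show "energy \<alpha> ?\<phi> v = - (\<integral>x. f x * v x \<partial>lborel)" .
    qed
    moreover have "bounded {x. ?\<phi> x \<noteq> 0}"
      using R by (auto simp: bounded_iff not_le[symmetric] intro!: exI[of _ R])
    ultimately show "\<exists>\<phi> f. \<phi> \<in> L2_fun \<and> f \<in> L2_fun \<and> (\<forall>x. 0 \<le> \<phi> x \<and> \<phi> x \<le> 1) \<and>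
       bounded {x. \<phi> x \<noteq> 0} \<and> (\<forall>x. norm x \<le> real n \<longrightarrow> \<phi> x = 1) \<and>
       (\<forall>x. \<bar>f x\<bar> \<le> 1 / real (Suc n)) \<and> (to_L2 \<phi>, to_L2 f) \<in> form_generator E F"
      using C_c_infinity_L2[OF \<phi>] fL fb cutoff_bounds cutoff_eq_1[OF e(1)]
      by (intro exI[of _ ?\<phi>] exI[of _ f]) blast
  qed
qed

text \<open>The supersolution is \<open>U(x) = ln (4 + |x|\<^sup>2) powr (- d)\<close>, a smooth bounded function of the size of
  \<open>\<integral>\<^bsub>|x|\<^esub>\<^bsup>\<infinity>\<^esup> s / a(s) ds\<close>. It satisfies \<open>- L U \<ge> c > 0\<close> only near infinity, which suffices
  because the zero-order term dominates on compact sets for a small resolvent parameter.\<close>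

lemma explosive_radial:
  assumes form: "energy_form \<alpha> E F" and d: "d > 0"
    and \<alpha>: "\<And>x. \<alpha> x = (2 + norm x)\<^sup>2 * ln (2 + norm x) powr (1 + d)"
  shows "explosive (E :: 'a::euclidean_space L2 \<Rightarrow> 'a L2 \<Rightarrow> real) F"
proof -
  interpret energy_form \<alpha> E F by fact
  \<comment> \<open>A and B compare the ingredients 2 + r of the weight with the smooth 4 + r^2 of
    the supersolution. With U and c as defined below, \<alpha> times the gradient of U is -(1/c)
    M(|x|) x, and N is the divergence of M(|x|) x.\<close>
  define A where "A r = (2 + r)\<^sup>2 / (4 + r\<^sup>2)" for r :: real
  define A' where "A' r = (2 * (2 + r) * (4 + r\<^sup>2) - (2 + r)\<^sup>2 * (2 * r)) / (4 + r\<^sup>2)\<^sup>2" for r :: real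
  define B where "B r = ln (2 + r) / ln (4 + r\<^sup>2)" for r :: real
  define B' where "B' r = (ln (4 + r\<^sup>2) / (2 + r) - ln (2 + r) * (2 * r / (4 + r\<^sup>2))) / (ln (4 + r\<^sup>2))\<^sup>2" for r :: real
  define M where "M r = 2 * d * (A r * B r powr (1 + d))" for r
  define M' where "M' r = 2 * d * (A' r * B r powr (1 + d) + A r * ((1 + d) * B r powr d * B' r))" for r
  define N where "N r = real DIM('a) * M r + r * M' r" for r
  have pos: "0 < 4 + r\<^sup>2" "0 < ln (4 + r\<^sup>2)" for r :: real
    using ln_4_plus_ge_1[of "r\<^sup>2"] by (auto intro: add_pos_nonneg)
  have Bpos: "0 < B r" if "0 \<le> r" for r
    using that pos by (simp add: B_def)
  have dA: "(A has_real_derivative A' r) (at r)" for r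
    unfolding A_def[abs_def] A'_def using pos[of r]
    by (auto intro!: derivative_eq_intros simp: power2_eq_square[of "4 + r\<^sup>2"])
  have dB: "(B has_real_derivative B' r) (at r)" if "0 \<le> r" for r
    unfolding B_def[abs_def] B'_def using pos[of r] that
    by (auto intro!: derivative_eq_intros simp: power2_eq_square[of "ln (4 + r\<^sup>2)"])
  have dM: "(M has_real_derivative M' r) (at r)" if "0 \<le> r" for r
  proof -
    have "((\<lambda>r. B r powr (1 + d)) has_real_derivative (1 + d) * B r powr d * B' r) (at r)"
      using DERIV_chain2[OF has_real_derivative_powr[OF Bpos[OF that], of "1 + d"] dB[OF that]] by simp
    from DERIV_cmult[OF DERIV_mult[OF dA this], of "2 * d"]
    show ?thesis by (simp add: M_def[abs_def] M'_def mult_ac)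
  qed
  have cont: "continuous_on {0..} A'" "continuous_on {0..} B'" "continuous_on {0..} A" "continuous_on {0..} B"
    unfolding A'_def B'_def A_def B_def using pos
    by (auto intro!: continuous_intros simp: less_imp_neq[symmetric])
  have cM': "continuous_on {0..} M'"
    unfolding M'_def using Bpos by (intro continuous_intros cont) (auto simp: less_imp_neq[symmetric])
  have cM: "continuous_on {0..} M"
    using dM by (auto intro!: continuous_at_imp_continuous_on DERIV_isCont)
  have cN: "continuous_on {0..} N" unfolding N_def by (intro continuous_intros cM cM')
  \<comment> \<open>The limit 1/2 arises because ln (4 + r^2) grows like 2 ln r.\<close>
  have lims: "(A \<longlongrightarrow> 1) at_top" "((\<lambda>r. r * A' r) \<longlongrightarrow> 0) at_top" "(B \<longlongrightarrow> 1/2) at_top" "((\<lambda>r. r * B' r) \<longlongrightarrow> 0) at_top"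
    unfolding A_def A'_def B_def B'_def by real_asymp+
  have "((\<lambda>r. real DIM('a) * (2 * d * (A r * B r powr (1 + d)))
     + 2 * d * ((r * A' r) * B r powr (1 + d) + A r * ((1 + d) * B r powr d * (r * B' r))))
     \<longlongrightarrow> real DIM('a) * (2 * d * (1 * (1/2) powr (1 + d))) + 2 * d * (0 * (1/2) powr (1 + d) + 1 * ((1 + d) * (1/2) powr d * 0))) at_top"
    by (intro tendsto_intros lims) auto
  then have limN: "(N \<longlongrightarrow> real DIM('a) * (2 * d * (1/2) powr (1 + d))) at_top"
    by (simp add: N_def[abs_def] M_def M'_def algebra_simps)
  \<comment> \<open>Half the limit of N, hence a positive lower bound for N near infinity.\<close>
  define \<nu> where "\<nu> = real DIM('a) * (d * (1/2) powr (1 + d))"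
  have \<nu>: "\<nu> > 0" using d by (simp add: \<nu>_def)
  have "(N \<longlongrightarrow> 2 * \<nu>) at_top" using limN by (simp add: \<nu>_def mult_ac)
  then have "\<forall>\<^sub>F r in at_top. \<nu> < N r" by (rule order_tendstoD(1)) (use \<nu> in simp)
  then obtain R0 where R0: "\<And>r. R0 \<le> r \<Longrightarrow> \<nu> < N r" by (auto simp: eventually_at_top_linorder)
  define R where "R = max R0 0"
  have "compact (N ` {0..R})" by (intro compact_continuous_image continuous_on_subset[OF cN]) auto
  then obtain C0 where C0: "\<And>r. 0 \<le> r \<Longrightarrow> r \<le> R \<Longrightarrow> \<bar>N r\<bar> \<le> C0"
    using compact_imp_bounded by (fastforce simp: bounded_iff)
  define C where "C = max C0 1"
  define u0 where "u0 = ln (4 + R\<^sup>2) powr (- d)"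
  have u0: "u0 > 0" unfolding u0_def powr_gt_zero using pos(2)[of R] by linarith
  \<comment> \<open>This gives \<open>h * C = u0 / 2\<close>: up to radius R the zero-order term, at
    least u0, outweighs a possibly negative \<open>h * N r\<close>.\<close>
  define h where "h = u0 / (2 * C)"
  have h: "h > 0" using u0 by (simp add: h_def C_def)
  define c where "c = min (u0 / 2) (h * \<nu>)"
  have c: "c > 0" using u0 h \<nu> by (simp add: c_def)
  have super: "c \<le> ln (4 + r\<^sup>2) powr (- d) + h * N r" if r: "0 \<le> r" for r
  proof (cases "r \<le> R")
    case True
    have "u0 \<le> ln (4 + r\<^sup>2) powr (- d)"
      unfolding u0_def using True r d pos[of r] pos[of R] by (intro powr_mono2') (auto intro: power_mono)
    moreover have "h * (- C) \<le> h * N r"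
      using C0[OF r True] h by (intro mult_left_mono) (auto simp: C_def)
    moreover have "h * C = u0 / 2" by (simp add: h_def C_def)
    moreover have "c \<le> u0 / 2" by (simp add: c_def)
    ultimately show ?thesis by linarith
  next
    case False
    then have "h * \<nu> \<le> h * N r" using less_imp_le[OF R0, of r] h by (intro mult_left_mono) (auto simp: R_def)
    moreover have "0 \<le> ln (4 + r\<^sup>2) powr (- d)" by (rule powr_ge_zero)
    moreover have "c \<le> h * \<nu>" by (simp add: c_def)
    ultimately show ?thesis by linarith
  qed
  \<comment> \<open>Dividing by c normalises the inequality to U - hLU \<ge> 1, matching the
    resolvent equation with datum at most 1.\<close>
  define U where "U x = (1 / c) * ln (4 + inner x x) powr (- d)" for x :: 'a
  have U: "C_on k UNIV U" for k
  proof -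
    have "C_on k {-1<..} (\<lambda>s::real. ln (4 + s) powr (- d))"
      by (rule C_on_compose[OF open_greaterThan C_on_powr C_on_ln_4_plus]) (simp add: ln_4_plus_pos)
    then have "C_on k UNIV (\<lambda>x::'a. ln (4 + inner x x) powr (- d))"
      by (rule C_on_compose[OF open_UNIV _ C_on_inner_self]) (smt (verit) inner_ge_zero greaterThan_iff)
    then show ?thesis unfolding U_def[abs_def] by (intro C_on_mult C_on_const open_UNIV)
  qed
  have Upos: "0 < U x" for x using c pos(2)[of "norm x"] by (simp add: U_def power2_norm_eq_inner)
  have gU: "\<alpha> x *\<^sub>R gradient U x = (- (1/c) * M (norm x)) *\<^sub>R x" for x
  proof -
    let ?r = "norm x"
    have "((\<lambda>s. (1/c) * ln (4 + s) powr (- d)) has_real_derivative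
       (1/c) * (- d * ln (4 + ?r\<^sup>2) powr (- d - 1) * (1 / (4 + ?r\<^sup>2)))) (at (inner x x))"
      unfolding power2_norm_eq_inner[symmetric]
    proof (rule DERIV_cmult, rule DERIV_chain2[of "\<lambda>y. y powr (- d)"])
      show "((\<lambda>y. y powr (- d)) has_real_derivative - d * ln (4 + ?r\<^sup>2) powr (- d - 1)) (at (ln (4 + ?r\<^sup>2)))"
        by (rule has_real_derivative_powr[OF pos(2)])
      show "((\<lambda>s. ln (4 + s)) has_real_derivative 1 / (4 + ?r\<^sup>2)) (at (?r\<^sup>2))"
        using pos(1)[of ?r] by (auto intro!: derivative_eq_intros)
    qed
    from gradient_radial[OF this]
    have g: "gradient U x = (2 * ((1/c) * (- d * ln (4 + ?r\<^sup>2) powr (- d - 1) * (1 / (4 + ?r\<^sup>2))))) *\<^sub>R x"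
      by (simp add: U_def[abs_def])
    have "ln (2 + ?r) powr (1 + d) * ln (4 + ?r\<^sup>2) powr (- d - 1) = B ?r powr (1 + d)"
    proof -
      have "- d - 1 = - (1 + d)" by simp
      then have "ln (4 + ?r\<^sup>2) powr (- d - 1) = inverse (ln (4 + ?r\<^sup>2) powr (1 + d))" by (simp only: powr_minus)
      moreover have "B ?r powr (1 + d) = ln (2 + ?r) powr (1 + d) / ln (4 + ?r\<^sup>2) powr (1 + d)"
        unfolding B_def by (rule powr_divide)
      ultimately show ?thesis by (simp add: divide_inverse)
    qed
    then have "\<alpha> x * (2 * ((1/c) * (- d * ln (4 + ?r\<^sup>2) powr (- d - 1) * (1 / (4 + ?r\<^sup>2))))) = - (1/c) * M ?r"
      unfolding \<alpha> M_def A_def by (simp add: field_simps)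
    then show ?thesis unfolding g by simp
  qed
  have res: "AE x in lborel. rep_L2 (resolvent h f) x \<le> U x" if f: "f \<in> between 0 1" for f
  proof (rule resolvent_le_supersolution[OF h f U Upos])
    fix w :: "'a \<Rightarrow> real" assume w: "w \<in> C_c_infinity" and w0: "\<And>x. 0 \<le> w x"
    obtain S where S: "\<And>x. S < norm x \<Longrightarrow> w x = 0" using C_c_infinityD(2)[OF w] by blast
    have ints: "integrable lborel w" "integrable lborel (\<lambda>x. U x * w x)"
      by (rule integrable_compact_support[of _ S]; use S in \<open>auto intro!: continuous_intros C_c_infinityD(3)[OF w] smoothD(1)[OF U]\<close>)+
    note ibp = radial_integration_by_parts[OF w dM cM', folded N_def]
    have "(\<integral>x. \<alpha> x * inner (gradient U x) (gradient w x) \<partial>lborel) = (\<integral>x. (- (1/c)) * (M (norm x) * inner x (gradient w x)) \<partial>lborel)"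
    proof (rule Bochner_Integration.integral_cong[OF refl])
      fix x
      have "\<alpha> x * inner (gradient U x) (gradient w x) = inner (\<alpha> x *\<^sub>R gradient U x) (gradient w x)" by simp
      then show "\<alpha> x * inner (gradient U x) (gradient w x) = (- (1/c)) * (M (norm x) * inner x (gradient w x))"
        unfolding gU by simp
    qed
    also have "\<dots> = (1/c) * (\<integral>x. N (norm x) * w x \<partial>lborel)"
      unfolding Bochner_Integration.integral_mult_right_zero using ibp(1) by simp
    finally have "h * (\<integral>x. \<alpha> x * inner (gradient U x) (gradient w x) \<partial>lborel) + (\<integral>x. U x * w x \<partial>lborel)
       = (\<integral>x. (h / c) * (N (norm x) * w x) + U x * w x \<partial>lborel)"
      using ibp(2) ints by simp
    moreover have "(\<integral>x. w x \<partial>lborel) \<le> \<dots>"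
    proof (rule integral_mono)
      show "integrable lborel (\<lambda>x. (h / c) * (N (norm x) * w x) + U x * w x)" using ibp(2) ints by simp
      fix x
      have "c * 1 \<le> c * ((h / c) * N (norm x) + U x)"
        using super[of "norm x"] c by (simp add: U_def power2_norm_eq_inner distrib_left)
      then have "1 \<le> (h / c) * N (norm x) + U x" using c by simp
      from mult_right_mono[OF this w0[of x]]
      show "w x \<le> (h / c) * (N (norm x) * w x) + U x * w x" by (simp add: distrib_right)
    qed (rule ints)
    ultimately show "(\<integral>x. w x \<partial>lborel) \<le> h * (\<integral>x. \<alpha> x * inner (gradient U x) (gradient w x) \<partial>lborel) + (\<integral>x. U x * w x \<partial>lborel)"
      by simp
  qed
  \<comment> \<open>U vanishes at infinity, so on some distant ball the resolvents of all
    truncations of 1 stay below 1/2.\<close>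
  have "((\<lambda>r. ln (4 + r\<^sup>2) powr (- d)) \<longlongrightarrow> 0) at_top" using d by real_asymp
  then have "\<forall>\<^sub>F r in at_top. ln (4 + r\<^sup>2) powr (- d) < c / 2" using c by (intro order_tendstoD(2)) auto
  then obtain r1 where r1: "\<And>r. r1 \<le> r \<Longrightarrow> ln (4 + r\<^sup>2) powr (- d) < c / 2" by (auto simp: eventually_at_top_linorder)
  obtain b :: 'a where b: "b \<in> Basis" using nonempty_Basis by blast
  define x0 where "x0 = (\<bar>r1\<bar> + 1) *\<^sub>R b"
  have x0: "norm x0 = \<bar>r1\<bar> + 1" using b by (simp add: x0_def)
  have far: "U x \<le> 1/2" if "x \<in> ball x0 1" for x
  proof -
    have "norm x0 \<le> norm x + dist x0 x" by (metis dist_commute dist_norm norm_triangle_sub)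
    then have "r1 \<le> norm x" using that x0 by (simp add: abs_if split: if_splits)
    from r1[OF this] show ?thesis using c by (simp add: U_def power2_norm_eq_inner field_simps)
  qed
  show ?thesis
  proof (rule explosiveI[OF h, of "ball x0 1" "1/2"])
    show "0 < measure lborel (ball x0 1)" using content_ball_pos[of 1 x0] by simp
    fix k
    have "to_L2 (ind k) \<in> between 0 1"
      by (rule to_L2_between[OF ind_L2]) (auto simp: ind_def indicator_def)
    from res[OF this]
    show "AE x in lborel. x \<in> ball x0 1 \<longrightarrow> rep_L2 (resolvent h (to_L2 (ind k))) x \<le> 1/2"
      by eventually_elim (use far in fastforce)
  qed auto
qed

section \<open>Mosco convergence\<close>

text \<open>\<open>k n\<close> is the largest j \<le> n with \<open>P j n\<close>. Where there is
  none it is the unspecified maximum of the empty set, which occurs only finitely often since index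
  0 is eventually admissible.\<close>

lemma diagonal_eventually:
  assumes "\<And>j::nat. \<forall>\<^sub>F n in sequentially. P j n"
  obtains k where "filterlim k at_top sequentially" "\<forall>\<^sub>F n in sequentially. P (k n) n"
proof -
  define S where "S n = {j. j \<le> n \<and> P j n}" for n
  define k where "k n = Max (S n)" for n
  have S: "finite (S n)" for n unfolding S_def by (rule finite_subset[of _ "{..n}"]) auto
  have ev: "\<forall>\<^sub>F n in sequentially. j \<in> S n" for j
    using assms[of j] eventually_ge_at_top[of j] by eventually_elim (simp add: S_def)
  have "\<forall>\<^sub>F n in sequentially. j \<le> k n" for j
    using ev[of j] by eventually_elim (simp add: k_def Max_ge[OF S])
  then have "filterlim k at_top sequentially" by (simp add: filterlim_at_top)
  moreover have "\<forall>\<^sub>F n in sequentially. P (k n) n"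
    using ev[of 0]
  proof eventually_elim
    case (elim n)
    then have "k n \<in> S n" unfolding k_def by (intro Max_in S) auto
    then show ?case by (simp add: S_def)
  qed
  ultimately show ?thesis by (rule that)
qed

text \<open>Gradients of test functions have compact support, so any continuous G is an admissible
  dominating weight.\<close>

lemma energy_tendsto:
  assumes \<phi>: "\<phi> \<in> C_c_infinity" and cont: "\<And>n. continuous_on UNIV (\<alpha>n n)" "continuous_on UNIV \<alpha>" "continuous_on UNIV G"
    and lim: "\<And>x. (\<lambda>n. \<alpha>n n x) \<longlonglongrightarrow> \<alpha> x" and bound: "\<And>n x. \<bar>\<alpha>n n x\<bar> \<le> G x"
  shows "(\<lambda>n. energy (\<alpha>n n) \<phi> \<phi>) \<longlonglongrightarrow> energy \<alpha> \<phi> \<phi>"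
  unfolding energy_def
proof (rule integral_dominated_convergence[where w = "\<lambda>x. G x * inner (gradient \<phi> x) (gradient \<phi> x)"])
  show "integrable lborel (\<lambda>x. G x * inner (gradient \<phi> x) (gradient \<phi> x))"
    by (rule energy_integrable[OF \<phi> \<phi> cont(3)])
  show "(\<lambda>x. \<alpha> x * inner (gradient \<phi> x) (gradient \<phi> x)) \<in> borel_measurable lborel"
    using energy_integrable[OF \<phi> \<phi> cont(2)] by (rule borel_measurable_integrable)
  show "(\<lambda>x. \<alpha>n n x * inner (gradient \<phi> x) (gradient \<phi> x)) \<in> borel_measurable lborel" for n
    using energy_integrable[OF \<phi> \<phi> cont(1)] by (rule borel_measurable_integrable)
  show "AE x in lborel. (\<lambda>n. \<alpha>n n x * inner (gradient \<phi> x) (gradient \<phi> x))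
      \<longlonglongrightarrow> \<alpha> x * inner (gradient \<phi> x) (gradient \<phi> x)"
    by (intro AE_I2 tendsto_intros lim)
  show "AE x in lborel. norm (\<alpha>n n x * inner (gradient \<phi> x) (gradient \<phi> x))
      \<le> G x * inner (gradient \<phi> x) (gradient \<phi> x)" for n
    using bound[of n] by (intro AE_I2) (simp add: abs_mult mult_right_mono)
qed

text \<open>A fixed test function is its own recovery sequence; the diagonal choice lets it vary
  slowly enough. Outside \<open>F\<close> the right side is infinite and a constant sequence will
  do.\<close>

lemma recovery_sequence:
  assumes forms: "\<And>n. energy_form (\<alpha>n n) (En n) (Fn n)" "energy_form \<alpha> E F"
    and G: "continuous_on UNIV G"
    and lim: "\<And>x. (\<lambda>n. \<alpha>n n x) \<longlonglongrightarrow> \<alpha> x" and bound: "\<And>n x. \<bar>\<alpha>n n x\<bar> \<le> G x"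
  shows "\<exists>un. un \<longlonglongrightarrow> u \<and> limsup (\<lambda>n. extended_form (En n) (Fn n) (un n)) \<le> extended_form E F u"
proof (cases "u \<in> F")
  case False
  then show ?thesis by (intro exI[of _ "\<lambda>_. u"]) (simp add: extended_form_def)
next
  case True
  interpret A: energy_form \<alpha> E F by fact
  obtain \<phi> where \<phi>: "\<And>n::nat. \<phi> n \<in> C_c_infinity" "(\<lambda>n. to_L2 (\<phi> n)) \<longlonglongrightarrow> u"
    "(\<lambda>n. E (to_L2 (\<phi> n) - u) (to_L2 (\<phi> n) - u)) \<longlonglongrightarrow> 0"
    "(\<lambda>n. energy \<alpha> (\<phi> n) (\<phi> n)) \<longlonglongrightarrow> E u u"
    by (rule A.core_sequence[OF True]) (rule that)
  have wc: "continuous_on UNIV (\<alpha>n n)" for n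
    using forms(1) by (rule energy_form.weight_continuous)
  have "\<forall>\<^sub>F n in sequentially. dist (energy (\<alpha>n n) (\<phi> j) (\<phi> j)) (energy \<alpha> (\<phi> j) (\<phi> j)) < 1 / real (Suc j)" for j
    by (rule tendstoD[OF energy_tendsto[OF \<phi>(1) wc A.weight_continuous G lim bound]]) simp
  then obtain k where k: "filterlim k at_top sequentially"
    "\<forall>\<^sub>F n in sequentially. dist (energy (\<alpha>n n) (\<phi> (k n)) (\<phi> (k n))) (energy \<alpha> (\<phi> (k n)) (\<phi> (k n))) < 1 / real (Suc (k n))"
    by (rule diagonal_eventually)
  define b where "b n = energy \<alpha> (\<phi> (k n)) (\<phi> (k n)) + 1 / real (Suc (k n))" for n
  have b: "b \<longlonglongrightarrow> E u u + 0"
    unfolding b_def[abs_def]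
    by (intro tendsto_add filterlim_compose[OF \<phi>(4) k(1)] filterlim_compose[OF LIMSEQ_Suc[OF lim_1_over_n] k(1)])
  have un: "(\<lambda>n. to_L2 (\<phi> (k n))) \<longlonglongrightarrow> u" by (rule filterlim_compose[OF \<phi>(2) k(1)])
  have "limsup (\<lambda>n. extended_form (En n) (Fn n) (to_L2 (\<phi> (k n)))) \<le> limsup (\<lambda>n. ereal (b n))"
  proof (rule Limsup_mono)
    show "\<forall>\<^sub>F n in sequentially. extended_form (En n) (Fn n) (to_L2 (\<phi> (k n))) \<le> ereal (b n)"
      using k(2)
    proof eventually_elim
      case (elim n)
      have "energy (\<alpha>n n) (\<phi> (k n)) (\<phi> (k n)) \<le> b n"
        using elim unfolding b_def dist_real_def by linarith
      then show ?case
        using energy_form.smooth_mem[OF forms(1) \<phi>(1)] energy_form.form_smooth[OF forms(1) \<phi>(1) \<phi>(1)]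
        by (simp add: extended_form_def)
    qed
  qed
  also have "\<dots> = ereal (E u u)"
    by (rule lim_imp_Limsup) (use b in auto)
  finally show ?thesis using un True by (intro exI[of _ "\<lambda>n. to_L2 (\<phi> (k n))"]) (simp add: extended_form_def)
qed

lemma ereal_le_if_all_reals_le:
  assumes "\<And>C. x < ereal C \<Longrightarrow> y \<le> ereal C"
  shows "y \<le> (x::ereal)"
proof (rule dense_ge)
  fix z assume "x < z"
  then show "y \<le> z" using assms by (cases z) auto
qed

lemma frequently_extended_form:
  assumes "liminf (\<lambda>n. extended_form (En n) (Fn n) (un n)) < ereal C"
  shows "\<exists>\<^sub>F n in sequentially. un n \<in> Fn n \<and> En n (un n) (un n) < C"
proof -
  have "\<exists>\<^sub>F n in sequentially. extended_form (En n) (Fn n) (un n) < ereal C"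
    using assms Liminf_bounded[of "ereal C" "\<lambda>n. extended_form (En n) (Fn n) (un n)" sequentially]
    by (auto simp: frequently_def not_less)
  then show ?thesis by (rule frequently_mono[rotated]) (auto simp: extended_form_def split: if_splits)
qed

text \<open>A bound on a lower limit yields good indices only infinitely often; stating this with
  \<open>frequently\<close> avoids passing to subsequences.\<close>

lemma (in closed_dense_form) weak_lsc_frequently:
  assumes wk: "weakly_converges un u" and fr: "\<exists>\<^sub>F n in sequentially. un n \<in> F \<and> E (un n) (un n) \<le> C"
  shows "u \<in> F" "E u u \<le> C"
proof -
  have "liminf (\<lambda>n. extended_form E F (un n)) \<le> ereal C"
  proof (rule ccontr)
    assume "\<not> ?thesis"
    then have "\<forall>\<^sub>F n in sequentially. ereal C < extended_form E F (un n)"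
      by (intro less_LiminfD) simp
    then have "\<forall>\<^sub>F n in sequentially. \<not> (un n \<in> F \<and> E (un n) (un n) \<le> C)"
      by eventually_elim (auto simp: extended_form_def)
    then show False using fr by (simp add: frequently_def)
  qed
  with weak_lsc[OF wk] have "extended_form E F u \<le> ereal C" by (rule order_trans)
  then show "u \<in> F" "E u u \<le> C" by (auto simp: extended_form_def split: if_splits)
qed

lemma le_if_le_all_larger:
  fixes x y :: real
  assumes "\<And>t. t > 0 \<Longrightarrow> x \<le> (1 + t) * y"
  shows "x \<le> y"
proof -
  have "((\<lambda>t. (1 + t) * y) \<longlongrightarrow> (1 + 0) * y) (at_right 0)" by (intro tendsto_intros)
  then have "x \<le> (1 + 0) * y"
    by (rule tendsto_lowerbound) (auto intro: eventually_mono[OF eventually_at_right_less] assms)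
  then show ?thesis by simp
qed

lemma mosco_liminf_comparable:
  fixes E :: "'h::{real_inner,complete_space} \<Rightarrow> 'h \<Rightarrow> real"
  assumes cf: "closed_form E F" "closure F = UNIV"
    and comp: "\<And>t. t > 0 \<Longrightarrow> \<forall>\<^sub>F n in sequentially. \<forall>v\<in>Fn n. v \<in> F \<and> E v v \<le> (1 + t) * En n v v"
    and wk: "weakly_converges un u"
  shows "extended_form E F u \<le> liminf (\<lambda>n. extended_form (En n) (Fn n) (un n))"
proof (rule ereal_le_if_all_reals_le)
  interpret closed_dense_form E F by unfold_locales (fact cf)+
  fix C assume C: "liminf (\<lambda>n. extended_form (En n) (Fn n) (un n)) < ereal C"
  have *: "u \<in> F" "E u u \<le> (1 + t) * C" if t: "t > 0" for t
  proof -
    have "\<exists>\<^sub>F n in sequentially. un n \<in> F \<and> E (un n) (un n) \<le> (1 + t) * C"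
    proof (rule frequently_rev_mp[OF frequently_extended_form[OF C]], rule eventually_mono[OF comp[OF t]], intro impI)
      fix n assume 1: "\<forall>v\<in>Fn n. v \<in> F \<and> E v v \<le> (1 + t) * En n v v" and 2: "un n \<in> Fn n \<and> En n (un n) (un n) < C"
      have "(1 + t) * En n (un n) (un n) \<le> (1 + t) * C" using 2 t by (intro mult_left_mono) auto
      then show "un n \<in> F \<and> E (un n) (un n) \<le> (1 + t) * C" using 1 2 by force
    qed
    from weak_lsc_frequently[OF wk this] show "u \<in> F" "E u u \<le> (1 + t) * C" .
  qed
  have "u \<in> F" using *(1)[of 1] by simp
  moreover have "E u u \<le> C" by (rule le_if_le_all_larger) (rule *(2))
  ultimately show "extended_form E F u \<le> ereal C" by (simp add: extended_form_def)
qed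

text \<open>At each point the cut-off is eventually exactly 1, as its plateau has radius n; this
  holds whatever the slopes are.\<close>

lemma mult_cutoff_tendsto:
  assumes "\<And>n::nat. 0 < e n"
  shows "(\<lambda>n. mult_L2 (cutoff (e n) (real n)) u) \<longlonglongrightarrow> u"
proof (rule LIM_zero_cancel, rule tendsto_norm_zero_cancel)
  let ?c = "\<lambda>n. cutoff (e n) (real n)"
  have cm: "?c n \<in> borel_measurable borel" for n
    by (rule C_c_infinityD(4)[OF cutoff_smooth[OF assms]])
  have c1: "\<bar>?c n x\<bar> \<le> 1" for n x using cutoff_bounds[of "e n" "real n" x] by auto
  have L: "(\<lambda>x. rep_L2 u x * ?c n x) \<in> L2_fun" for n by (rule bounded_mult_L2[OF rep_L2 cm c1])
  have eq: "(norm (mult_L2 (?c n) u - u))\<^sup>2 = (\<integral>x. (rep_L2 u x * ?c n x - rep_L2 u x)\<^sup>2 \<partial>lborel)" for n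
  proof -
    have "mult_L2 (?c n) u - u = to_L2 (\<lambda>x. rep_L2 u x * ?c n x - rep_L2 u x)"
      by (simp add: mult_L2_def to_L2_diff[symmetric] L rep_L2 to_L2_rep)
    then show ?thesis by (simp add: norm_to_L2 L2_fun_diff L rep_L2)
  qed
  have "(\<lambda>n. \<integral>x. (rep_L2 u x * ?c n x - rep_L2 u x)\<^sup>2 \<partial>lborel) \<longlonglongrightarrow> (\<integral>x. 0 \<partial>(lborel :: 'a measure))"
  proof (rule integral_dominated_convergence[where w = "\<lambda>x. (rep_L2 u x)\<^sup>2"])
    show "integrable lborel (\<lambda>x. (rep_L2 u x)\<^sup>2)" using rep_L2[of u] by (simp add: L2_fun_def)
    show "(\<lambda>x. (rep_L2 u x * ?c n x - rep_L2 u x)\<^sup>2) \<in> borel_measurable lborel" for n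
      using cm[of n] by measurable
    show "AE x in lborel. (\<lambda>n. (rep_L2 u x * ?c n x - rep_L2 u x)\<^sup>2) \<longlonglongrightarrow> 0"
    proof (rule AE_I2, rule tendsto_eventually)
      fix x :: 'a
      show "\<forall>\<^sub>F n in sequentially. (rep_L2 u x * ?c n x - rep_L2 u x)\<^sup>2 = 0"
        using eventually_ge_at_top[of "nat \<lceil>norm x\<rceil>"]
      proof eventually_elim
        case (elim n)
        then have "?c n x = 1" by (intro cutoff_eq_1 assms) linarith
        then show ?case by simp
      qed
    qed
    show "AE x in lborel. norm ((rep_L2 u x * ?c n x - rep_L2 u x)\<^sup>2) \<le> (rep_L2 u x)\<^sup>2" for n
    proof (rule AE_I2)
      fix x
      have "(rep_L2 u x * ?c n x - rep_L2 u x)\<^sup>2 = (rep_L2 u x)\<^sup>2 * (?c n x - 1)\<^sup>2"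
        by (simp add: power_mult_distrib[symmetric] algebra_simps)
      also have "\<dots> \<le> (rep_L2 u x)\<^sup>2 * 1"
        using cutoff_bounds[of "e n" "real n" x] by (intro mult_left_mono) (auto simp: abs_square_le_1)
      finally show "norm ((rep_L2 u x * ?c n x - rep_L2 u x)\<^sup>2) \<le> (rep_L2 u x)\<^sup>2" by simp
    qed
  qed simp
  then have "(\<lambda>n. (norm (mult_L2 (?c n) u - u))\<^sup>2) \<longlonglongrightarrow> 0" by (simp add: eq)
  then show "(\<lambda>n. norm (mult_L2 (?c n) u - u)) \<longlonglongrightarrow> 0" by simp
qed

text \<open>The square root (2 + r) ln (2 + r) of the weight times r is at most 2
  \<open>log_scale r\<close>, and the gradient of the cut-off has size at most 2 C1 e r /
  \<open>log_scale r\<close>. Squaring the product of the two constants gives 16.\<close>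

lemma weight_cutoff_bound:
  obtains C where "0 \<le> C" "\<And>e n (x::'a::euclidean_space). 0 < e \<Longrightarrow>
    ((2 + norm x)\<^sup>2 * (ln (2 + norm x))\<^sup>2) * inner (gradient (cutoff e n) x) (gradient (cutoff e n) x) \<le> C * e\<^sup>2"
proof -
  obtain C1 where C1: "C1 > 0" "\<And>s. \<bar>deriv smooth_step s\<bar> \<le> C1" "\<And>s. \<bar>deriv (deriv smooth_step) s\<bar> \<le> C1"
    by (rule smooth_step_derivs_bounded) (rule that)
  have "((2 + norm x)\<^sup>2 * (ln (2 + norm x))\<^sup>2) * inner (gradient (cutoff e n) x) (gradient (cutoff e n) x) \<le> 16 * C1\<^sup>2 * e\<^sup>2"
    if e: "0 < e" for e n and x :: 'a
  proof -
    let ?r = "norm x"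
    define p where "p = deriv smooth_step (e * (ln (ln (4 + (norm x)\<^sup>2)) - ln (ln (4 + n\<^sup>2))))"
    have D: "0 < log_scale ?r" by (rule log_scale_pos)
    have "(2 + ?r) * ?r * ln (2 + ?r) \<le> (2 * (4 + ?r\<^sup>2)) * ln (4 + ?r\<^sup>2)"
    proof (rule mult_mono)
      have "(2 + ?r) * ?r \<le> (2 + ?r)\<^sup>2" by (simp add: power2_eq_square algebra_simps)
      also have "\<dots> \<le> 2 * (4 + ?r\<^sup>2)" by (rule two_plus_le) simp
      finally show "(2 + ?r) * ?r \<le> 2 * (4 + ?r\<^sup>2)" .
    qed (use ln_two_plus_le[of ?r] in auto)
    then have q: "\<bar>(2 + ?r) * ?r * ln (2 + ?r) / log_scale ?r\<bar> \<le> 2"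
      using D by (simp add: log_scale_def abs_mult field_simps)
    have "((2 + ?r)\<^sup>2 * (ln (2 + ?r))\<^sup>2) * inner (gradient (cutoff e n) x) (gradient (cutoff e n) x)
       = (2 * e * p * ((2 + ?r) * ?r * ln (2 + ?r) / log_scale ?r))\<^sup>2"
      unfolding gradient_cutoff p_def[symmetric] inner_scaleR_left inner_scaleR_right power2_norm_eq_inner[symmetric]
      using D by (simp add: power_mult_distrib power_divide power2_eq_square field_simps)
    also have "\<dots> = (2 * e * \<bar>p\<bar> * \<bar>(2 + ?r) * ?r * ln (2 + ?r) / log_scale ?r\<bar>)\<^sup>2"
    proof -
      have "2 * e * \<bar>p\<bar> * \<bar>(2 + ?r) * ?r * ln (2 + ?r) / log_scale ?r\<bar> = \<bar>2 * e * p * ((2 + ?r) * ?r * ln (2 + ?r) / log_scale ?r)\<bar>"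
        unfolding abs_mult[of "2 * e * p"] abs_mult[of "2 * e"] using e by simp
      then show ?thesis by (simp only: power2_abs)
    qed
    also have "\<dots> \<le> (2 * e * C1 * 2)\<^sup>2"
      using e C1 q by (intro power_mono mult_mono) (auto simp: p_def)
    also have "\<dots> = 16 * C1\<^sup>2 * e\<^sup>2" by (simp add: power_mult_distrib)
    finally show ?thesis .
  qed
  then show ?thesis by (intro that[of "16 * C1\<^sup>2"]) auto
qed

text \<open>Although \<open>\<alpha>\<close> makes the process explode, the intrinsic metric \<open>dr / (r ln r)\<close> is complete, so
  the cut-offs have small energy and the monotone limit of the forms is the closure of its
  restriction to test functions.\<close>

lemma mosco_liminf_increasing:
  fixes E :: "'a::euclidean_space L2 \<Rightarrow> 'a L2 \<Rightarrow> real"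
  assumes forms: "\<And>n. energy_form (\<alpha>n n) (En n) (Fn n)" "energy_form \<alpha> E F"
    and \<alpha>n: "\<And>n x. \<alpha>n n x = (2 + norm x) powr (2 - 1 / real (Suc n)) * (ln (2 + norm x))\<^sup>2"
    and \<alpha>: "\<And>x. \<alpha> x = (2 + norm x)\<^sup>2 * (ln (2 + norm x))\<^sup>2"
    and wk: "weakly_converges un u"
  shows "extended_form E F u \<le> liminf (\<lambda>n. extended_form (En n) (Fn n) (un n))"
proof (rule ereal_le_if_all_reals_le)
  interpret A: energy_form \<alpha> E F by fact
  fix C assume C: "liminf (\<lambda>n. extended_form (En n) (Fn n) (un n)) < ereal C"
  have ratio: "\<alpha> x = (2 + norm x) powr (1 / real (Suc m)) * \<alpha>n m x" for m x
  proof -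
    have "0 < 2 + norm x" by (simp add: add_pos_nonneg)
    then have "(2 + norm x)\<^sup>2 = (2 + norm x) powr (1 / real (Suc m) + (2 - 1 / real (Suc m)))"
      by (simp add: powr_numeral)
    then show ?thesis unfolding \<alpha> \<alpha>n by (simp only: powr_add mult.assoc)
  qed
  have mono: "\<alpha>n m x \<le> 1 * \<alpha>n n x" if "m \<le> n" for m n x
    unfolding \<alpha>n mult_1
  proof (rule mult_right_mono[OF powr_mono])
    show "2 - 1 / real (Suc m) \<le> 2 - 1 / real (Suc n)" using that by (simp add: frac_le)
  qed auto
  \<comment> \<open>Energies at indices n \<ge> m bound the fixed form of index m, to which weak
    lower semicontinuity applies.\<close>
  have um: "u \<in> Fn m" "En m u u \<le> C" for m
  proof -
    interpret B: energy_form "\<alpha>n m" "En m" "Fn m" by (rule forms)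
    have "\<exists>\<^sub>F n in sequentially. un n \<in> Fn m \<and> En m (un n) (un n) \<le> C"
    proof (rule frequently_rev_mp[OF frequently_extended_form[OF C]], rule eventually_mono[OF eventually_ge_at_top[of m]], intro impI)
      fix n assume "m \<le> n" and 2: "un n \<in> Fn n \<and> En n (un n) (un n) < C"
      from energy_form_mono[OF forms(1) forms(1) mono[OF this(1)], of "un n"] 2
      show "un n \<in> Fn m \<and> En m (un n) (un n) \<le> C" by auto
    qed
    from B.weak_lsc_frequently[OF wk this] show "u \<in> Fn m" "En m u u \<le> C" .
  qed
  obtain K where K: "0 \<le> K" "\<And>e n x. 0 < e \<Longrightarrow> \<alpha> x * inner (gradient (cutoff e n) x) (gradient (cutoff e n) x) \<le> K * e\<^sup>2"
    using weight_cutoff_bound unfolding \<alpha> by metis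
  \<comment> \<open>A null sequence, so that for fixed t the gradient term of the cut-offs
    disappears in the limit.\<close>
  define e where "e k = 1 / real (Suc k)" for k
  have e: "0 < e k" for k by (simp add: e_def)
  let ?c = "\<lambda>k. cutoff (e k) (real k) :: 'a \<Rightarrow> real"
  \<comment> \<open>For fixed k the support lies in a ball, on which \<alpha> exceeds the weight of
    index m at most by the factor S^(1/(m + 1)). The limits are taken in the order m to infinity, k
    to infinity, t to 0.\<close>
  have cut: "mult_L2 (?c k) u \<in> F"
    "E (mult_L2 (?c k) u) (mult_L2 (?c k) u) \<le> (1 + t) * C + (1 + 1/t) * (K * (e k)\<^sup>2) * (norm u)\<^sup>2"
    if t: "t > 0" for k t
  proof -
    obtain R where R: "\<And>x. R < norm x \<Longrightarrow> ?c k x = 0"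
      using C_c_infinityD(2)[OF cutoff_smooth[OF e]] by blast
    define S where "S = 2 + max R 0"
    have S: "0 < S" by (simp add: S_def)
    have *: "mult_L2 (?c k) u \<in> F \<and> E (mult_L2 (?c k) u) (mult_L2 (?c k) u)
       \<le> (1 + t) * S powr (1 / real (Suc m)) * C + (1 + 1/t) * (K * (e k)\<^sup>2) * (norm u)\<^sup>2" for m
    proof -
      interpret B: energy_form "\<alpha>n m" "En m" "Fn m" by (rule forms)
      have "\<alpha> x \<le> S powr (1 / real (Suc m)) * \<alpha>n m x" if "?c k x \<noteq> 0" for x
      proof -
        have "norm x \<le> R" using R[of x] that by (meson not_le)
        then have "(2 + norm x) powr (1 / real (Suc m)) \<le> S powr (1 / real (Suc m))"
          by (intro powr_mono2) (auto simp: S_def)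
        then show ?thesis unfolding ratio[of x m] by (rule mult_right_mono[OF _ B.weight_nonneg])
      qed
      note M = mult_L2_form_le[OF forms(2) forms(1) cutoff_smooth[OF e[of k], of "real k"]
          cutoff_bounds[of "e k" "real k"] this powr_ge_zero K(2)[OF e[of k]] t um(1)]
      have "(1 + t) * S powr (1 / real (Suc m)) * En m u u \<le> (1 + t) * S powr (1 / real (Suc m)) * C"
        using t um(2)[of m] by (intro mult_left_mono) auto
      with M show ?thesis by (auto intro: order_trans)
    qed
    then show "mult_L2 (?c k) u \<in> F" by blast
    have "(\<lambda>m. S powr (1 / real (Suc m))) \<longlonglongrightarrow> S powr 0"
      using S by (intro tendsto_intros LIMSEQ_Suc[OF lim_1_over_n]) auto
    then have "(\<lambda>m. (1 + t) * S powr (1 / real (Suc m)) * C + (1 + 1/t) * (K * (e k)\<^sup>2) * (norm u)\<^sup>2)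
       \<longlonglongrightarrow> (1 + t) * S powr 0 * C + (1 + 1/t) * (K * (e k)\<^sup>2) * (norm u)\<^sup>2"
      by (intro tendsto_add tendsto_mult tendsto_const)
    then show "E (mult_L2 (?c k) u) (mult_L2 (?c k) u) \<le> (1 + t) * C + (1 + 1/t) * (K * (e k)\<^sup>2) * (norm u)\<^sup>2"
      using LIMSEQ_le_const[of _ _ "E (mult_L2 (?c k) u) (mult_L2 (?c k) u)"] * S by fastforce
  qed
  have lim: "(\<lambda>k. mult_L2 (?c k) u) \<longlonglongrightarrow> u" by (rule mult_cutoff_tendsto[OF e])
  have *: "u \<in> F" "E u u \<le> (1 + t) * C" if t: "t > 0" for t
  proof -
    have "(\<lambda>k. (1 + t) * C + (1 + 1/t) * (K * (e k)\<^sup>2) * (norm u)\<^sup>2)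
       \<longlonglongrightarrow> (1 + t) * C + (1 + 1/t) * (K * 0\<^sup>2) * (norm u)\<^sup>2"
      unfolding e_def by (intro tendsto_intros LIMSEQ_Suc[OF lim_1_over_n])
    from A.strong_lsc[OF lim cut(1)[OF t] cut(2)[OF t] this]
    show "u \<in> F" "E u u \<le> (1 + t) * C" by auto
  qed
  have "u \<in> F" using *(1)[of 1] by simp
  moreover have "E u u \<le> C" by (rule le_if_le_all_larger) (rule *(2))
  ultimately show "extended_form E F u \<le> ereal C" by (simp add: extended_form_def)
qed

section \<open>The concrete weights\<close>

lemma conservative_weight_log:
  assumes "energy_form \<alpha> E F" "\<And>x. \<alpha> x = (2 + norm x)\<^sup>2 * ln (2 + norm x)"
  shows "conservative E F"
proof (rule conservative_radial[OF assms, where a' = "\<lambda>r. 2 * (2 + r) * ln (2 + r) + (2 + r)" and C = 6])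
  fix r :: real assume r: "0 \<le> r"
  show "((\<lambda>r. (2 + r)\<^sup>2 * ln (2 + r)) has_real_derivative 2 * (2 + r) * ln (2 + r) + (2 + r)) (at r)"
    using r by (auto intro!: derivative_eq_intros simp: power2_eq_square)
  have l: "0 \<le> ln (2 + r)" "ln (2 + r) \<le> ln (4 + r\<^sup>2)" "1 \<le> ln (4 + r\<^sup>2)"
    using r ln_two_plus_le[OF r] by (auto intro: ln_4_plus_ge_1)
  have "(2 + r)\<^sup>2 * ln (2 + r) \<le> (2 * (4 + r\<^sup>2)) * ln (4 + r\<^sup>2)"
    by (intro mult_mono two_plus_le r l) (use l in auto)
  then have 1: "(2 + r)\<^sup>2 * ln (2 + r) \<le> 2 * log_scale r" by (simp only: log_scale_def mult.assoc)
  have 2: "(2 + r)\<^sup>2 \<le> 2 * log_scale r"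
    by (rule order_trans[OF two_plus_le[OF r]]) (use log_scale_ge[of r] in simp)
  show "\<bar>(2 + r)\<^sup>2 * ln (2 + r)\<bar> \<le> 6 * log_scale r"
    using 1 l log_scale_pos[of r] by (simp add: abs_mult)
  have "r * \<bar>2 * (2 + r) * ln (2 + r) + (2 + r)\<bar> \<le> (2 + r) * (2 * (2 + r) * ln (2 + r) + (2 + r))"
    using r l by (intro mult_mono) auto
  also have "\<dots> = 2 * ((2 + r)\<^sup>2 * ln (2 + r)) + (2 + r)\<^sup>2" by (simp add: power2_eq_square algebra_simps)
  \<comment> \<open>Twice 2 for the logarithmic term and 2 for the square of 2 + r.\<close>
  also have "\<dots> \<le> 6 * log_scale r" using 1 2 log_scale_pos[of r] by linarith
  finally show "r * \<bar>2 * (2 + r) * ln (2 + r) + (2 + r)\<bar> \<le> 6 * log_scale r" .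
qed (auto intro!: continuous_intros)

text \<open>The missing power d absorbs one logarithm, since ln y \<le> y^d / d; the other logarithm
  goes into \<open>log_scale\<close>. This is why the constant is proportional to 1 / d.\<close>

lemma conservative_weight_powr:
  assumes "energy_form \<alpha> E F" "\<And>x. \<alpha> x = (2 + norm x) powr (2 - d) * (ln (2 + norm x))\<^sup>2" and d: "0 < d" "d \<le> 1"
  shows "conservative E F"
proof (rule conservative_radial[OF assms(1,2),
      where a' = "\<lambda>r. (2 + r) powr (1 - d) * ((2 - d) * (ln (2 + r))\<^sup>2 + 2 * ln (2 + r))" and C = "8 / d"])
  fix r :: real assume r: "0 \<le> r"
  have p: "0 < 2 + r" using r by simp
  have e: "(2 + r) powr (2 - d) = (2 + r) powr (1 - d) * (2 + r)" "(2 + r) powr (2 - d) = (2 + r)\<^sup>2 * (2 + r) powr (- d)"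
    using p powr_add[of "2 + r" "1 - d" 1] powr_add[of "2 + r" 2 "- d"] by (simp_all add: powr_numeral)
  have d1: "((\<lambda>r. (2 + r) powr (2 - d)) has_real_derivative (2 - d) * (2 + r) powr (1 - d)) (at r)"
    using p by (auto intro!: derivative_eq_intros)
  have d2: "((\<lambda>r. (ln (2 + r))\<^sup>2) has_real_derivative 2 * ln (2 + r) / (2 + r)) (at r)"
    using p by (auto intro!: derivative_eq_intros)
  have q: "2 * ln (2 + r) / (2 + r) * (2 + r) powr (2 - d) = 2 * ln (2 + r) * (2 + r) powr (1 - d)"
    unfolding e(1) using p by simp
  from DERIV_mult[OF d1 d2]
  show "((\<lambda>r. (2 + r) powr (2 - d) * (ln (2 + r))\<^sup>2) has_real_derivative
      (2 + r) powr (1 - d) * ((2 - d) * (ln (2 + r))\<^sup>2 + 2 * ln (2 + r))) (at r)"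
    unfolding q by (rule DERIV_cong) (simp add: algebra_simps)
  have l: "0 \<le> ln (2 + r)" "ln (2 + r) \<le> ln (4 + r\<^sup>2)" "1 \<le> ln (4 + r\<^sup>2)"
    using r ln_two_plus_le[OF r] by (auto intro: ln_4_plus_ge_1)
  have k: "(2 + r) powr (2 - d) * ln (2 + r) \<le> (1/d) * (2 * (4 + r\<^sup>2))"
  proof -
    have "ln (2 + r) \<le> (2 + r) powr d / d" using r d by (intro ln_powr_bound) auto
    then have "(2 + r) powr (- d) * ln (2 + r) \<le> (2 + r) powr (- d) * ((2 + r) powr d / d)"
      by (intro mult_left_mono) auto
    also have "\<dots> = 1 / d" using p by (simp add: powr_minus)
    finally have "(2 + r)\<^sup>2 * ((2 + r) powr (- d) * ln (2 + r)) \<le> (2 * (4 + r\<^sup>2)) * (1 / d)"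
      using d l by (intro mult_mono two_plus_le r) auto
    then show ?thesis unfolding e(2) by (simp add: mult_ac)
  qed
  have 1: "(2 + r) powr (2 - d) * (ln (2 + r))\<^sup>2 \<le> (2 / d) * log_scale r"
  proof -
    have "((2 + r) powr (2 - d) * ln (2 + r)) * ln (2 + r) \<le> ((1/d) * (2 * (4 + r\<^sup>2))) * ln (4 + r\<^sup>2)"
      using d l by (intro mult_mono k) auto
    also have "\<dots> = (2 / d) * log_scale r" by (simp add: log_scale_def)
    finally show ?thesis by (simp only: power2_eq_square mult.assoc)
  qed
  have 2: "(2 + r) powr (2 - d) * ln (2 + r) \<le> (2 / d) * log_scale r"
    using k mult_left_mono[OF log_scale_ge[of r], of "2 / d"] d by simp
  have D: "0 < log_scale r / d" using log_scale_pos[of r] d by simp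
  show "\<bar>(2 + r) powr (2 - d) * (ln (2 + r))\<^sup>2\<bar> \<le> (8 / d) * log_scale r"
    using 1 D by (simp add: abs_mult)
  have "r * \<bar>(2 + r) powr (1 - d) * ((2 - d) * (ln (2 + r))\<^sup>2 + 2 * ln (2 + r))\<bar>
    \<le> (2 + r) * ((2 + r) powr (1 - d) * (2 * (ln (2 + r))\<^sup>2 + 2 * ln (2 + r)))"
    using r l d by (intro mult_mono) (auto simp: abs_mult intro!: mult_left_mono add_mono mult_right_mono)
  also have "\<dots> = 2 * ((2 + r) powr (2 - d) * (ln (2 + r))\<^sup>2) + 2 * ((2 + r) powr (2 - d) * ln (2 + r))"
    unfolding e(1) by (simp add: algebra_simps)
  also have "\<dots> \<le> (8 / d) * log_scale r" using 1 2 by simp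
  finally show "r * \<bar>(2 + r) powr (1 - d) * ((2 - d) * (ln (2 + r))\<^sup>2 + 2 * ln (2 + r))\<bar> \<le> (8 / d) * log_scale r" .
qed (use d in \<open>auto intro!: continuous_intros\<close>)

lemma energy_formI:
  assumes "dirichlet_form E F \<and> regular_form E F" "smallest_closed_energy_extension \<alpha> E F"
    "continuous_on UNIV \<alpha>" "\<And>x. 0 < \<alpha> x"
  shows "energy_form \<alpha> E F"
  using assms by unfold_locales (auto intro: less_imp_le)

theorem proposition1p5:
  fixes \<alpha>n :: "nat \<Rightarrow> real ^ 'd \<Rightarrow> real" and \<alpha> :: "real ^ 'd \<Rightarrow> real"
    and En :: "nat \<Rightarrow> (real ^ 'd) L2 \<Rightarrow> (real ^ 'd) L2 \<Rightarrow> real" and Fn :: "nat \<Rightarrow> (real ^ 'd) L2 set"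
    and E :: "(real ^ 'd) L2 \<Rightarrow> (real ^ 'd) L2 \<Rightarrow> real" and F :: "(real ^ 'd) L2 set"
  assumes "\<And>n x. n \<ge> 1 \<Longrightarrow> \<alpha>n n x > 0"
    and "\<And>x. \<alpha> x > 0"
    and "\<And>n. n \<ge> 1 \<Longrightarrow> dirichlet_form (En n) (Fn n) \<and> regular_form (En n) (Fn n)"
    and "dirichlet_form E F \<and> regular_form E F"
    and "\<And>n. n \<ge> 1 \<Longrightarrow> smallest_closed_energy_extension (\<alpha>n n) (En n) (Fn n)"
    and "smallest_closed_energy_extension \<alpha> E F"
  shows
    "((\<forall>n\<ge>1. \<forall>x. \<alpha>n n x = (2 + norm x) ^ 2 * ln (2 + norm x) powr (1 + 1 / real n)) \<and>
      (\<forall>x. \<alpha> x = (2 + norm x) ^ 2 * ln (2 + norm x)) \<longrightarrow>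
        (\<forall>n\<ge>1. explosive (En n) (Fn n)) \<and>
        mosco_converges (\<lambda>n. En (Suc n)) (\<lambda>n. Fn (Suc n)) E F \<and>
        conservative E F) \<and>
     ((\<forall>n\<ge>1. \<forall>x. \<alpha>n n x = (2 + norm x) powr (2 - 1 / real n) * (ln (2 + norm x)) ^ 2) \<and>
      (\<forall>x. \<alpha> x = (2 + norm x) ^ 2 * (ln (2 + norm x)) ^ 2) \<longrightarrow>
        (\<forall>n\<ge>1. conservative (En n) (Fn n)) \<and>
        mosco_converges (\<lambda>n. En (Suc n)) (\<lambda>n. Fn (Suc n)) E F \<and>
        explosive E F)"
proof (intro conjI impI)
  have ge2: "0 < 2 + norm x" "1 < 2 + norm x" "2 + norm x \<noteq> 0" "ln (2 + norm x) \<noteq> 0" "ln 2 \<le> ln (2 + norm x)" "0 < ln (2 + norm x)"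
    for x :: "real ^ 'd"
    by (auto simp: add_pos_nonneg add_nonneg_eq_0_iff)
  {
    assume "(\<forall>n\<ge>1. \<forall>x. \<alpha>n n x = (2 + norm x) ^ 2 * ln (2 + norm x) powr (1 + 1 / real n)) \<and>
      (\<forall>x. \<alpha> x = (2 + norm x) ^ 2 * ln (2 + norm x))"
    then have \<alpha>n: "\<And>n x. n \<ge> 1 \<Longrightarrow> \<alpha>n n x = (2 + norm x) ^ 2 * ln (2 + norm x) powr (1 + 1 / real n)"
      and \<alpha>: "\<And>x. \<alpha> x = (2 + norm x) ^ 2 * ln (2 + norm x)" by auto
    have cn: "continuous_on UNIV (\<alpha>n n)" if "n \<ge> 1" for n
      using \<alpha>n[OF that] ge2 by (simp cong: continuous_on_cong) (intro continuous_intros, auto)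
    have c: "continuous_on UNIV \<alpha>"
      using \<alpha> ge2 by (simp cong: continuous_on_cong) (intro continuous_intros, auto)
    have fn: "energy_form (\<alpha>n n) (En n) (Fn n)" if "n \<ge> 1" for n
      by (rule energy_formI[OF assms(3,5)[OF that] cn[OF that] assms(1)[OF that]])
    have f: "energy_form \<alpha> E F" by (rule energy_formI[OF assms(4,6) c assms(2)])
    show "\<forall>n\<ge>1. explosive (En n) (Fn n)"
    proof (intro allI impI)
      fix n :: nat assume n: "1 \<le> n"
      show "explosive (En n) (Fn n)" by (rule explosive_radial[OF fn[OF n] _ \<alpha>n[OF n]]) (use n in simp)
    qed
    show "conservative E F" by (rule conservative_weight_log[OF f \<alpha>])
    show "mosco_converges (\<lambda>n. En (Suc n)) (\<lambda>n. Fn (Suc n)) E F"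
      unfolding mosco_converges_def
    proof (intro conjI allI impI)
      fix u un assume wk: "weakly_converges un (u :: (real ^ 'd) L2)"
      show "extended_form E F u \<le> liminf (\<lambda>n. extended_form (En (Suc n)) (Fn (Suc n)) (un n))"
      proof (rule mosco_liminf_comparable[OF _ _ _ wk])
        show "closed_form E F" "closure F = UNIV" using assms(4) by (auto simp: dirichlet_form_def)
        fix t :: real assume t: "t > 0"
        \<comment> \<open>The ratio of \<alpha> to its approximant is ln (2 + |x|) to the power
          -1/(n + 1). It is largest at the origin, where it is this sequence.\<close>
        have "(\<lambda>n. ln 2 powr (- (1 / real (Suc n)))) \<longlonglongrightarrow> ln 2 powr (- 0)"
          by (intro tendsto_intros LIMSEQ_Suc[OF lim_1_over_n]) auto
        then have "\<forall>\<^sub>F n in sequentially. ln 2 powr (- (1 / real (Suc n))) < 1 + t"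
          using t by (intro order_tendstoD(2)) auto
        then show "\<forall>\<^sub>F n in sequentially. \<forall>v\<in>Fn (Suc n). v \<in> F \<and> E v v \<le> (1 + t) * En (Suc n) v v"
        proof eventually_elim
          case (elim n)
          have le: "\<alpha> x \<le> (1 + t) * \<alpha>n (Suc n) x" for x
          proof -
            have "1 = ln 2 powr (- (1 / real (Suc n))) * ln 2 powr (1 / real (Suc n))"
              by (simp add: powr_add[symmetric])
            also have "\<dots> \<le> (1 + t) * ln (2 + norm x) powr (1 / real (Suc n))"
              using elim ge2[of x] t by (intro mult_mono powr_mono2) auto
            finally have "((2 + norm x)\<^sup>2 * ln (2 + norm x)) * 1
              \<le> ((2 + norm x)\<^sup>2 * ln (2 + norm x)) * ((1 + t) * ln (2 + norm x) powr (1 / real (Suc n)))"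
              using ge2[of x] by (intro mult_left_mono) auto
            then show ?thesis using ge2[of x] by (simp add: \<alpha> \<alpha>n powr_add mult_ac)
          qed
          show ?case using energy_form_mono[OF f fn le] by simp
        qed
      qed
    next
      fix u :: "(real ^ 'd) L2"
      show "\<exists>un. un \<longlonglongrightarrow> u \<and> limsup (\<lambda>n. extended_form (En (Suc n)) (Fn (Suc n)) (un n)) \<le> extended_form E F u"
      proof (rule recovery_sequence[of "\<lambda>n. \<alpha>n (Suc n)" _ _ \<alpha> _ _ "\<lambda>x. (2 + norm x)\<^sup>2 * (ln (2 + norm x) * (1 + ln (2 + norm x)))"])
        show "energy_form (\<alpha>n (Suc n)) (En (Suc n)) (Fn (Suc n))" for n by (rule fn) simp
        show "energy_form \<alpha> E F" by (rule f)
        show "continuous_on UNIV (\<lambda>x::real ^ 'd. (2 + norm x)\<^sup>2 * (ln (2 + norm x) * (1 + ln (2 + norm x))))"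
          using ge2 by (intro continuous_intros) auto
        fix x :: "real ^ 'd"
        have "(\<lambda>n. (2 + norm x)\<^sup>2 * ln (2 + norm x) powr (1 + 1 / real (Suc n))) \<longlonglongrightarrow> (2 + norm x)\<^sup>2 * ln (2 + norm x) powr (1 + 0)"
          using ge2[of x] by (intro tendsto_intros LIMSEQ_Suc[OF lim_1_over_n]) auto
        then show "(\<lambda>n. \<alpha>n (Suc n) x) \<longlonglongrightarrow> \<alpha> x" using ge2[of x] by (simp add: \<alpha> \<alpha>n)
        fix n
        let ?l = "ln (2 + norm x)" and ?p = "1 / real (Suc n)"
        \<comment> \<open>The exponent is at most 1, and near the origin the logarithm is below 1;
          the sum 1 + l dominates in both regimes.\<close>
        have "?l powr ?p \<le> 1 + ?l"
        proof (cases "?l \<le> 1")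
          case True
          then have "?l powr ?p \<le> 1 powr ?p" using ge2[of x] by (intro powr_mono2) auto
          moreover have "1 powr ?p = 1" by simp
          ultimately show ?thesis using ge2(6)[of x] by linarith
        next
          case False
          then have "?l powr ?p \<le> ?l powr 1" by (intro powr_mono) auto
          then show ?thesis using False by simp
        qed
        then have "(2 + norm x)\<^sup>2 * (?l * ?l powr ?p) \<le> (2 + norm x)\<^sup>2 * (?l * (1 + ?l))"
          using ge2[of x] by (intro mult_left_mono) auto
        moreover have "\<alpha>n (Suc n) x = (2 + norm x)\<^sup>2 * (?l * ?l powr ?p)"
          using ge2[of x] by (simp add: \<alpha>n powr_add)
        ultimately show "\<bar>\<alpha>n (Suc n) x\<bar> \<le> (2 + norm x)\<^sup>2 * (?l * (1 + ?l))"
          using assms(1)[of "Suc n" x] by simp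
      qed
    qed
  }
  {
    assume "(\<forall>n\<ge>1. \<forall>x. \<alpha>n n x = (2 + norm x) powr (2 - 1 / real n) * (ln (2 + norm x)) ^ 2) \<and>
      (\<forall>x. \<alpha> x = (2 + norm x) ^ 2 * (ln (2 + norm x)) ^ 2)"
    then have \<alpha>n: "\<And>n x. n \<ge> 1 \<Longrightarrow> \<alpha>n n x = (2 + norm x) powr (2 - 1 / real n) * (ln (2 + norm x)) ^ 2"
      and \<alpha>: "\<And>x. \<alpha> x = (2 + norm x) ^ 2 * (ln (2 + norm x)) ^ 2" by auto
    have cn: "continuous_on UNIV (\<alpha>n n)" if "n \<ge> 1" for n
      using \<alpha>n[OF that] ge2 by (simp cong: continuous_on_cong) (intro continuous_intros, auto)
    have c: "continuous_on UNIV \<alpha>"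
      using \<alpha> ge2 by (simp cong: continuous_on_cong) (intro continuous_intros, auto)
    have fn: "energy_form (\<alpha>n n) (En n) (Fn n)" if "n \<ge> 1" for n
      by (rule energy_formI[OF assms(3,5)[OF that] cn[OF that] assms(1)[OF that]])
    have f: "energy_form \<alpha> E F" by (rule energy_formI[OF assms(4,6) c assms(2)])
    show "\<forall>n\<ge>1. conservative (En n) (Fn n)"
    proof (intro allI impI)
      fix n :: nat assume n: "1 \<le> n"
      show "conservative (En n) (Fn n)"
        by (rule conservative_weight_powr[OF fn[OF n] \<alpha>n[OF n]]) (use n in auto)
    qed
    show "explosive E F"
    \<comment> \<open>The squared logarithm is the case d = 1 of the explosion criterion.\<close>
    proof (rule explosive_radial[OF f, of 1])
      show "\<alpha> x = (2 + norm x)\<^sup>2 * ln (2 + norm x) powr (1 + 1)" for x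
        using ge2[of x] by (simp add: \<alpha> powr_numeral)
    qed simp
    show "mosco_converges (\<lambda>n. En (Suc n)) (\<lambda>n. Fn (Suc n)) E F"
      unfolding mosco_converges_def
    proof (intro conjI allI impI)
      fix u un assume wk: "weakly_converges un (u :: (real ^ 'd) L2)"
      show "extended_form E F u \<le> liminf (\<lambda>n. extended_form (En (Suc n)) (Fn (Suc n)) (un n))"
        by (rule mosco_liminf_increasing[of "\<lambda>n. \<alpha>n (Suc n)" _ _ \<alpha>, OF fn f \<alpha>n \<alpha> wk]) auto
    next
      fix u :: "(real ^ 'd) L2"
      show "\<exists>un. un \<longlonglongrightarrow> u \<and> limsup (\<lambda>n. extended_form (En (Suc n)) (Fn (Suc n)) (un n)) \<le> extended_form E F u"
      \<comment> \<open>The approximating weights lie below their limit, so \<alpha> itself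
        dominates.\<close>
      proof (rule recovery_sequence[of "\<lambda>n. \<alpha>n (Suc n)" _ _ \<alpha> _ _ \<alpha>])
        show "energy_form (\<alpha>n (Suc n)) (En (Suc n)) (Fn (Suc n))" for n by (rule fn) simp
        show "energy_form \<alpha> E F" by (rule f)
        show "continuous_on UNIV \<alpha>" by (rule c)
        fix x :: "real ^ 'd"
        have "(\<lambda>n. (2 + norm x) powr (2 - 1 / real (Suc n)) * (ln (2 + norm x))\<^sup>2) \<longlonglongrightarrow> (2 + norm x) powr (2 - 0) * (ln (2 + norm x))\<^sup>2"
          using ge2[of x] by (intro tendsto_intros LIMSEQ_Suc[OF lim_1_over_n]) auto
        then show "(\<lambda>n. \<alpha>n (Suc n) x) \<longlonglongrightarrow> \<alpha> x" using ge2[of x] by (simp add: \<alpha> \<alpha>n powr_numeral)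
        fix n
        have "(2 + norm x) powr (2 - 1 / real (Suc n)) \<le> (2 + norm x) powr 2"
          using ge2[of x] by (intro powr_mono) auto
        then have "\<alpha>n (Suc n) x \<le> \<alpha> x"
          using ge2[of x] by (simp add: \<alpha> \<alpha>n powr_numeral mult_right_mono)
        then show "\<bar>\<alpha>n (Suc n) x\<bar> \<le> \<alpha> x" using assms(1)[of "Suc n" x] by simp
      qed
    qed
  }
qed

end
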